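(* Let $\Gamma,\Lambda$ be countable groups and let $\Gamma\curvearrowright(X,\mu_X)$, $\Lambda\curvearrowright(Y,\mu_Y)$ be essentially free measure preserving actions on standard Borel probability spaces. (1) Let $T:X\to Y$ be a measurable isomorphism defining an orbit equivalence between the two actions. Then for every measurable coefficient $(\Lambda\ltimes Y)$-module $E$ (regarded as a $(\Gamma\ltimes X)$-module by pullback along the induced groupoid homomorphism $f_T$) there are isometric isomorphisms $$\mathrm{H}^\bullet_{mb}(\Lambda\ltimes Y,E)\cong\mathrm{H}^\bullet_{mb}(\Gamma\ltimes X,E).$$ (2) If both actions are moreover ergodic, then a weak orbit equivalence between them induces isomorphisms $$\mathrm{H}^\bullet_{mb}(\Lambda\ltimes Y,E)\cong\mathrm{H}^\bullet_{mb}(\Gamma\ltimes X,E)$$ for every measurable coefficient $(\Lambda\ltimes Y)$-module $E$ (regarded as a $(\Gamma\ltimes X)$-module via the weak orbit equivalence).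
   Context: **Semidirect groupoid.** For a countable group $\Gamma$ acting measure preservingly on a standard Borel probability space $(X,\mu)$, $\mathcal{G}=\Gamma\ltimes X$ is the groupoid with underlying set $\Gamma\times X$, unit space $X$, $s(\gamma,x)=x$, $t(\gamma,x)=\gamma x$, $(\gamma',\gamma x)(\gamma,x)=(\gamma'\gamma,x)$, $(\gamma,x)^{-1}=(\gamma^{-1},\gamma x)$, and measure class of (counting)$\times\mu$. For $U\subset X$ Borel, $\mathcal{G}_{|U}=\{g:s(g),t(g)\in U\}$. **Coefficients.** A measurable coefficient $\mathcal{G}$-module $(E,L)$: $E=(E^\flat)^*$ with $E^\flat$ separable Banach, with $L^\flat:\mathcal{G}\to\mathrm{Isom}(E^\flat)$ multiplicative on almost every composable pair and with $g\mapsto L^\flat(g)v$ measurable for every $v$; $L$ is the contragredient, $\langle L(g)\lambda,v\rangle=\langle\lambda,L^\flat(g^{-1})v\rangle$. Pullback along $f:\mathcal{G}\to\mathcal{H}$: action $g\mapsto L(f(g))$. **Measurable bounded cohomology.** Let $\nu$ be a symmetric probability measure in the class of $\mathcal{G}$ with disintegration $\nu=\int\nu^x\,d\mu(x)$ along $t$ (where now $\mu=t_*\nu$). $\mathcal{G}^{(n)}$ is the set of $n$-tuples in $\mathcal{G}$ with common target, with measure $\nu^{(n)}=\int(\nu^x)^{\otimes n}d\mu(x)$. $L^\infty_{w^*}(\mathcal{G}^{(n)},E)$: weak$^*$ measurable essentially bounded functions modulo a.e. equality, with essential sup norm; $\lambda$ is $\mathcal{G}$-invariant if $L(g)\lambda(g^{-1}g_1,\dots,g^{-1}g_n)=\lambda(g_1,\dots,g_n)$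 for $\nu^{(n+1)}$-a.e. $(g,g_1,\dots,g_n)\in\mathcal{G}^{(n+1)}$. $\mathrm{H}^k_{mb}(\mathcal{G},E)$ is the $k$-th cohomology of $\big(L^\infty_{w^*}(\mathcal{G}^{(k+1)},E)^{\mathcal{G}}\big)_{k\ge0}$ with the homogeneous coboundary $\delta\lambda(g_1,\dots,g_{k+2})=\sum_i(-1)^{i-1}\lambda(\dots,\widehat{g_i},\dots)$, with the quotient seminorm. **Orbit equivalence.** An orbit equivalence is a Borel map $T:X\to Y$ with $T_*\mu_X=\mu_Y$ restricting to a Borel isomorphism between conull Borel sets $X'\subset X$, $Y'\subset Y$ with $T(\Gamma x\cap X')=\Lambda T(x)\cap Y'$ for $x\in X'$. It defines a.e. a cocycle $\sigma_T:\Gamma\times X\to\Lambda$ by $T(\gamma x)=\sigma_T(\gamma,x)T(x)$, and $f_T:\Gamma\ltimes X\to\Lambda\ltimes Y$, $f_T(\gamma,x)=(\sigma_T(\gamma,x),T(x))$. A weak orbit equivalence is an orbit equivalence $T:U\to V$ between positive measure subsets $U\subset X$, $V\subset Y$ with normalized restricted measures (orbits intersected with $U$, $V$); it induces an isomorphism $f_T:(\Gamma\ltimes X)_{|U}\to(\Lambda\ltimes Y)_{|V}$ (after discarding null sets). When the actions are ergodic there is a Borel map $\vartheta$ defined a.e. on $X$ with values in $\Gamma\ltimes X$ with $s(\vartheta(x))=x$, $t(\vartheta(x))\in U$; the $(\Gamma\ltimes X)$-structure on $E$ via the weak orbit equivalence is the pullback along $g\mapsto f_T(\vartheta(t(g))\,g\,\vartheta(s(g))^{-1})$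 (different $\vartheta$ give isomorphic modules). *)

theory Defs
  imports "HOL-Probability.Probability" "HOL-Algebra.Group_Action"
begin

section \<open>Measure preserving actions\<close>

definition standard_borel :: "'x measure \<Rightarrow> bool" where
  "standard_borel M \<longleftrightarrow>
     (\<exists>T. completely_metrizable_space T \<and> second_countable T \<and> topspace T = space M \<and>
          sets M = sigma_sets (space M) {W. openin T W})"

locale pmp_action =
  group_action \<Gamma> "space M" \<phi> + prob_space M
  for \<Gamma> :: "('g, 'm) monoid_scheme" (structure) and \<phi> :: "'g \<Rightarrow> 'x \<Rightarrow> 'x" and M :: "'x measure" +
  assumes countable_group: "countable (carrier \<Gamma>)"
    and standard: "standard_borel M"
    and measurable_action: "\<gamma> \<in> carrier \<Gamma> \<Longrightarrow> \<phi> \<gamma> \<in> M \<rightarrow>\<^sub>M M"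
    and measure_preserving: "\<gamma> \<in> carrier \<Gamma> \<Longrightarrow> distr M M (\<phi> \<gamma>) = M"

definition essentially_free ::
    "('g, 'm) monoid_scheme \<Rightarrow> ('g \<Rightarrow> 'x \<Rightarrow> 'x) \<Rightarrow> 'x measure \<Rightarrow> bool" where
  "essentially_free \<Gamma> \<phi> M \<longleftrightarrow> (AE x in M. stabilizer \<Gamma> \<phi> x = {\<one>\<^bsub>\<Gamma>\<^esub>})"

definition ergodic_action ::
    "('g, 'm) monoid_scheme \<Rightarrow> ('g \<Rightarrow> 'x \<Rightarrow> 'x) \<Rightarrow> 'x measure \<Rightarrow> bool" where
  "ergodic_action \<Gamma> \<phi> M \<longleftrightarrow>
     (\<forall>A\<in>sets M. (\<forall>\<gamma>\<in>carrier \<Gamma>. \<phi> \<gamma> ` A = A) \<longrightarrow> A \<in> null_sets M \<or> space M - A \<in> null_sets M)"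


section \<open>Measured groupoids and coefficient modules\<close>

text \<open>The measure on the arrows only matters through its null sets.\<close>

record ('a, 'x) mgroupoid =
  arrows :: "'a measure"
  units :: "'x measure"
  source :: "'a \<Rightarrow> 'x"
  target :: "'a \<Rightarrow> 'x"
  gmult :: "'a \<Rightarrow> 'a \<Rightarrow> 'a"
  ginv :: "'a \<Rightarrow> 'a"

definition semidirect ::
    "('g, 'm) monoid_scheme \<Rightarrow> ('g \<Rightarrow> 'x \<Rightarrow> 'x) \<Rightarrow> 'x measure \<Rightarrow> ('g \<times> 'x, 'x) mgroupoid" where
  "semidirect \<Gamma> \<phi> M =
     \<lparr>arrows = count_space (carrier \<Gamma>) \<Otimes>\<^sub>M M,
      units = M,
      source = (\<lambda>(\<gamma>, x). x),
      target = (\<lambda>(\<gamma>, x). \<phi> \<gamma> x),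
      gmult = (\<lambda>(\<gamma>', y) (\<gamma>, x). (\<gamma>' \<otimes>\<^bsub>\<Gamma>\<^esub> \<gamma>, x)),
      ginv = (\<lambda>(\<gamma>, x). (inv\<^bsub>\<Gamma>\<^esub> \<gamma>, \<phi> \<gamma> x))\<rparr>"

type_synonym 'e dual = "'e \<Rightarrow>\<^sub>L real"

text \<open>
  The sort \<open>{banach, second_countable_topology}\<close> expresses a separable Banach space.
  The groupoids considered have countable fibres, and the measure class on composable pairs is the
  one of \<open>\<integral> (counting measure on {h. s h = t g}) dg\<close>. A property therefore holds for almost every
  composable pair \<open>(h, g)\<close> iff, for almost every \<open>g\<close>, it holds for all \<open>h\<close> with \<open>s h = t g\<close>.
\<close>

definition coefficient_module ::
    "('a, 'x) mgroupoid \<Rightarrow> ('a \<Rightarrow> ('e::{banach, second_countable_topology} \<Rightarrow>\<^sub>L 'e)) \<Rightarrow> bool" where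
  "coefficient_module G L\<^sub>b \<longleftrightarrow>
     (\<forall>g\<in>space (arrows G). (\<forall>v. norm (L\<^sub>b g v) = norm v) \<and> surj (blinfun_apply (L\<^sub>b g))) \<and>
     (AE g in arrows G. \<forall>h\<in>space (arrows G). source G h = target G g \<longrightarrow>
        L\<^sub>b (gmult G h g) = L\<^sub>b h o\<^sub>L L\<^sub>b g) \<and>
     (\<forall>v. (\<lambda>g. L\<^sub>b g v) \<in> borel_measurable (arrows G))"

definition contragredient ::
    "('a, 'x) mgroupoid \<Rightarrow> ('a \<Rightarrow> ('e::real_normed_vector \<Rightarrow>\<^sub>L 'e)) \<Rightarrow> 'a \<Rightarrow> 'e dual \<Rightarrow> 'e dual" where
  "contragredient G L\<^sub>b g \<xi> = \<xi> o\<^sub>L L\<^sub>b (ginv G g)"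


section \<open>Measurable bounded cohomology\<close>

definition symmetric_class_prob :: "('a, 'x) mgroupoid \<Rightarrow> 'a measure \<Rightarrow> bool" where
  "symmetric_class_prob G \<nu> \<longleftrightarrow>
     prob_space \<nu> \<and> sets \<nu> = sets (arrows G) \<and> null_sets \<nu> = null_sets (arrows G) \<and>
     distr \<nu> \<nu> (ginv G) = \<nu>"

definition base_measure :: "('a, 'x) mgroupoid \<Rightarrow> 'a measure \<Rightarrow> 'x measure" where
  "base_measure G \<nu> = distr \<nu> (units G) (target G)"

definition disintegration ::
    "('a, 'x) mgroupoid \<Rightarrow> 'a measure \<Rightarrow> ('x \<Rightarrow> 'a measure) \<Rightarrow> bool" where
  "disintegration G \<nu> \<kappa> \<longleftrightarrow>
     \<kappa> \<in> units G \<rightarrow>\<^sub>M prob_algebra (arrows G) \<and>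
     (AE x in base_measure G \<nu>. AE g in \<kappa> x. target G g = x) \<and>
     \<nu> = base_measure G \<nu> \<bind> \<kappa>"

text \<open>
  An \<open>n\<close>-tuple \<open>(g\<^sub>1, \<dots>, g\<^sub>n)\<close> is a function on \<open>{..<n}\<close>, so indices are shifted by one.
\<close>

definition tuple_measure ::
    "('a, 'x) mgroupoid \<Rightarrow> 'a measure \<Rightarrow> ('x \<Rightarrow> 'a measure) \<Rightarrow> nat \<Rightarrow> (nat \<Rightarrow> 'a) measure" where
  "tuple_measure G \<nu> \<kappa> n =
     restrict_space (base_measure G \<nu> \<bind> (\<lambda>x. \<Pi>\<^sub>M i\<in>{..<n}. \<kappa> x))
       {gs. \<forall>i<n. \<forall>j<n. target G (gs i) = target G (gs j)}"

definition Linf_wstar :: "'b measure \<Rightarrow> ('b \<Rightarrow> 'e::real_normed_vector dual) set" where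
  "Linf_wstar M =
     {\<xi>. (\<forall>v. (\<lambda>\<omega>. blinfun_apply (\<xi> \<omega>) v) \<in> borel_measurable M) \<and>
         (\<exists>C. AE \<omega> in M. norm (\<xi> \<omega>) \<le> C)}"

definition Linf_norm :: "'b measure \<Rightarrow> ('b \<Rightarrow> 'e::real_normed_vector dual) \<Rightarrow> real" where
  "Linf_norm M \<xi> = real_of_ereal (esssup M (\<lambda>\<omega>. ereal (norm (\<xi> \<omega>))))"

definition invariant_fun ::
    "('a, 'x) mgroupoid \<Rightarrow> 'a measure \<Rightarrow> ('x \<Rightarrow> 'a measure) \<Rightarrow>
     ('a \<Rightarrow> 'e::real_normed_vector dual \<Rightarrow> 'e dual) \<Rightarrow> nat \<Rightarrow> ((nat \<Rightarrow> 'a) \<Rightarrow> 'e dual) \<Rightarrow> bool" where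
  "invariant_fun G \<nu> \<kappa> L n \<xi> \<longleftrightarrow>
     (AE gs in tuple_measure G \<nu> \<kappa> (Suc n).
        L (gs 0) (\<xi> (\<lambda>i\<in>{..<n}. gmult G (ginv G (gs 0)) (gs (Suc i)))) =
        \<xi> (\<lambda>i\<in>{..<n}. gs (Suc i)))"

definition cochains ::
    "('a, 'x) mgroupoid \<Rightarrow> 'a measure \<Rightarrow> ('x \<Rightarrow> 'a measure) \<Rightarrow>
     ('a \<Rightarrow> 'e::real_normed_vector dual \<Rightarrow> 'e dual) \<Rightarrow> nat \<Rightarrow> ((nat \<Rightarrow> 'a) \<Rightarrow> 'e dual) set" where
  "cochains G \<nu> \<kappa> L k =
     {\<xi> \<in> Linf_wstar (tuple_measure G \<nu> \<kappa> (k + 1)). invariant_fun G \<nu> \<kappa> L (k + 1) \<xi>}"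

definition coboundary ::
    "nat \<Rightarrow> ((nat \<Rightarrow> 'a) \<Rightarrow> 'e::real_normed_vector dual) \<Rightarrow> (nat \<Rightarrow> 'a) \<Rightarrow> 'e dual" where
  "coboundary k \<xi> gs =
     (\<Sum>i<k + 2. (- 1) ^ i *\<^sub>R \<xi> (\<lambda>j\<in>{..<k + 1}. if j < i then gs j else gs (Suc j)))"

definition cocycles ::
    "('a, 'x) mgroupoid \<Rightarrow> 'a measure \<Rightarrow> ('x \<Rightarrow> 'a measure) \<Rightarrow>
     ('a \<Rightarrow> 'e::real_normed_vector dual \<Rightarrow> 'e dual) \<Rightarrow> nat \<Rightarrow> ((nat \<Rightarrow> 'a) \<Rightarrow> 'e dual) set" where
  "cocycles G \<nu> \<kappa> L k =
     {\<xi> \<in> cochains G \<nu> \<kappa> L k. AE gs in tuple_measure G \<nu> \<kappa> (k + 2). coboundary k \<xi> gs = 0}"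

definition coboundaries ::
    "('a, 'x) mgroupoid \<Rightarrow> 'a measure \<Rightarrow> ('x \<Rightarrow> 'a measure) \<Rightarrow>
     ('a \<Rightarrow> 'e::real_normed_vector dual \<Rightarrow> 'e dual) \<Rightarrow> nat \<Rightarrow> ((nat \<Rightarrow> 'a) \<Rightarrow> 'e dual) set" where
  "coboundaries G \<nu> \<kappa> L k =
     {\<xi> \<in> cochains G \<nu> \<kappa> L k.
        case k of
          0 \<Rightarrow> AE gs in tuple_measure G \<nu> \<kappa> (k + 1). \<xi> gs = 0
        | Suc j \<Rightarrow> \<exists>\<eta>\<in>cochains G \<nu> \<kappa> L j.
                     AE gs in tuple_measure G \<nu> \<kappa> (k + 1). \<xi> gs = coboundary j \<eta> gs}"

text \<open>
  Cochains are functions rather than almost everywhere classes. Almost everywhere vanishing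
  functions count as coboundaries, so that \<open>cohomology_class\<close> passes to almost everywhere classes
  and to cohomology classes at the same time.
\<close>

definition cohomology_class ::
    "('a, 'x) mgroupoid \<Rightarrow> 'a measure \<Rightarrow> ('x \<Rightarrow> 'a measure) \<Rightarrow>
     ('a \<Rightarrow> 'e::real_normed_vector dual \<Rightarrow> 'e dual) \<Rightarrow> nat \<Rightarrow> ((nat \<Rightarrow> 'a) \<Rightarrow> 'e dual) \<Rightarrow>
     ((nat \<Rightarrow> 'a) \<Rightarrow> 'e dual) set" where
  "cohomology_class G \<nu> \<kappa> L k \<xi> =
     {\<xi>' \<in> cocycles G \<nu> \<kappa> L k. (\<lambda>gs. \<xi>' gs - \<xi> gs) \<in> coboundaries G \<nu> \<kappa> L k}"

record 'v seminormed =
  vcarrier :: "'v set"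
  vadd :: "'v \<Rightarrow> 'v \<Rightarrow> 'v"
  vscale :: "real \<Rightarrow> 'v \<Rightarrow> 'v"
  vnorm :: "'v \<Rightarrow> real"

definition Hmb ::
    "('a, 'x) mgroupoid \<Rightarrow> 'a measure \<Rightarrow> ('x \<Rightarrow> 'a measure) \<Rightarrow>
     ('a \<Rightarrow> 'e::real_normed_vector dual \<Rightarrow> 'e dual) \<Rightarrow> nat \<Rightarrow>
     ((nat \<Rightarrow> 'a) \<Rightarrow> 'e dual) set seminormed" where
  "Hmb G \<nu> \<kappa> L k =
     \<lparr>vcarrier = cohomology_class G \<nu> \<kappa> L k ` cocycles G \<nu> \<kappa> L k,
      vadd = (\<lambda>P Q. \<Union>p\<in>P. \<Union>q\<in>Q. cohomology_class G \<nu> \<kappa> L k (\<lambda>gs. p gs + q gs)),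
      vscale = (\<lambda>c P. \<Union>p\<in>P. cohomology_class G \<nu> \<kappa> L k (\<lambda>gs. c *\<^sub>R p gs)),
      vnorm = (\<lambda>P. INF p\<in>P. Linf_norm (tuple_measure G \<nu> \<kappa> (k + 1)) p)\<rparr>"

definition linear_iso :: "'v seminormed \<Rightarrow> 'w seminormed \<Rightarrow> ('v \<Rightarrow> 'w) \<Rightarrow> bool" where
  "linear_iso V W \<Phi> \<longleftrightarrow>
     bij_betw \<Phi> (vcarrier V) (vcarrier W) \<and>
     (\<forall>P\<in>vcarrier V. \<forall>Q\<in>vcarrier V. \<Phi> (vadd V P Q) = vadd W (\<Phi> P) (\<Phi> Q)) \<and>
     (\<forall>c. \<forall>P\<in>vcarrier V. \<Phi> (vscale V c P) = vscale W c (\<Phi> P))"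

definition isometric_iso :: "'v seminormed \<Rightarrow> 'w seminormed \<Rightarrow> ('v \<Rightarrow> 'w) \<Rightarrow> bool" where
  "isometric_iso V W \<Phi> \<longleftrightarrow> linear_iso V W \<Phi> \<and> (\<forall>P\<in>vcarrier V. vnorm W (\<Phi> P) = vnorm V P)"

text \<open>Isomorphism of seminormed spaces: a linear bijection, bounded together with its inverse.\<close>

definition seminormed_iso :: "'v seminormed \<Rightarrow> 'w seminormed \<Rightarrow> ('v \<Rightarrow> 'w) \<Rightarrow> bool" where
  "seminormed_iso V W \<Phi> \<longleftrightarrow> linear_iso V W \<Phi> \<and>
     (\<exists>C. \<forall>P\<in>vcarrier V. vnorm W (\<Phi> P) \<le> C * vnorm V P \<and> vnorm V P \<le> C * vnorm W (\<Phi> P))"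

text \<open>
  \<open>\<Phi>\<close> is the map \<open>[\<xi>] \<mapsto> [\<xi> \<circ> F]\<close> from the cohomology of \<open>H\<close> to that of \<open>G\<close>. Since \<open>F\<close> is only
  determined almost everywhere, \<open>\<xi> \<circ> F\<close> is only required to agree almost everywhere with a member of
  the class \<open>\<Phi> [\<xi>]\<close>.
\<close>

definition induced_by ::
    "('b, 'y) mgroupoid \<Rightarrow> 'b measure \<Rightarrow> ('y \<Rightarrow> 'b measure) \<Rightarrow>
     ('a, 'x) mgroupoid \<Rightarrow> 'a measure \<Rightarrow> ('x \<Rightarrow> 'a measure) \<Rightarrow>
     ('b \<Rightarrow> 'e::real_normed_vector dual \<Rightarrow> 'e dual) \<Rightarrow> nat \<Rightarrow> ('a \<Rightarrow> 'b) \<Rightarrow>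
     (((nat \<Rightarrow> 'b) \<Rightarrow> 'e dual) set \<Rightarrow> ((nat \<Rightarrow> 'a) \<Rightarrow> 'e dual) set) \<Rightarrow> bool" where
  "induced_by H \<nu>\<^sub>H \<kappa>\<^sub>H G \<nu>\<^sub>G \<kappa>\<^sub>G L k F \<Phi> \<longleftrightarrow>
     (\<forall>P\<in>vcarrier (Hmb H \<nu>\<^sub>H \<kappa>\<^sub>H L k). \<forall>\<xi>\<in>P. \<exists>\<xi>'\<in>\<Phi> P.
        AE gs in tuple_measure G \<nu>\<^sub>G \<kappa>\<^sub>G (k + 1). \<xi>' gs = \<xi> (\<lambda>i\<in>{..<k + 1}. F (gs i)))"


section \<open>Orbit equivalence\<close>

text \<open>
  The measures \<open>M\<close> and \<open>N\<close> may live on subsets of the spaces acted upon, so that weak orbit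
  equivalence is an instance.
\<close>

definition orbit_equivalence ::
    "('g, 'm) monoid_scheme \<Rightarrow> ('g \<Rightarrow> 'x \<Rightarrow> 'x) \<Rightarrow> 'x measure \<Rightarrow>
     ('l, 'n) monoid_scheme \<Rightarrow> ('l \<Rightarrow> 'y \<Rightarrow> 'y) \<Rightarrow> 'y measure \<Rightarrow> ('x \<Rightarrow> 'y) \<Rightarrow> bool" where
  "orbit_equivalence \<Gamma> \<phi> M \<Lambda> \<psi> N T \<longleftrightarrow>
     T \<in> M \<rightarrow>\<^sub>M N \<and> distr M N T = N \<and>
     (\<exists>X'\<in>sets M. \<exists>Y'\<in>sets N.
        (AE x in M. x \<in> X') \<and> (AE y in N. y \<in> Y') \<and>
        bij_betw T X' Y' \<and>
        the_inv_into X' T \<in> restrict_space N Y' \<rightarrow>\<^sub>M restrict_space M X' \<and>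
        (\<forall>x\<in>X'. T ` (orbit \<Gamma> \<phi> x \<inter> X') = orbit \<Lambda> \<psi> (T x) \<inter> Y'))"

definition normalized_restriction :: "'x measure \<Rightarrow> 'x set \<Rightarrow> 'x measure" where
  "normalized_restriction M U = scale_measure (1 / emeasure M U) (restrict_space M U)"

definition weak_orbit_equivalence ::
    "('g, 'm) monoid_scheme \<Rightarrow> ('g \<Rightarrow> 'x \<Rightarrow> 'x) \<Rightarrow> 'x measure \<Rightarrow> 'x set \<Rightarrow>
     ('l, 'n) monoid_scheme \<Rightarrow> ('l \<Rightarrow> 'y \<Rightarrow> 'y) \<Rightarrow> 'y measure \<Rightarrow> 'y set \<Rightarrow> ('x \<Rightarrow> 'y) \<Rightarrow> bool" where
  "weak_orbit_equivalence \<Gamma> \<phi> M U \<Lambda> \<psi> N V T \<longleftrightarrow>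
     U \<in> sets M \<and> V \<in> sets N \<and> emeasure M U > 0 \<and> emeasure N V > 0 \<and>
     orbit_equivalence \<Gamma> \<phi> (normalized_restriction M U) \<Lambda> \<psi> (normalized_restriction N V) T"

text \<open>
  The cocycle is determined (by essential freeness) at almost every \<open>x\<close>, respectively at almost
  every \<open>x\<close> such that \<open>x\<close> and \<open>\<gamma> x\<close> belong to the domain of \<open>T\<close>; its other values are irrelevant.
\<close>

definition oe_cocycle ::
    "('g \<Rightarrow> 'x \<Rightarrow> 'x) \<Rightarrow> ('l, 'n) monoid_scheme \<Rightarrow> ('l \<Rightarrow> 'y \<Rightarrow> 'y) \<Rightarrow> ('x \<Rightarrow> 'y) \<Rightarrow>
     'g \<Rightarrow> 'x \<Rightarrow> 'l" where
  "oe_cocycle \<phi> \<Lambda> \<psi> T \<gamma> x = (THE l. l \<in> carrier \<Lambda> \<and> T (\<phi> \<gamma> x) = \<psi> l (T x))"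

definition oe_hom ::
    "('g \<Rightarrow> 'x \<Rightarrow> 'x) \<Rightarrow> ('l, 'n) monoid_scheme \<Rightarrow> ('l \<Rightarrow> 'y \<Rightarrow> 'y) \<Rightarrow> ('x \<Rightarrow> 'y) \<Rightarrow>
     'g \<times> 'x \<Rightarrow> 'l \<times> 'y" where
  "oe_hom \<phi> \<Lambda> \<psi> T = (\<lambda>(\<gamma>, x). (oe_cocycle \<phi> \<Lambda> \<psi> T \<gamma> x, T x))"

definition retracting_section :: "('a, 'x) mgroupoid \<Rightarrow> 'x set \<Rightarrow> ('x \<Rightarrow> 'a) \<Rightarrow> bool" where
  "retracting_section G U \<theta> \<longleftrightarrow>
     \<theta> \<in> units G \<rightarrow>\<^sub>M arrows G \<and>
     (AE x in units G. source G (\<theta> x) = x \<and> target G (\<theta> x) \<in> U)"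

definition retract :: "('a, 'x) mgroupoid \<Rightarrow> ('x \<Rightarrow> 'a) \<Rightarrow> 'a \<Rightarrow> 'a" where
  "retract G \<theta> g = gmult G (gmult G (\<theta> (target G g)) g) (ginv G (\<theta> (source G g)))"

end

theory Submission
  imports Defs
begin

text \<open>
  The fibres of the groupoids are countable and the conditional measures of \<open>\<nu>\<close> charge every arrow, so
  a property of tuples holds almost everywhere iff, for almost every \<open>x\<close>, it holds for \<^emph>\<open>all\<close> tuples of
  arrows with target \<open>x\<close>. By essential freeness an arrow is determined by its source and target, hence
  a tuple is a base point \<open>x\<close> together with points of the orbit of \<open>x\<close>, and all identities between arrows
  become trivial.

  A weak orbit equivalence yields nonsingular maps \<open>p: X \<rightarrow> Y\<close> and \<open>q: Y \<rightarrow> X\<close> that map orbits to orbits and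
  whose composites preserve almost every orbit: \<open>p\<close> is \<open>T\<close> after moving \<open>x\<close> into \<open>U\<close>, and \<open>q\<close> is the
  inverse of \<open>T\<close> after moving \<open>y\<close> into \<open>V\<close>, which is possible by ergodicity (or because \<open>V = Y\<close>). Pulling
  cochains back along \<open>p\<close>, and along \<open>q\<close> with a twist by the arrow from \<open>y\<close> to \<open>p (q y)\<close>, gives chain maps
  that do not increase norms. Up to invariance, the composites are induced by the change of base points
  \<open>\<eta> (x; x\<^sub>0, \<dots>, x\<^sub>k) \<mapsto> \<eta> (x; r x\<^sub>0, \<dots>, r x\<^sub>k)\<close>, which the prism operator shows to be homotopic to the
  identity. So both chain maps are isometric isomorphisms in cohomology, in part (2) as well as in part (1).
\<close>

section \<open>Standard Borel actions and arrows\<close>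

text \<open>An orbit equivalence need not carry \<open>\<nu>\<close> and \<open>\<kappa>\<close> of
  one groupoid to those of the other, so cochains cannot be compared by transport of measure. Orbit
  coordinates leave only null sets of base points, and for these nonsingular maps suffice. As
  \<open>p\<close> and \<open>q\<close> need not be injective, the composites on cochains need not
  be the identity, which is why a homotopy enters. The twist arises because the \<Gamma>-module is
  \<open>L\<close> pulled back along \<open>p\<close>: pulling back again along \<open>q\<close>
  gives the action along p o q instead of \<open>L\<close>, and the arrows from y to p (q y)
  intertwine the two. They act isometrically, so norms are not disturbed and no factor from the
  measures of \<open>U\<close> and \<open>V\<close> appears. Two technical constraints shape the
  constructions. Cochains are functions measurable everywhere, so maps defined almost everywhere
  carry default values. Weak* measurability concerns fixed vectors, so twisting requires a pairing
  with a vector that varies with the base point.\<close>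

lemma standard_borel_pred_eq:
  assumes M: "standard_borel M" and f: "f \<in> K \<rightarrow>\<^sub>M M" and g: "g \<in> K \<rightarrow>\<^sub>M M"
  shows "Measurable.pred K (\<lambda>\<omega>. f \<omega> = g \<omega>)"
proof -
  obtain T where T: "completely_metrizable_space T" "second_countable T" "topspace T = space M"
      "sets M = sigma_sets (space M) {W. openin T W}"
    using M unfolding standard_borel_def by blast
  obtain B where B: "countable B" "\<And>V. V \<in> B \<Longrightarrow> openin T V"
      "\<And>U x. openin T U \<Longrightarrow> x \<in> U \<Longrightarrow> \<exists>V\<in>B. x \<in> V \<and> V \<subseteq> U"
    using T(2) unfolding second_countable_def by metis
  have B_sets: "V \<in> sets M" if "V \<in> B" for V
    using B(2)[OF that] T(4) by (auto intro: sigma_sets.Basic)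
  \<comment> \<open>A metrizable space is T1, so the countable base \<open>B\<close> separates
    points. Equality of \<open>f\<close> and \<open>g\<close> thereby becomes a countable
    conjunction of measurable conditions.\<close>
  have sep: "x = y" if xy: "x \<in> space M" "y \<in> space M" and V: "\<forall>V\<in>B. x \<in> V \<longleftrightarrow> y \<in> V" for x y
  proof (rule ccontr)
    assume "x \<noteq> y"
    moreover have "t1_space T"
      using completely_metrizable_imp_metrizable_space[OF T(1)]
      by (simp add: Hausdorff_imp_t1_space metrizable_imp_Hausdorff_space)
    ultimately obtain U where "openin T U" "x \<in> U" "y \<notin> U"
      using xy T(3) unfolding t1_space_def by blast
    then show False using B(3) V by blast
  qed
  have pred_mem: "Measurable.pred K (\<lambda>\<omega>. h \<omega> \<in> V)" if "V \<in> B" "h \<in> K \<rightarrow>\<^sub>M M" for V h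
    using measurable_sets[OF that(2) B_sets[OF that(1)]] by (simp add: pred_def vimage_def Int_def conj_commute)
  have "{\<omega> \<in> space K. f \<omega> = g \<omega>} = {\<omega> \<in> space K. \<forall>V\<in>B. f \<omega> \<in> V \<longleftrightarrow> g \<omega> \<in> V}"
    using sep measurable_space[OF f] measurable_space[OF g] by auto
  moreover have "Measurable.pred K (\<lambda>\<omega>. \<forall>V\<in>B. f \<omega> \<in> V \<longleftrightarrow> g \<omega> \<in> V)"
  proof -
    have "Measurable.pred K (\<lambda>\<omega>. f \<omega> \<in> V \<longleftrightarrow> g \<omega> \<in> V)" if "V \<in> B" for V
      using pred_mem[OF that f] pred_mem[OF that g] by measurable
    then show ?thesis
      unfolding pred_def using B(1) by (intro sets.sets_Collect_countable_All')
  qed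
  ultimately show ?thesis by (simp add: pred_def)
qed

lemma standard_borel_singleton:
  assumes "standard_borel M" "x \<in> space M"
  shows "{x} \<in> sets M"
proof -
  have "Measurable.pred M (\<lambda>y. y = x)"
    using assms by (intro standard_borel_pred_eq[of M]) auto
  moreover have "{y \<in> space M. y = x} = {x}" using assms(2) by auto
  ultimately show ?thesis by (simp add: pred_def)
qed

text \<open>Rectangles form an intersection stable generator, so only they have to be tested; there
  the value is a finite product of measurable functions of the base point.\<close>

lemma PiM_kernel_measurable:
  assumes \<kappa>: "\<kappa> \<in> M \<rightarrow>\<^sub>M prob_algebra N" and I: "finite I"
  shows "(\<lambda>x. \<Pi>\<^sub>M i\<in>I. \<kappa> x) \<in> M \<rightarrow>\<^sub>M prob_algebra (\<Pi>\<^sub>M i\<in>I. N)"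
proof (rule measurable_prob_algebra_generated[OF sets_PiM Int_stable_prod_algebra prod_algebra_sets_into_space])
  have prob: "prob_space (\<kappa> a)" and sets: "sets (\<kappa> a) = sets N" if "a \<in> space M" for a
    using measurable_space[OF \<kappa> that] by (auto simp: space_prob_algebra)
  show "prob_space (\<Pi>\<^sub>M i\<in>I. \<kappa> a)" if "a \<in> space M" for a
    using prob[OF that] by (intro prob_space_PiM)
  show "sets (\<Pi>\<^sub>M i\<in>I. \<kappa> a) = sets (\<Pi>\<^sub>M i\<in>I. N)" if "a \<in> space M" for a
    using sets[OF that] by (intro sets_PiM_cong) auto
  fix A assume "A \<in> prod_algebra I (\<lambda>i. N)"
  then obtain S where S: "A = (\<Pi>\<^sub>E i\<in>I. S i)" "\<And>i. i \<in> I \<Longrightarrow> S i \<in> sets N"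
    unfolding prod_algebra_eq_finite[OF I] by auto
  have "emeasure (\<Pi>\<^sub>M i\<in>I. \<kappa> a) A = (\<Prod>i\<in>I. emeasure (\<kappa> a) (S i))" if "a \<in> space M" for a
  proof -
    interpret prob_space "\<kappa> a" by (rule prob[OF that])
    interpret product_sigma_finite "\<lambda>_. \<kappa> a" by unfold_locales
    show ?thesis unfolding S(1) using I S(2) sets[OF that] by (intro emeasure_PiM) auto
  qed
  moreover have "(\<lambda>a. \<Prod>i\<in>I. emeasure (\<kappa> a) (S i)) \<in> borel_measurable M"
    using S(2) measurable_emeasure_kernel[OF measurable_prob_algebraD[OF \<kappa>]]
    by (intro borel_measurable_prod_ennreal) auto
  ultimately show "(\<lambda>a. emeasure (\<Pi>\<^sub>M i\<in>I. \<kappa> a) A) \<in> borel_measurable M"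
    by (simp cong: measurable_cong)
qed

section \<open>Orbits and arrows of a single action\<close>

context pmp_action
begin

abbreviation G where "G \<equiv> semidirect \<Gamma> \<phi> M"

abbreviation Orb where "Orb x \<equiv> orbit \<Gamma> \<phi> x"

lemma group_Gamma: "group \<Gamma>"
  using group_hom group_hom.axioms(1) by blast

lemma act_space [simp]: "\<gamma> \<in> carrier \<Gamma> \<Longrightarrow> x \<in> space M \<Longrightarrow> \<phi> \<gamma> x \<in> space M"
  using element_image by blast

lemma act_one [simp]: "x \<in> space M \<Longrightarrow> \<phi> \<one> x = x"
  using id_eq_one by (metis restrict_apply')

lemma orbit_space: "x \<in> space M \<Longrightarrow> y \<in> Orb x \<Longrightarrow> y \<in> space M"
  by (auto simp: orbit_def)

lemma orbitI: "\<gamma> \<in> carrier \<Gamma> \<Longrightarrow> \<phi> \<gamma> x \<in> Orb x"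
  by (auto simp: orbit_def)

lemma orbit_eq:
  assumes "x \<in> space M" "y \<in> Orb x"
  shows "Orb y = Orb x"
  using assms orbit_trans orbit_sym orbit_space by (metis subsetI subset_antisym)

lemma AE_act:
  assumes "\<gamma> \<in> carrier \<Gamma>" "AE x in M. P x"
  shows "AE x in M. P (\<phi> \<gamma> x)"
  using assms AE_distrD[OF measurable_action] measure_preserving by metis

text \<open>A countable intersection of translates of a conull set is conull. This is the device by
  which statements about almost every point are promoted to whole orbits.\<close>

lemma AE_orbit:
  assumes "AE x in M. P x"
  shows "AE x in M. \<forall>y\<in>Orb x. P y"
proof -
  have "AE x in M. \<forall>\<gamma>\<in>carrier \<Gamma>. P (\<phi> \<gamma> x)"
    using AE_act assms countable_group by (simp add: AE_ball_countable)
  then show ?thesis by (auto simp: orbit_def)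
qed

lemma semidirect_simps:
  "space (arrows G) = carrier \<Gamma> \<times> space M" "units G = M"
  "source G (\<gamma>, x) = x" "target G (\<gamma>, x) = \<phi> \<gamma> x"
  "gmult G (\<gamma>', y) (\<gamma>, x) = (\<gamma>' \<otimes> \<gamma>, x)" "ginv G (\<gamma>, x) = (inv \<gamma>, \<phi> \<gamma> x)"
  by (auto simp: semidirect_def space_pair_measure)

lemma arrows_eq: "arrows G = count_space (carrier \<Gamma>) \<Otimes>\<^sub>M M"
  by (simp add: semidirect_def)

lemma measurable_source: "source G \<in> arrows G \<rightarrow>\<^sub>M M"
  by (simp add: semidirect_def case_prod_beta')

lemma measurable_target: "target G \<in> arrows G \<rightarrow>\<^sub>M M"
proof -
  have "(\<lambda>g. \<phi> (fst g) (snd g)) \<in> count_space (carrier \<Gamma>) \<Otimes>\<^sub>M M \<rightarrow>\<^sub>M M"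
    by (rule measurable_compose_countable'[OF _ measurable_fst countable_group])
       (auto intro: measurable_compose[OF measurable_snd measurable_action])
  then show ?thesis by (simp add: semidirect_def case_prod_beta')
qed

text \<open>Counting measure on a countable set makes an arrow set null exactly when all its slices
  are. As \<open>P\<close> is arbitrary, the converse direction builds a null superset from null
  supersets of the slices.\<close>

lemma AE_arrows:
  "(AE g in arrows G. P g) \<longleftrightarrow> (AE x in M. \<forall>\<gamma>\<in>carrier \<Gamma>. P (\<gamma>, x))"
proof -
  interpret C: sigma_finite_measure "count_space (carrier \<Gamma>)"
    by (rule sigma_finite_measure_count_space_countable[OF countable_group])
  interpret P: pair_sigma_finite "count_space (carrier \<Gamma>)" M ..
  have "(AE g in arrows G. P g) \<longleftrightarrow> (\<forall>\<gamma>\<in>carrier \<Gamma>. AE x in M. P (\<gamma>, x))"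
  proof
    assume "AE g in arrows G. P g"
    then show "\<forall>\<gamma>\<in>carrier \<Gamma>. AE x in M. P (\<gamma>, x)"
      using P.AE_pair[of P] unfolding arrows_eq AE_count_space by blast
  next
    assume *: "\<forall>\<gamma>\<in>carrier \<Gamma>. AE x in M. P (\<gamma>, x)"
    then obtain N where N: "\<And>\<gamma>. \<gamma> \<in> carrier \<Gamma> \<Longrightarrow> N \<gamma> \<in> null_sets M"
        "\<And>\<gamma>. \<gamma> \<in> carrier \<Gamma> \<Longrightarrow> {x \<in> space M. \<not> P (\<gamma>, x)} \<subseteq> N \<gamma>"
      unfolding eventually_ae_filter by metis
    have "{\<gamma>} \<times> N \<gamma> \<in> null_sets (arrows G)" if "\<gamma> \<in> carrier \<Gamma>" for \<gamma>
      using N(1)[OF that] that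
      by (auto simp: null_sets_def semidirect_def emeasure_pair_measure_Times)
    then have "(\<Union>\<gamma>\<in>carrier \<Gamma>. {\<gamma>} \<times> N \<gamma>) \<in> null_sets (arrows G)"
      using countable_group by (intro null_sets_UN') auto
    moreover have "{g \<in> space (arrows G). \<not> P g} \<subseteq> (\<Union>\<gamma>\<in>carrier \<Gamma>. {\<gamma>} \<times> N \<gamma>)"
      using N(2) by (auto simp: semidirect_simps)
    ultimately show "AE g in arrows G. P g"
      unfolding eventually_ae_filter by blast
  qed
  then show ?thesis using countable_group by (simp add: AE_ball_countable)
qed

text \<open>
  Choosing the least index, instead of the unique element, makes \<open>arr\<close> measurable everywhere; the
  value is meaningful only if \<open>y\<close> lies in the orbit of \<open>x\<close>.
\<close>

definition arr :: "'x \<Rightarrow> 'x \<Rightarrow> 'g \<times> 'x" where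
  "arr x y = (from_nat_into (carrier \<Gamma>) (LEAST n. \<phi> (from_nat_into (carrier \<Gamma>) n) x = y), x)"

lemma carrier_ne: "carrier \<Gamma> \<noteq> {}"
  using group_Gamma group.is_monoid monoid.one_closed by blast

lemma arr_in: "x \<in> space M \<Longrightarrow> arr x y \<in> space (arrows G)"
  by (simp add: arr_def semidirect_simps from_nat_into carrier_ne)

lemma source_arr [simp]: "source G (arr x y) = x"
  by (simp add: arr_def semidirect_simps)

lemma target_arr: "y \<in> Orb x \<Longrightarrow> target G (arr x y) = y"
proof -
  assume "y \<in> Orb x"
  then obtain \<gamma> where "\<gamma> \<in> carrier \<Gamma>" "\<phi> \<gamma> x = y" by (auto simp: orbit_def)
  then have "\<exists>n. \<phi> (from_nat_into (carrier \<Gamma>) n) x = y"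
    using from_nat_into_surj[OF countable_group] by metis
  then show ?thesis
    unfolding arr_def semidirect_simps by (rule LeastI_ex)
qed

lemma measurable_arr:
  assumes f: "f \<in> K \<rightarrow>\<^sub>M M" and g: "g \<in> K \<rightarrow>\<^sub>M M"
  shows "(\<lambda>\<omega>. arr (f \<omega>) (g \<omega>)) \<in> K \<rightarrow>\<^sub>M arrows G"
proof -
  have en: "from_nat_into (carrier \<Gamma>) n \<in> carrier \<Gamma>" for n
    by (simp add: from_nat_into carrier_ne)
  have "Measurable.pred K (\<lambda>\<omega>. \<phi> (from_nat_into (carrier \<Gamma>) n) (f \<omega>) = g \<omega>)" for n
    using measurable_compose[OF f measurable_action[OF en]] g
    by (intro standard_borel_pred_eq[OF standard])
  then have "(\<lambda>\<omega>. LEAST n. \<phi> (from_nat_into (carrier \<Gamma>) n) (f \<omega>) = g \<omega>) \<in> K \<rightarrow>\<^sub>M count_space UNIV"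
    by (rule measurable_Least)
  then have "(\<lambda>\<omega>. from_nat_into (carrier \<Gamma>) (LEAST n. \<phi> (from_nat_into (carrier \<Gamma>) n) (f \<omega>) = g \<omega>)) \<in> K \<rightarrow>\<^sub>M count_space (carrier \<Gamma>)"
    by (rule measurable_compose) (simp add: en)
  then show ?thesis
    using f by (simp add: semidirect_def arr_def)
qed

lemma free_unique:
  assumes "stabilizer \<Gamma> \<phi> x = {\<one>}" "x \<in> space M" "\<gamma> \<in> carrier \<Gamma>" "\<gamma>' \<in> carrier \<Gamma>" "\<phi> \<gamma> x = \<phi> \<gamma>' x"
  shows "\<gamma> = \<gamma>'"
proof -
  interpret group \<Gamma> by (rule group_Gamma)
  have "\<phi> (inv \<gamma>' \<otimes> \<gamma>) x = x"
    using assms by (simp add: composition_rule orbit_sym_aux)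
  then have "inv \<gamma>' \<otimes> \<gamma> = \<one>"
    using assms(1,3,4) by (auto simp: stabilizer_def)
  then show ?thesis using assms(3,4) by (metis inv_closed inv_inv inv_equality)
qed

lemma arr_source_target:
  assumes "stabilizer \<Gamma> \<phi> (source G g) = {\<one>}" "g \<in> space (arrows G)" "target G g = y"
  shows "arr (source G g) y = g"
proof -
  obtain \<gamma> x where g: "g = (\<gamma>, x)" "\<gamma> \<in> carrier \<Gamma>" "x \<in> space M"
    using assms(2) by (auto simp: semidirect_simps)
  have "target G (arr x y) = y"
    using assms(3) g by (auto simp: semidirect_simps intro!: target_arr orbitI)
  moreover have "arr x y \<in> space (arrows G)" using g(3) by (rule arr_in)
  ultimately show ?thesis
    using free_unique[of x \<gamma> "fst (arr x y)"] assms g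
    by (auto simp: semidirect_simps arr_def)
qed

end

section \<open>Almost every tuple\<close>

locale measured_action = pmp_action \<Gamma> \<phi> M
  for \<Gamma> :: "('g, 'm) monoid_scheme" (structure) and \<phi> :: "'g \<Rightarrow> 'x \<Rightarrow> 'x" and M :: "'x measure" +
  fixes \<nu> :: "('g \<times> 'x) measure" and \<kappa> :: "'x \<Rightarrow> ('g \<times> 'x) measure"
  assumes free: "essentially_free \<Gamma> \<phi> M"
    and symm: "symmetric_class_prob (semidirect \<Gamma> \<phi> M) \<nu>"
    and disint: "disintegration (semidirect \<Gamma> \<phi> M) \<nu> \<kappa>"
begin

lemma kernel: "\<kappa> \<in> M \<rightarrow>\<^sub>M prob_algebra (arrows G)"
  using disint by (simp add: disintegration_def semidirect_simps)

lemma kernel_prob: "x \<in> space M \<Longrightarrow> prob_space (\<kappa> x)"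
  and kernel_sets: "x \<in> space M \<Longrightarrow> sets (\<kappa> x) = sets (arrows G)"
  using measurable_space[OF kernel] by (auto simp: space_prob_algebra)

lemma sets_nu: "sets \<nu> = sets (arrows G)" and null_sets_nu: "null_sets \<nu> = null_sets (arrows G)"
  using symm by (auto simp: symmetric_class_prob_def)

lemma sets_base: "sets (base_measure G \<nu>) = sets M"
  by (simp add: base_measure_def semidirect_simps)

lemma space_base: "space (base_measure G \<nu>) = space M"
  using sets_base by (rule sets_eq_imp_space_eq)

lemma AE_nu: "(AE g in \<nu>. P g) \<longleftrightarrow> (AE g in arrows G. P g)"
  unfolding eventually_ae_filter null_sets_nu sets_eq_imp_space_eq[OF sets_nu] ..

text \<open>The target map hits \<open>N\<close> with measure zero exactly when almost every orbit
  misses \<open>N\<close>. By \<open>AE_orbit\<close>, and because each point lies in its own orbit,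
  this is nullness of \<open>N\<close> for \<open>M\<close>.\<close>

lemma null_sets_base: "null_sets (base_measure G \<nu>) = null_sets M"
proof -
  have target: "target G \<in> \<nu> \<rightarrow>\<^sub>M M"
    using measurable_target sets_nu by (simp cong: measurable_cong_sets)
  have "N \<in> null_sets (base_measure G \<nu>) \<longleftrightarrow> N \<in> null_sets M" if N: "N \<in> sets M" for N
  proof -
    have "N \<in> null_sets (base_measure G \<nu>) \<longleftrightarrow> (AE x in base_measure G \<nu>. x \<notin> N)"
      using N sets_base by (simp add: AE_iff_null_sets)
    also have "\<dots> \<longleftrightarrow> (AE g in \<nu>. target G g \<notin> N)"
      unfolding base_measure_def semidirect_simps
      using N target by (intro AE_distr_iff) auto
    also have "\<dots> \<longleftrightarrow> (AE x in M. \<forall>y\<in>Orb x. y \<notin> N)"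
      unfolding AE_nu AE_arrows by (rule AE_cong) (auto simp: semidirect_simps orbit_def)
    also have "\<dots> \<longleftrightarrow> (AE x in M. x \<notin> N)"
    proof
      assume "AE x in M. \<forall>y\<in>Orb x. y \<notin> N"
      then show "AE x in M. x \<notin> N"
        using AE_space[of M] by eventually_elim (use orbit_refl in blast)
    qed (rule AE_orbit)
    finally show ?thesis using N by (simp add: AE_iff_null_sets)
  qed
  then show ?thesis using sets_base by (auto dest: null_setsD2)
qed

lemma AE_base: "(AE x in base_measure G \<nu>. P x) \<longleftrightarrow> (AE x in M. P x)"
  unfolding eventually_ae_filter null_sets_base space_base ..

lemma kernel_target: "AE x in M. AE g in \<kappa> x. target G g = x"
  using disint by (simp add: disintegration_def AE_base)

text \<open>Suppose the kernels give the slice of \<gamma> no mass over a set \<open>B\<close> of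
  targets. Then the arrows of the slice ending in \<open>B\<close> are null for
  \<open>\<nu>\<close>, hence for the arrow measure, so \<gamma> x avoids \<open>B\<close> for
  almost every x. Since \<gamma> preserves \<open>M\<close>, the set \<open>B\<close> is
  null.\<close>

lemma kernel_slice_pos:
  assumes \<gamma>: "\<gamma> \<in> carrier \<Gamma>"
  shows "AE x in M. 0 < emeasure (\<kappa> x) ({\<gamma>} \<times> space M)"
proof -
  interpret group \<Gamma> by (rule group_Gamma)
  have slice: "{\<gamma>} \<times> space M \<in> sets (arrows G)"
    using \<gamma> by (simp add: arrows_eq)
  define B where "B = {x \<in> space M. emeasure (\<kappa> x) ({\<gamma>} \<times> space M) = 0}"
  have B: "B \<in> sets M"
    unfolding B_def
    using measurable_emeasure_kernel[OF measurable_prob_algebraD[OF kernel] slice]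
    by measurable
  define C where "C = {\<gamma>} \<times> space M \<inter> target G -` B"
  have "C = ({\<gamma>} \<times> space M) \<inter> (target G -` B \<inter> space (arrows G))"
    using \<gamma> by (auto simp: C_def semidirect_simps)
  then have C: "C \<in> sets (arrows G)"
    using slice measurable_sets[OF measurable_target B] by auto
  have "AE x in M. emeasure (\<kappa> x) C = 0"
    using kernel_target AE_space[of M]
  proof eventually_elim
    case (elim x)
    have Cx: "C \<in> sets (\<kappa> x)" using C kernel_sets[OF elim(2)] by simp
    show ?case
    proof (cases "x \<in> B")
      case True
      have "emeasure (\<kappa> x) C \<le> emeasure (\<kappa> x) ({\<gamma>} \<times> space M)"
        using slice kernel_sets[OF elim(2)] by (intro emeasure_mono) (auto simp: C_def)
      then show ?thesis using True by (simp add: B_def)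
    next
      case False
      then have "AE g in \<kappa> x. g \<notin> C"
        by (intro AE_mp[OF elim(1) AE_I2] impI) (simp add: C_def)
      then have "C \<in> null_sets (\<kappa> x)" by (simp only: AE_iff_null_sets[OF Cx])
      then show ?thesis by (rule null_setsD1)
    qed
  qed
  then have "AE x in base_measure G \<nu>. emeasure (\<kappa> x) C = 0"
    by (simp add: AE_base)
  moreover have "emeasure \<nu> C = (\<integral>\<^sup>+x. emeasure (\<kappa> x) C \<partial>base_measure G \<nu>)"
  proof -
    have "\<nu> = base_measure G \<nu> \<bind> \<kappa>" using disint by (simp add: disintegration_def)
    moreover have "\<kappa> \<in> base_measure G \<nu> \<rightarrow>\<^sub>M subprob_algebra (arrows G)"
      using measurable_prob_algebraD[OF kernel] sets_base by (simp cong: measurable_cong_sets)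
    ultimately show ?thesis
      using emeasure_bind[OF _ _ C] not_empty space_base by metis
  qed
  ultimately have "emeasure \<nu> C = 0"
    by (simp add: nn_integral_0_iff_AE cong: nn_integral_cong_AE)
  then have "AE g in arrows G. g \<notin> C"
    using C sets_nu null_sets_nu by (intro AE_not_in) (auto simp: null_sets_def)
  then have "AE x in M. \<phi> \<gamma> x \<notin> B"
    using \<gamma> unfolding AE_arrows by (auto simp: C_def semidirect_simps elim!: AE_mp intro!: AE_I2)
  \<comment> \<open>Invariance of \<open>M\<close> permits replacing x by its translate under the
    inverse of \<gamma>, so that the point tested becomes x itself.\<close>
  then have "AE x in M. \<phi> \<gamma> (\<phi> (inv \<gamma>) x) \<notin> B"
    using \<gamma> by (intro AE_act[where P="\<lambda>x. \<phi> \<gamma> x \<notin> B"] inv_closed)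
  then show ?thesis
  proof (rule AE_mp, intro AE_I2 impI)
    fix x assume x: "x \<in> space M" "\<phi> \<gamma> (\<phi> (inv \<gamma>) x) \<notin> B"
    have "\<phi> \<gamma> (\<phi> (inv \<gamma>) x) = x"
      using \<gamma> x(1) by (metis composition_rule inv_closed r_inv act_one)
    then show "0 < emeasure (\<kappa> x) ({\<gamma>} \<times> space M)"
      using x by (simp add: B_def zero_less_iff_neq_zero)
  qed
qed

text \<open>As \<gamma> acts injectively, its slice contains at most one arrow with a given target.
  The kernel lives on the arrows with that target, so the singleton has the same mass as the
  slice.\<close>

lemma kernel_atom_pos: "AE x in M. \<forall>g\<in>space (arrows G). target G g = x \<longrightarrow> 0 < emeasure (\<kappa> x) {g}"
proof -
  have "AE x in M. \<forall>\<gamma>\<in>carrier \<Gamma>. 0 < emeasure (\<kappa> x) ({\<gamma>} \<times> space M)"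
    using kernel_slice_pos countable_group by (simp add: AE_ball_countable)
  with kernel_target AE_space[of M] show ?thesis
  proof (eventually_elim, safe)
    fix x \<gamma> y
    assume target: "AE g in \<kappa> (target G (\<gamma>, y)). target G g = target G (\<gamma>, y)"
      and x: "target G (\<gamma>, y) \<in> space M"
      and pos: "\<forall>\<gamma>'\<in>carrier \<Gamma>. 0 < emeasure (\<kappa> (target G (\<gamma>, y))) ({\<gamma>'} \<times> space M)"
      and g: "(\<gamma>, y) \<in> space (arrows G)"
    have \<gamma>: "\<gamma> \<in> carrier \<Gamma>" "y \<in> space M" using g by (auto simp: semidirect_simps)
    have "{\<gamma>} \<times> {y} \<in> sets (arrows G)" "{\<gamma>} \<times> space M \<in> sets (arrows G)"
      unfolding arrows_eq using \<gamma> standard_borel_singleton[OF standard, of y]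
      by (intro pair_measureI; simp)+
    moreover have "AE g in \<kappa> (target G (\<gamma>, y)). g \<in> {\<gamma>} \<times> {y} \<longleftrightarrow> g \<in> {\<gamma>} \<times> space M"
      using target
    proof eventually_elim
      case (elim g)
      have "z = y" if "z \<in> space M" "\<phi> \<gamma> z = \<phi> \<gamma> y" for z
        using inj_prop(1)[OF \<gamma>(1)] that \<gamma>(2) by (meson inj_onD)
      then show ?case using elim \<gamma> by (cases g) (auto simp: semidirect_simps)
    qed
    ultimately have "emeasure (\<kappa> (target G (\<gamma>, y))) ({\<gamma>} \<times> {y}) =
        emeasure (\<kappa> (target G (\<gamma>, y))) ({\<gamma>} \<times> space M)"
      using kernel_sets[OF x] by (intro emeasure_eq_AE) auto
    then show "0 < emeasure (\<kappa> (target G (\<gamma>, y))) {(\<gamma>, y)}"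
      using pos \<gamma> by auto
  qed
qed

definition fibre_tuples :: "nat \<Rightarrow> 'x \<Rightarrow> (nat \<Rightarrow> 'g \<times> 'x) set" where
  "fibre_tuples n x = (\<Pi>\<^sub>E i\<in>{..<n}. {g \<in> space (arrows G). target G g = x})"

lemma tuple_kernel:
  fixes n :: nat
  shows "(\<lambda>x. \<Pi>\<^sub>M i\<in>{..<n}. \<kappa> x) \<in> base_measure G \<nu> \<rightarrow>\<^sub>M subprob_algebra (\<Pi>\<^sub>M i\<in>{..<n}. arrows G)"
  using measurable_prob_algebraD[OF PiM_kernel_measurable[OF kernel finite_lessThan]] sets_base
  by (simp cong: measurable_cong_sets)

lemma sets_tuple_bind:
  fixes n :: nat
  shows "sets (base_measure G \<nu> \<bind> (\<lambda>x. \<Pi>\<^sub>M i\<in>{..<n}. \<kappa> x)) = sets (\<Pi>\<^sub>M i\<in>{..<n}. arrows G)"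
  by (rule sets_bind_measurable[OF tuple_kernel]) (simp add: space_base not_empty)

lemma same_target_measurable:
  fixes n :: nat
  shows "{gs. \<forall>i<n. \<forall>j<n. target G (gs i) = target G (gs j)} \<inter> space (\<Pi>\<^sub>M i\<in>{..<n}. arrows G)
    \<in> sets (\<Pi>\<^sub>M i\<in>{..<n}. arrows G)"
proof -
  have "Measurable.pred (\<Pi>\<^sub>M i\<in>{..<n}. arrows G) (\<lambda>gs. target G (gs i) = target G (gs j))"
    if "i < n" "j < n" for i j
    using that
    by (intro standard_borel_pred_eq[OF standard] measurable_compose[OF _ measurable_target]
          measurable_component_singleton) auto
  then have pred: "Measurable.pred (\<Pi>\<^sub>M i\<in>{..<n}. arrows G)
      (\<lambda>gs. \<forall>i\<in>{..<n}. \<forall>j\<in>{..<n}. target G (gs i) = target G (gs j))"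
    by (intro pred_intros_finite) auto
  have "{gs. \<forall>i<n. \<forall>j<n. target G (gs i) = target G (gs j)} \<inter> space (\<Pi>\<^sub>M i\<in>{..<n}. arrows G) =
      {gs \<in> space (\<Pi>\<^sub>M i\<in>{..<n}. arrows G). \<forall>i\<in>{..<n}. \<forall>j\<in>{..<n}. target G (gs i) = target G (gs j)}"
    by blast
  with pred show ?thesis unfolding pred_def by (simp only:)
qed

text \<open>The sigma-algebra of tuples does not depend on \<open>\<nu>\<close> and
  \<open>\<kappa>\<close>; these influence cochains only through null sets.\<close>

lemma measurable_tuple_iff:
  "f \<in> tuple_measure G \<nu> \<kappa> n \<rightarrow>\<^sub>M K \<longleftrightarrow>
    f \<in> restrict_space (\<Pi>\<^sub>M i\<in>{..<n}. arrows G) {gs. \<forall>i<n. \<forall>j<n. target G (gs i) = target G (gs j)} \<rightarrow>\<^sub>M K"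
  unfolding tuple_measure_def
  by (intro arg_cong[where f="\<lambda>S. f \<in> S"] measurable_cong_sets sets_restrict_space_cong sets_tuple_bind refl)

text \<open>Forward: a tuple over a good x is an atom of positive mass for the product of the
  kernels, so no null set contains it. Backward: a measurable null set of base points is lifted to
  tuples; as \<open>n\<close> is positive, the base point can be read off the first entry.\<close>

theorem AE_tuple:
  assumes n: "0 < n"
  shows "(AE gs in tuple_measure G \<nu> \<kappa> n. P gs) \<longleftrightarrow> (AE x in M. \<forall>gs\<in>fibre_tuples n x. P gs)"
proof -
  define K where "K = base_measure G \<nu> \<bind> (\<lambda>x. \<Pi>\<^sub>M i\<in>{..<n}. \<kappa> x)"
  define S where "S = {gs. \<forall>i<n. \<forall>j<n. target G (gs i) = target G (gs j)}"
  have sets_K: "sets K = sets (\<Pi>\<^sub>M i\<in>{..<n}. arrows G)"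
    unfolding K_def by (rule sets_tuple_bind)
  note space_K = sets_eq_imp_space_eq[OF sets_K]
  have restrict: "(AE gs in tuple_measure G \<nu> \<kappa> n. P gs) \<longleftrightarrow> (AE gs in K. gs \<in> S \<longrightarrow> P gs)"
    unfolding tuple_measure_def S_def[symmetric] K_def[symmetric]
    by (intro AE_restrict_space_iff) (unfold sets_K space_K S_def, rule same_target_measurable)
  have AE_K: "(AE gs in K. gs \<notin> A) \<longleftrightarrow> (AE x in M. AE gs in \<Pi>\<^sub>M i\<in>{..<n}. \<kappa> x. gs \<notin> A)"
    if "A \<in> sets (\<Pi>\<^sub>M i\<in>{..<n}. arrows G)" for A
    unfolding K_def AE_base[symmetric]
    using that by (intro AE_bind[OF tuple_kernel]) auto
  show ?thesis
    unfolding restrict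
  proof
    assume "AE gs in K. gs \<in> S \<longrightarrow> P gs"
    then obtain A where A: "A \<in> null_sets K" "{gs \<in> space K. \<not> (gs \<in> S \<longrightarrow> P gs)} \<subseteq> A"
      unfolding eventually_ae_filter by blast
    have null: "AE x in M. AE gs in \<Pi>\<^sub>M i\<in>{..<n}. \<kappa> x. gs \<notin> A"
      using AE_K[of A] AE_not_in[OF A(1)] A(1) sets_K by auto
    show "AE x in M. \<forall>gs\<in>fibre_tuples n x. P gs"
    proof (rule AE_mp[OF kernel_atom_pos], rule AE_mp[OF null], intro AE_I2 impI ballI, rule ccontr)
      fix x gs
      assume null_x: "AE gs in \<Pi>\<^sub>M i\<in>{..<n}. \<kappa> x. gs \<notin> A"
        and pos: "\<forall>g\<in>space (arrows G). target G g = x \<longrightarrow> 0 < emeasure (\<kappa> x) {g}"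
        and x: "x \<in> space M" and gs: "gs \<in> fibre_tuples n x" and "\<not> P gs"
      interpret K: prob_space "\<kappa> x" by (rule kernel_prob[OF x])
      interpret P: product_sigma_finite "\<lambda>_. \<kappa> x" by unfold_locales
      have gi: "gs i \<in> space (arrows G)" "target G (gs i) = x" if "i < n" for i
        using gs that by (auto simp: fibre_tuples_def PiE_iff)
      have single: "{gs i} \<in> sets (\<kappa> x)" if i: "i < n" for i
      proof -
        obtain \<gamma> y where "gs i = (\<gamma>, y)" "\<gamma> \<in> carrier \<Gamma>" "y \<in> space M"
          using gi(1)[OF i] by (auto simp: semidirect_simps)
        moreover from this have "{\<gamma>} \<times> {y} \<in> sets (arrows G)"
          unfolding arrows_eq using standard_borel_singleton[OF standard, of y]
          by (intro pair_measureI; simp)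
        ultimately show ?thesis using kernel_sets[OF x] by simp
      qed
      have gs_eq: "{gs} = (\<Pi>\<^sub>E i\<in>{..<n}. {gs i})"
        using gs by (subst PiE_singleton) (auto simp: fibre_tuples_def PiE_def)
      have gs_sets: "{gs} \<in> sets (\<Pi>\<^sub>M i\<in>{..<n}. \<kappa> x)"
        unfolding gs_eq using single by (intro sets_PiM_I_finite) auto
      have "emeasure (\<Pi>\<^sub>M i\<in>{..<n}. \<kappa> x) {gs} = (\<Prod>i\<in>{..<n}. emeasure (\<kappa> x) {gs i})"
        unfolding gs_eq using single by (intro P.emeasure_PiM) auto
      moreover have "emeasure (\<kappa> x) {gs i} \<noteq> 0" if "i < n" for i
        using pos gi[OF that] by (metis less_irrefl)
      then have "(\<Prod>i\<in>{..<n}. emeasure (\<kappa> x) {gs i}) \<noteq> 0"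
        by (simp add: prod_zero_iff)
      moreover have "gs \<in> space K"
        using gs gi(1) unfolding space_K space_PiM fibre_tuples_def PiE_iff by blast
      moreover have "gs \<in> S" using gi(2) by (simp add: S_def)
      ultimately have prod: "emeasure (\<Pi>\<^sub>M i\<in>{..<n}. \<kappa> x) {gs} \<noteq> 0" and "gs \<in> A"
        using A(2) \<open>\<not> P gs\<close> by auto
      then have "{gs} \<in> null_sets (\<Pi>\<^sub>M i\<in>{..<n}. \<kappa> x)"
        unfolding AE_iff_null_sets[OF gs_sets] by (intro AE_mp[OF null_x AE_I2] impI) auto
      then show False using prod by (simp add: null_setsD1)
    qed
  next
    assume "AE x in M. \<forall>gs\<in>fibre_tuples n x. P gs"
    then obtain N where N: "N \<in> null_sets M" "{x \<in> space M. \<not> (\<forall>gs\<in>fibre_tuples n x. P gs)} \<subseteq> N"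
      unfolding eventually_ae_filter by blast
    define A where "A = (\<lambda>gs. target G (gs 0)) -` N \<inter> space (\<Pi>\<^sub>M i\<in>{..<n}. arrows G)"
    have A: "A \<in> sets (\<Pi>\<^sub>M i\<in>{..<n}. arrows G)"
      unfolding A_def using n N(1)
      by (intro measurable_sets[where A=M] measurable_compose[OF _ measurable_target]
            measurable_component_singleton) auto
    have "AE x in M. AE gs in \<Pi>\<^sub>M i\<in>{..<n}. \<kappa> x. gs \<notin> A"
      using kernel_target AE_not_in[OF N(1)] AE_space[of M]
    proof eventually_elim
      case (elim x)
      have *: "AE gs in \<Pi>\<^sub>M i\<in>{..<n}. \<kappa> x. target G (gs 0) = x"
        using n kernel_prob elim by (intro AE_PiM_component) auto
      show ?case
        by (intro AE_mp[OF * AE_I2] impI) (use elim in \<open>auto simp: A_def\<close>)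
    qed
    then have "AE gs in K. gs \<notin> A" using AE_K[OF A] by simp
    then show "AE gs in K. gs \<in> S \<longrightarrow> P gs"
      using AE_space[of K]
    proof (eventually_elim, safe)
      fix gs assume gs: "gs \<notin> A" "gs \<in> space K" "gs \<in> S"
      have gi: "gs i \<in> space (arrows G)" if "i < n" for i
        using gs(2) that unfolding space_K space_PiM PiE_iff by blast
      have "target G (gs i) = target G (gs 0)" if "i < n" for i
        using gs(3) n that unfolding S_def by blast
      then have "gs \<in> fibre_tuples n (target G (gs 0))"
        using gs(2) gi unfolding fibre_tuples_def space_K space_PiM PiE_iff by blast
      moreover have "target G (gs 0) \<in> space M"
        using measurable_space[OF measurable_target gi[OF n]] .
      ultimately show "P gs" using N(2) gs by (auto simp: A_def space_K)
    qed
  qed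
qed

end

section \<open>Orbit coordinates\<close>

text \<open>For simple \<open>w\<close> the pairing is glued from finitely many pairings with fixed
  vectors. The general case is a pointwise limit, because each functional is continuous.\<close>

lemma wstar_pairing_measurable:
  fixes \<xi> :: "'b \<Rightarrow> 'e::{banach, second_countable_topology} dual"
  assumes \<xi>: "\<And>v. (\<lambda>\<omega>. \<xi> \<omega> v) \<in> borel_measurable K" and w: "w \<in> borel_measurable K"
  shows "(\<lambda>\<omega>. \<xi> \<omega> (w \<omega>)) \<in> borel_measurable K"
proof -
  obtain F where F: "\<And>i. simple_function K (F i)" "\<And>\<omega>. \<omega> \<in> space K \<Longrightarrow> (\<lambda>i. F i \<omega>) \<longlonglongrightarrow> w \<omega>"
    using borel_measurable_implies_sequence_metric[OF w] by metis
  show ?thesis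
  proof (rule borel_measurable_LIMSEQ_metric)
    show "(\<lambda>\<omega>. \<xi> \<omega> (F i \<omega>)) \<in> borel_measurable K" for i
    proof (rule measurable_compose_countable'[where I="F i ` space K"])
      show "F i \<in> K \<rightarrow>\<^sub>M count_space (F i ` space K)"
        using measurable_simple_function[OF F(1)[of i]]
        by (auto simp: measurable_def simple_functionD[OF F(1)] intro: F(1)[THEN simple_functionD(2)])
      show "countable (F i ` space K)"
        using simple_functionD(1)[OF F(1)] by (rule countable_finite)
    qed (rule \<xi>)
    show "(\<lambda>i. \<xi> \<omega> (F i \<omega>)) \<longlonglongrightarrow> \<xi> \<omega> (w \<omega>)" if "\<omega> \<in> space K" for \<omega>
      using F(2)[OF that] by (intro tendsto_intros)
  qed
qed

text \<open>The dual norm is an uncountable supremum; separability reduces each bound on it to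
  countably many conditions on a dense set \<open>D\<close>.\<close>

lemma wstar_norm_measurable:
  fixes \<xi> :: "'b \<Rightarrow> 'e::{banach, second_countable_topology} dual"
  assumes \<xi>: "\<And>v. (\<lambda>\<omega>. \<xi> \<omega> v) \<in> borel_measurable K"
  shows "(\<lambda>\<omega>. norm (\<xi> \<omega>)) \<in> borel_measurable K"
proof -
  obtain D :: "'e set" where D: "countable D" "\<And>U. open U \<Longrightarrow> U \<noteq> {} \<Longrightarrow> \<exists>d\<in>D. d \<in> U"
    using countable_dense_exists by metis
  \<comment> \<open>The conjunct \<open>0 \<le> c\<close> matters if \<open>'e\<close> is the zero
    space, where the inequalities on \<open>D\<close> hold for every \<open>c\<close>.\<close>
  have bound: "norm f \<le> c \<longleftrightarrow> 0 \<le> c \<and> (\<forall>v\<in>D. norm (f v) \<le> c * norm v)" for f :: "'e dual" and c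
  proof
    assume "norm f \<le> c"
    then show "0 \<le> c \<and> (\<forall>v\<in>D. norm (f v) \<le> c * norm v)"
      using norm_ge_zero[of f] norm_blinfun[of f] by (meson mult_right_mono norm_ge_zero order_trans)
  next
    assume *: "0 \<le> c \<and> (\<forall>v\<in>D. norm (f v) \<le> c * norm v)"
    have "closed {v. norm (f v) \<le> c * norm v}"
      by (intro closed_Collect_le continuous_intros)
    moreover have "D \<subseteq> {v. norm (f v) \<le> c * norm v}" using * by auto
    moreover have "closure D = UNIV"
      unfolding closure_iff_nhds_not_empty set_eq_iff using D(2) by (simp add: disjoint_iff) blast
    ultimately have "norm (f v) \<le> c * norm v" for v
      using closure_minimal[of D "{v. norm (f v) \<le> c * norm v}"] by auto
    then show "norm f \<le> c" using * by (intro norm_blinfun_bound) auto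
  qed
  have "{\<omega> \<in> space K. norm (\<xi> \<omega>) \<le> c} \<in> sets K" for c
  proof -
    have "{\<omega> \<in> space K. norm (\<xi> \<omega> v) \<le> c * norm v} \<in> sets K" for v
      using \<xi>[of v] by measurable
    then have "{\<omega> \<in> space K. \<forall>v\<in>D. norm (\<xi> \<omega> v) \<le> c * norm v} \<in> sets K"
      using D(1) by (intro sets.sets_Collect_countable_All')
    then show ?thesis
      unfolding bound by (cases "0 \<le> c") auto
  qed
  then show ?thesis by (simp add: borel_measurable_iff_le)
qed

text \<open>The face maps of simplices. Vertex sequences are total functions and
  \<open>coord\<close> alone truncates them, so the identities between face maps and prism maps hold
  without upper bounds on indices.\<close>

definition del :: "nat \<Rightarrow> (nat \<Rightarrow> 'x) \<Rightarrow> nat \<Rightarrow> 'x" where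
  "del i xs j = (if j < i then xs j else xs (Suc j))"

section \<open>Cochains in orbit coordinates\<close>

context measured_action
begin

lemma AE_free: "AE x in M. \<forall>y\<in>Orb x. stabilizer \<Gamma> \<phi> y = {\<one>}"
  using free AE_orbit unfolding essentially_free_def by blast

definition coord :: "nat \<Rightarrow> 'x \<Rightarrow> (nat \<Rightarrow> 'x) \<Rightarrow> nat \<Rightarrow> 'g \<times> 'x" where
  "coord n x xs = (\<lambda>i\<in>{..<n}. arr (xs i) x)"

lemma coord_cong: "(\<And>i. i < n \<Longrightarrow> xs i = ys i) \<Longrightarrow> coord n x xs = coord n x ys"
  by (auto simp: coord_def)

lemma source_in_orbit:
  assumes "g \<in> space (arrows G)"
  shows "source G g \<in> Orb (target G g)" "source G g \<in> space M" "target G g \<in> Orb (source G g)"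
proof -
  obtain \<gamma> x where g: "g = (\<gamma>, x)" "\<gamma> \<in> carrier \<Gamma>" "x \<in> space M"
    using assms by (auto simp: semidirect_simps)
  then show "target G g \<in> Orb (source G g)" "source G g \<in> space M"
    by (auto simp: semidirect_simps intro: orbitI)
  then show "source G g \<in> Orb (target G g)"
    using orbit_sym orbit_space by blast
qed

lemma arr_mult:
  assumes "\<forall>y\<in>Orb x. stabilizer \<Gamma> \<phi> y = {\<one>}" "x \<in> space M" "y \<in> Orb x" "z \<in> Orb x" "w \<in> Orb x"
  shows "gmult G (arr y z) (arr w y) = arr w z"
proof -
  interpret group \<Gamma> by (rule group_Gamma)
  have sp: "y \<in> space M" "z \<in> space M" "w \<in> space M" using assms orbit_space by auto
  have orb: "Orb y = Orb x" "Orb z = Orb x" "Orb w = Orb x" using assms orbit_eq by auto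
  obtain \<gamma> \<delta> where \<gamma>: "arr y z = (\<gamma>, y)" "\<gamma> \<in> carrier \<Gamma>" and \<delta>: "arr w y = (\<delta>, w)" "\<delta> \<in> carrier \<Gamma>"
    using arr_in[OF sp(1), of z] arr_in[OF sp(3), of y] by (auto simp: arr_def semidirect_simps)
  have "\<phi> \<gamma> y = z" "\<phi> \<delta> w = y"
    using target_arr[of z y] target_arr[of y w] assms orb \<gamma> \<delta> by (auto simp: semidirect_simps)
  then have "arr (source G (\<gamma> \<otimes> \<delta>, w)) z = (\<gamma> \<otimes> \<delta>, w)"
    using assms sp \<gamma> \<delta> by (intro arr_source_target) (auto simp: semidirect_simps composition_rule)
  then show ?thesis using \<gamma> \<delta> by (simp add: semidirect_simps)
qed

lemma arr_ginv:
  assumes "\<forall>y\<in>Orb x. stabilizer \<Gamma> \<phi> y = {\<one>}" "x \<in> space M" "y \<in> Orb x" "z \<in> Orb x"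
  shows "ginv G (arr y z) = arr z y"
proof -
  interpret group \<Gamma> by (rule group_Gamma)
  have sp: "y \<in> space M" "z \<in> space M" using assms orbit_space by auto
  have orb: "Orb y = Orb x" "Orb z = Orb x" using assms orbit_eq by auto
  obtain \<gamma> where \<gamma>: "arr y z = (\<gamma>, y)" "\<gamma> \<in> carrier \<Gamma>"
    using arr_in[OF sp(1), of z] by (auto simp: arr_def semidirect_simps)
  have "\<phi> \<gamma> y = z"
    using target_arr[of z y] assms orb \<gamma> by (auto simp: semidirect_simps)
  then have "arr (source G (inv \<gamma>, z)) y = (inv \<gamma>, z)"
    using assms sp \<gamma> orbit_sym_aux[OF \<gamma>(2) sp(1)]
    by (intro arr_source_target) (auto simp: semidirect_simps)
  then show ?thesis using \<gamma> \<open>\<phi> \<gamma> y = z\<close> by (simp add: semidirect_simps)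
qed

lemma fibre_tuples_coord:
  assumes x: "x \<in> space M" and fr: "\<forall>y\<in>Orb x. stabilizer \<Gamma> \<phi> y = {\<one>}"
  shows "fibre_tuples n x = {coord n x xs | xs. \<forall>i<n. xs i \<in> Orb x}" (is "_ = ?R")
proof
  show "fibre_tuples n x \<subseteq> ?R"
  proof
    fix gs assume gs: "gs \<in> fibre_tuples n x"
    then have gi: "gs i \<in> space (arrows G)" "target G (gs i) = x" if "i < n" for i
      using that by (auto simp: fibre_tuples_def PiE_iff)
    have "source G (gs i) \<in> Orb x" if "i < n" for i
      using source_in_orbit(1)[OF gi(1)[OF that]] gi(2)[OF that] by simp
    moreover from this have "gs = coord n x (\<lambda>i. source G (gs i))"
      using gs fr gi by (auto simp: coord_def fibre_tuples_def PiE_iff extensional_def arr_source_target)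
    ultimately show "gs \<in> ?R" by blast
  qed
  show "?R \<subseteq> fibre_tuples n x"
  proof clarify
    fix xs assume xs: "\<forall>i<n. xs i \<in> Orb x"
    have "xs i \<in> space M" "x \<in> Orb (xs i)" if "i < n" for i
      using xs that x orbit_space orbit_sym by blast+
    then show "coord n x xs \<in> fibre_tuples n x"
      by (simp add: fibre_tuples_def coord_def arr_in target_arr)
  qed
qed

theorem AE_coord:
  assumes "0 < n"
  shows "(AE gs in tuple_measure G \<nu> \<kappa> n. P gs) \<longleftrightarrow>
    (AE x in M. \<forall>xs. (\<forall>i<n. xs i \<in> Orb x) \<longrightarrow> P (coord n x xs))"
proof -
  have "(AE x in M. (\<forall>gs\<in>fibre_tuples n x. P gs) \<longleftrightarrow> (\<forall>xs. (\<forall>i<n. xs i \<in> Orb x) \<longrightarrow> P (coord n x xs)))"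
    using AE_free AE_space[of M] by eventually_elim (auto simp: fibre_tuples_coord)
  then show ?thesis unfolding AE_tuple[OF assms] by (rule eventually_subst)
qed

text \<open>Let g be the arrow from z to x. Translating an arrow from y to x by the inverse of g
  gives the arrow from y to z. So translation moves the base point and fixes the orbit points, and
  invariance links the values over the base points of one orbit.\<close>

lemma invariant_fun_coord:
  assumes n: "0 < n"
  shows "invariant_fun G \<nu> \<kappa> A n \<xi> \<longleftrightarrow>
    (AE x in M. \<forall>z\<in>Orb x. \<forall>xs. (\<forall>i<n. xs i \<in> Orb x) \<longrightarrow>
      A (arr z x) (\<xi> (coord n z xs)) = \<xi> (coord n x xs))"
proof -
  have "AE x in M.
      (\<forall>xs. (\<forall>i<Suc n. xs i \<in> Orb x) \<longrightarrow>
        A (coord (Suc n) x xs 0)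
          (\<xi> (\<lambda>i\<in>{..<n}. gmult G (ginv G (coord (Suc n) x xs 0)) (coord (Suc n) x xs (Suc i)))) =
        \<xi> (\<lambda>i\<in>{..<n}. coord (Suc n) x xs (Suc i))) \<longleftrightarrow>
      (\<forall>z\<in>Orb x. \<forall>xs. (\<forall>i<n. xs i \<in> Orb x) \<longrightarrow>
        A (arr z x) (\<xi> (coord n z xs)) = \<xi> (coord n x xs))"
    using AE_free AE_space[of M]
  proof eventually_elim
    case (elim x)
    have mult: "(\<lambda>i\<in>{..<n}. gmult G (ginv G (coord (Suc n) x xs 0)) (coord (Suc n) x xs (Suc i))) =
          coord n (xs 0) (\<lambda>i. xs (Suc i))" if xs: "\<forall>i<Suc n. xs i \<in> Orb x" for xs
    proof -
      have "gmult G (ginv G (arr (xs 0) x)) (arr (xs (Suc i)) x) = arr (xs (Suc i)) (xs 0)" if "i < n" for i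
      proof -
        have "xs 0 \<in> Orb x" "xs (Suc i) \<in> Orb x" "x \<in> Orb x"
          using that xs orbit_refl elim by auto
        then show ?thesis using arr_ginv[OF elim] arr_mult[OF elim] by simp
      qed
      then show ?thesis by (auto simp: coord_def)
    qed
    have tail: "(\<lambda>i\<in>{..<n}. coord (Suc n) x xs (Suc i)) = coord n x (\<lambda>i. xs (Suc i))"
      and head: "coord (Suc n) x xs 0 = arr (xs 0) x" for xs
      by (auto simp: coord_def)
    show ?case
    proof (intro iffI ballI allI impI, goal_cases)
      case (1 z xs)
      \<comment> \<open>The definition of invariance keeps the translating arrow in slot 0 of a
        longer tuple, so its source z is put in front of the orbit points.\<close>
      define ys where "ys i = (case i of 0 \<Rightarrow> z | Suc j \<Rightarrow> xs j)" for i
      have ys: "\<forall>i<Suc n. ys i \<in> Orb x"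
        using 1(2,3) by (auto simp: ys_def split: nat.split)
      have tl: "(\<lambda>i. ys (Suc i)) = xs" and hd: "ys 0 = z" by (auto simp: ys_def)
      from 1(1)[THEN spec, THEN mp, OF ys] show ?case
        unfolding mult[OF ys] unfolding tail head tl hd .
    next
      case (2 xs)
      then have "xs 0 \<in> Orb x" "\<forall>i<n. xs (Suc i) \<in> Orb x" by auto
      then show ?case
        unfolding mult[OF 2(2)] unfolding tail head using 2(1) by simp
    qed
  qed
  then show ?thesis
    unfolding invariant_fun_def AE_coord[OF zero_less_Suc] by (rule eventually_subst)
qed

lemma cochains_iff:
  "\<xi> \<in> cochains G \<nu> \<kappa> A k \<longleftrightarrow>
    (\<forall>v. (\<lambda>\<omega>. \<xi> \<omega> v) \<in> borel_measurable (tuple_measure G \<nu> \<kappa> (k + 1))) \<and>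
    (\<exists>C. AE \<omega> in tuple_measure G \<nu> \<kappa> (k + 1). norm (\<xi> \<omega>) \<le> C) \<and>
    (AE x in M. \<forall>z\<in>Orb x. \<forall>xs. (\<forall>i<k+1. xs i \<in> Orb x) \<longrightarrow>
      A (arr z x) (\<xi> (coord (k+1) z xs)) = \<xi> (coord (k+1) x xs))"
  unfolding cochains_def Linf_wstar_def
  using invariant_fun_coord[of "k + 1" A \<xi>] by (simp only: mem_Collect_eq conj_assoc add_gr_0 zero_less_one simp_thms)

lemma coboundary_coord:
  "coboundary k \<xi> (coord (k + 2) x xs) = (\<Sum>i<k + 2. (- 1) ^ i *\<^sub>R \<xi> (coord (k + 1) x (del i xs)))"
  unfolding coboundary_def
  by (intro sum.cong refl arg_cong2[where f=scaleR] arg_cong[where f=\<xi>]) (auto simp: coord_def del_def)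

end

section \<open>Seminormed quotients\<close>

lemma Linf_norm_nonneg:
  assumes "(\<lambda>\<omega>. norm (\<xi> \<omega>)) \<in> borel_measurable K"
  shows "0 \<le> Linf_norm K \<xi>"
proof (cases "emeasure K (space K) = 0")
  \<comment> \<open>On a null space the essential supremum is -infinity, which
    \<open>real_of_ereal\<close> sends to 0.\<close>
  case True
  then show ?thesis using assms by (simp add: Linf_norm_def esssup_zero_space)
next
  case False
  have "(0::ereal) = esssup K (\<lambda>_. 0)" using esssup_const[OF False] by simp
  also have "\<dots> \<le> esssup K (\<lambda>\<omega>. ereal (norm (\<xi> \<omega>)))" by (intro esssup_mono) auto
  finally show ?thesis unfolding Linf_norm_def by (rule real_of_ereal_pos)
qed

text \<open>Comparing almost everywhere bounds makes sense for functions on different measure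
  spaces. Since \<open>real_of_ereal\<close> sends infinity to 0, it is monotone here only because
  \<open>bdd\<close> keeps the larger supremum below infinity.\<close>

lemma Linf_norm_mono:
  assumes "(\<lambda>\<omega>. norm (\<xi> \<omega>)) \<in> borel_measurable K" "(\<lambda>\<omega>. norm (\<xi>' \<omega>)) \<in> borel_measurable K'"
    and bdd: "AE \<omega> in K. norm (\<xi> \<omega>) \<le> C"
    and le: "\<And>c. (AE \<omega> in K. norm (\<xi> \<omega>) \<le> c) \<Longrightarrow> (AE \<omega> in K'. norm (\<xi>' \<omega>) \<le> c)"
  shows "Linf_norm K' \<xi>' \<le> Linf_norm K \<xi>"
proof -
  define e where "e = esssup K (\<lambda>\<omega>. ereal (norm (\<xi> \<omega>)))"
  define e' where "e' = esssup K' (\<lambda>\<omega>. ereal (norm (\<xi>' \<omega>)))"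
  have meas: "(\<lambda>\<omega>. ereal (norm (\<xi> \<omega>))) \<in> borel_measurable K" "(\<lambda>\<omega>. ereal (norm (\<xi>' \<omega>))) \<in> borel_measurable K'"
    using assms(1,2) by auto
  have e'_le: "e' \<le> ereal c" if "e \<le> ereal c" for c
  proof -
    have "AE \<omega> in K. norm (\<xi> \<omega>) \<le> c"
      using esssup_AE[of "\<lambda>\<omega>. ereal (norm (\<xi> \<omega>))" K]
      by eventually_elim (use that in \<open>auto simp: e_def dest: order_trans\<close>)
    from le[OF this] show ?thesis
      unfolding e'_def using meas(2) by (intro esssup_I) auto
  qed
  have "e \<le> ereal C"
    unfolding e_def using meas(1) bdd by (intro esssup_I) auto
  then have "e' \<le> e"
    using e'_le by (cases e) (auto intro: ereal_bot)
  moreover have "0 \<le> real_of_ereal e"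
    using Linf_norm_nonneg[OF assms(1)] by (simp add: Linf_norm_def e_def)
  ultimately have "real_of_ereal e' \<le> real_of_ereal e"
    using \<open>e \<le> ereal C\<close> by (cases e; cases e') auto
  then show ?thesis by (simp add: Linf_norm_def e_def e'_def)
qed

section \<open>Seminormed quotients and equivalences between them\<close>

text \<open>Abstracts the pair of cocycles and coboundaries. The operations of \<open>Hmb\<close>
  are unions over all representatives; such a union collapses to one class because every
  representative yields the same one.\<close>

locale function_quotient =
  fixes Z B :: "('b \<Rightarrow> 'v::real_vector) set"
  assumes Z_lin: "x \<in> Z \<Longrightarrow> y \<in> Z \<Longrightarrow> (\<lambda>\<omega>. a *\<^sub>R x \<omega> + b *\<^sub>R y \<omega>) \<in> Z"
    and B_lin: "x \<in> B \<Longrightarrow> y \<in> B \<Longrightarrow> (\<lambda>\<omega>. a *\<^sub>R x \<omega> + b *\<^sub>R y \<omega>) \<in> B"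
    and B_zero: "(\<lambda>_. 0) \<in> B"
begin

definition cls :: "('b \<Rightarrow> 'v) \<Rightarrow> ('b \<Rightarrow> 'v) set" where
  "cls x = {y \<in> Z. (\<lambda>\<omega>. y \<omega> - x \<omega>) \<in> B}"

definition quotient_space :: "(('b \<Rightarrow> 'v) \<Rightarrow> real) \<Rightarrow> ('b \<Rightarrow> 'v) set seminormed" where
  "quotient_space N =
     \<lparr>vcarrier = cls ` Z,
      vadd = (\<lambda>P Q. \<Union>p\<in>P. \<Union>q\<in>Q. cls (\<lambda>\<omega>. p \<omega> + q \<omega>)),
      vscale = (\<lambda>c P. \<Union>p\<in>P. cls (\<lambda>\<omega>. c *\<^sub>R p \<omega>)),
      vnorm = (\<lambda>P. INF p\<in>P. N p)\<rparr>"

lemma Z_add: "x \<in> Z \<Longrightarrow> y \<in> Z \<Longrightarrow> (\<lambda>\<omega>. x \<omega> + y \<omega>) \<in> Z"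
  using Z_lin[of x y 1 1] by simp

lemma Z_scale: "x \<in> Z \<Longrightarrow> (\<lambda>\<omega>. c *\<^sub>R x \<omega>) \<in> Z"
  using Z_lin[of x x c 0] by simp

lemma B_add: "x \<in> B \<Longrightarrow> y \<in> B \<Longrightarrow> (\<lambda>\<omega>. x \<omega> + y \<omega>) \<in> B"
  using B_lin[of x y 1 1] by simp

lemma B_scale: "x \<in> B \<Longrightarrow> (\<lambda>\<omega>. c *\<^sub>R x \<omega>) \<in> B"
  using B_lin[of x x c 0] by simp

lemma B_diff_commute: "(\<lambda>\<omega>. x \<omega> - y \<omega>) \<in> B \<Longrightarrow> (\<lambda>\<omega>. y \<omega> - x \<omega>) \<in> B"
  using B_scale[of "\<lambda>\<omega>. x \<omega> - y \<omega>" "-1"] by simp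

lemma B_diff_trans: "(\<lambda>\<omega>. x \<omega> - y \<omega>) \<in> B \<Longrightarrow> (\<lambda>\<omega>. y \<omega> - z \<omega>) \<in> B \<Longrightarrow> (\<lambda>\<omega>. x \<omega> - z \<omega>) \<in> B"
  using B_add[of "\<lambda>\<omega>. x \<omega> - y \<omega>" "\<lambda>\<omega>. y \<omega> - z \<omega>"] by simp

lemma cls_self: "x \<in> Z \<Longrightarrow> x \<in> cls x"
  using B_zero by (simp add: cls_def)

lemma cls_eq: "(\<lambda>\<omega>. x \<omega> - y \<omega>) \<in> B \<Longrightarrow> cls x = cls y"
  unfolding cls_def using B_diff_trans B_diff_commute by blast

lemma cls_eq_iff: "x \<in> Z \<Longrightarrow> cls x = cls y \<longleftrightarrow> (\<lambda>\<omega>. x \<omega> - y \<omega>) \<in> B"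
  using cls_eq cls_self by (auto simp: cls_def)

lemma cls_UN:
  assumes "x \<in> Z" "\<And>p. p \<in> cls x \<Longrightarrow> h p = c"
  shows "(\<Union>p\<in>cls x. h p) = c"
  using assms cls_self by auto

lemma cls_add:
  assumes "x \<in> Z" "y \<in> Z"
  shows "(\<Union>p\<in>cls x. \<Union>q\<in>cls y. cls (\<lambda>\<omega>. p \<omega> + q \<omega>)) = cls (\<lambda>\<omega>. x \<omega> + y \<omega>)"
proof (intro cls_UN assms cls_eq)
  fix p q assume "p \<in> cls x" "q \<in> cls y"
  then show "(\<lambda>\<omega>. (p \<omega> + q \<omega>) - (x \<omega> + y \<omega>)) \<in> B"
    using B_add[of "\<lambda>\<omega>. p \<omega> - x \<omega>" "\<lambda>\<omega>. q \<omega> - y \<omega>"]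
    by (simp add: cls_def algebra_simps)
qed

lemma cls_scale:
  assumes "x \<in> Z"
  shows "(\<Union>p\<in>cls x. cls (\<lambda>\<omega>. c *\<^sub>R p \<omega>)) = cls (\<lambda>\<omega>. c *\<^sub>R x \<omega>)"
proof (intro cls_UN assms cls_eq)
  fix p assume "p \<in> cls x"
  then show "(\<lambda>\<omega>. c *\<^sub>R p \<omega> - c *\<^sub>R x \<omega>) \<in> B"
    using B_scale[of "\<lambda>\<omega>. p \<omega> - x \<omega>" c] by (simp add: cls_def algebra_simps)
qed

end

text \<open>\<open>f\<close> and \<open>g\<close> are inverse to each other modulo \<open>B\<close>
  and \<open>B'\<close>, and both are contracting. This makes the induced bijection isometric for
  the infimum seminorms.\<close>

locale quotient_equivalence =
  A: function_quotient Z B + B: function_quotient Z' B'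
  for Z B :: "('b \<Rightarrow> 'v::real_vector) set" and Z' B' :: "('c \<Rightarrow> 'w::real_vector) set" +
  fixes f :: "('b \<Rightarrow> 'v) \<Rightarrow> 'c \<Rightarrow> 'w" and g :: "('c \<Rightarrow> 'w) \<Rightarrow> 'b \<Rightarrow> 'v"
    and N :: "('b \<Rightarrow> 'v) \<Rightarrow> real" and N' :: "('c \<Rightarrow> 'w) \<Rightarrow> real"
  assumes f_lin: "f (\<lambda>\<omega>. a *\<^sub>R x \<omega> + b *\<^sub>R y \<omega>) = (\<lambda>\<omega>. a *\<^sub>R f x \<omega> + b *\<^sub>R f y \<omega>)"
    and g_lin: "g (\<lambda>\<omega>. a *\<^sub>R x' \<omega> + b *\<^sub>R y' \<omega>) = (\<lambda>\<omega>. a *\<^sub>R g x' \<omega> + b *\<^sub>R g y' \<omega>)"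
    and f_Z: "x \<in> Z \<Longrightarrow> f x \<in> Z'" and f_B: "x \<in> B \<Longrightarrow> f x \<in> B'"
    and g_Z: "x' \<in> Z' \<Longrightarrow> g x' \<in> Z" and g_B: "x' \<in> B' \<Longrightarrow> g x' \<in> B"
    and gf: "x \<in> Z \<Longrightarrow> (\<lambda>\<omega>. g (f x) \<omega> - x \<omega>) \<in> B"
    and fg: "x' \<in> Z' \<Longrightarrow> (\<lambda>\<omega>. f (g x') \<omega> - x' \<omega>) \<in> B'"
    and N_nonneg: "x \<in> Z \<Longrightarrow> 0 \<le> N x" and N'_nonneg: "x' \<in> Z' \<Longrightarrow> 0 \<le> N' x'"
    and f_N: "x \<in> Z \<Longrightarrow> N' (f x) \<le> N x" and g_N: "x' \<in> Z' \<Longrightarrow> N (g x') \<le> N' x'"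
begin

definition induced :: "('b \<Rightarrow> 'v) set \<Rightarrow> ('c \<Rightarrow> 'w) set" where
  "induced P = (\<Union>p\<in>P. B.cls (f p))"

lemma f_diff: "f (\<lambda>\<omega>. x \<omega> - y \<omega>) = (\<lambda>\<omega>. f x \<omega> - f y \<omega>)"
  using f_lin[of 1 x "-1" y] by simp

lemma g_diff: "g (\<lambda>\<omega>. x \<omega> - y \<omega>) = (\<lambda>\<omega>. g x \<omega> - g y \<omega>)"
  using g_lin[of 1 x "-1" y] by simp

lemma induced_cls: "x \<in> Z \<Longrightarrow> induced (A.cls x) = B.cls (f x)"
  unfolding induced_def
  by (intro A.cls_UN B.cls_eq) (auto simp: A.cls_def f_diff[symmetric] f_B)

lemma INF_le:
  assumes "x \<in> Z"
  shows "(INF p\<in>B.cls (f x). N' p) \<le> (INF p\<in>A.cls x. N p)"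
proof (rule cINF_greatest)
  show "A.cls x \<noteq> {}" using A.cls_self assms by blast
  fix p assume p: "p \<in> A.cls x"
  then have "f p \<in> B.cls (f x)"
    using f_Z f_B by (auto simp: A.cls_def B.cls_def f_diff[symmetric])
  then have "(INF p\<in>B.cls (f x). N' p) \<le> N' (f p)"
    using N'_nonneg by (intro cINF_lower bdd_belowI[where m=0]) (auto simp: B.cls_def)
  also have "\<dots> \<le> N p" using f_N p by (simp add: A.cls_def)
  finally show "(INF p\<in>B.cls (f x). N' p) \<le> N p" .
qed

text \<open>If p represents the class of f x, then g p differs from g (f x), and hence from x, by an
  element of \<open>B\<close>. So \<open>g\<close> maps representatives back into the class of x
  without increasing the norm.\<close>

lemma INF_ge:
  assumes "x \<in> Z"
  shows "(INF p\<in>A.cls x. N p) \<le> (INF p\<in>B.cls (f x). N' p)"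
proof (rule cINF_greatest)
  show "B.cls (f x) \<noteq> {}" using B.cls_self f_Z assms by blast
  fix p assume p: "p \<in> B.cls (f x)"
  then have "(\<lambda>\<omega>. g p \<omega> - g (f x) \<omega>) \<in> B"
    using g_B by (auto simp: B.cls_def g_diff[symmetric])
  then have "g p \<in> A.cls x"
    using g_Z p gf[OF assms] A.B_diff_trans by (auto simp: A.cls_def B.cls_def)
  then have "(INF p\<in>A.cls x. N p) \<le> N (g p)"
    using N_nonneg by (intro cINF_lower bdd_belowI[where m=0]) (auto simp: A.cls_def)
  also have "\<dots> \<le> N' p" using g_N p by (simp add: B.cls_def)
  finally show "(INF p\<in>A.cls x. N p) \<le> N' p" .
qed

theorem isometric_iso_induced: "isometric_iso (A.quotient_space N) (B.quotient_space N') induced"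
proof -
  have inj: "inj_on induced (A.cls ` Z)"
  proof (rule inj_onI, clarify)
    fix x y assume xy: "x \<in> Z" "y \<in> Z" "induced (A.cls x) = induced (A.cls y)"
    then have "(\<lambda>\<omega>. f x \<omega> - f y \<omega>) \<in> B'"
      by (simp add: induced_cls B.cls_eq_iff f_Z)
    then have "(\<lambda>\<omega>. g (f x) \<omega> - g (f y) \<omega>) \<in> B" unfolding g_diff[symmetric] by (rule g_B)
    then have "(\<lambda>\<omega>. x \<omega> - y \<omega>) \<in> B"
      using A.B_diff_trans A.B_diff_commute gf xy by blast
    then show "A.cls x = A.cls y" by (rule A.cls_eq)
  qed
  have surj: "induced ` A.cls ` Z = B.cls ` Z'"
  proof
    show "induced ` A.cls ` Z \<subseteq> B.cls ` Z'" using f_Z by (auto simp: induced_cls)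
    show "B.cls ` Z' \<subseteq> induced ` A.cls ` Z"
    proof clarify
      fix x' assume "x' \<in> Z'"
      then have "B.cls x' = induced (A.cls (g x'))" "g x' \<in> Z"
        using B.cls_eq[OF fg] g_Z by (simp_all add: induced_cls)
      then show "B.cls x' \<in> induced ` A.cls ` Z" by blast
    qed
  qed
  have f_add: "f (\<lambda>\<omega>. x \<omega> + y \<omega>) = (\<lambda>\<omega>. f x \<omega> + f y \<omega>)" for x y
    using f_lin[of 1 x 1 y] by simp
  have f_scale: "f (\<lambda>\<omega>. c *\<^sub>R x \<omega>) = (\<lambda>\<omega>. c *\<^sub>R f x \<omega>)" for c x
    using f_lin[of c x 0 x] by simp
  show ?thesis
    unfolding isometric_iso_def linear_iso_def bij_betw_def A.quotient_space_def B.quotient_space_def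
      seminormed.simps
    using inj surj INF_le INF_ge f_Z
    by (auto simp: induced_cls A.cls_add B.cls_add A.cls_scale B.cls_scale A.Z_add A.Z_scale
          f_add f_scale intro: antisym)
qed

lemma mem_induced: "P \<in> A.cls ` Z \<Longrightarrow> x \<in> P \<Longrightarrow> f x \<in> induced P"
  using B.cls_self f_Z by (auto simp: induced_def A.cls_def)

end

section \<open>Prism operator and pullbacks\<close>

text \<open>The i-th simplex (x_0, ..., x_i, r x_i, ..., r x_k) of the prism over (x_0, ..., x_k).
  The vertex x_i occurs both plain and moved, whence the shift to \<open>j - 1\<close>.\<close>

definition prism_map :: "('x \<Rightarrow> 'x) \<Rightarrow> nat \<Rightarrow> (nat \<Rightarrow> 'x) \<Rightarrow> nat \<Rightarrow> 'x" where
  "prism_map r i xs j = (if j \<le> i then xs j else r (xs (j - 1)))"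

text \<open>The alternating sum of the cocycle identities over all prism simplices is 0. The two
  faces next to the step from plain to moved vertices telescope to the left-hand side; every other
  face is a prism simplex over a face of \<open>xs\<close>, with the opposite sign. What remains is
  the coboundary of the prism operator applied to \<open>e\<close>.\<close>

lemma prism_homotopy:
  fixes e :: "(nat \<Rightarrow> 'x) \<Rightarrow> 'v::real_vector"
  assumes ext: "\<And>xs ys. (\<And>i. i < k + 1 \<Longrightarrow> xs i = ys i) \<Longrightarrow> e xs = e ys"
    and cocycle: "\<And>i. i < k + 1 \<Longrightarrow> (\<Sum>j<k + 2. (- 1) ^ j *\<^sub>R e (del j (prism_map r i xs))) = 0"
  shows "e (\<lambda>j. r (xs j)) - e xs =
    (\<Sum>j<k + 1. (- 1) ^ j *\<^sub>R (\<Sum>i<k. (- 1) ^ i *\<^sub>R e (prism_map r i (del j xs))))"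
proof -
  define a where "a i j = (- 1) ^ (i + j) *\<^sub>R e (del j (prism_map r i xs))" for i j
  define b where "b i j = (- 1) ^ (i + j) *\<^sub>R e (prism_map r i (del j xs))" for i j
  define m where "m i = e (\<lambda>j. if j < i then xs j else r (xs j))" for i
  \<comment> \<open>Deleting the last plain or the first moved vertex of the i-th simplex gives the
    neighbouring staircases \<open>m i\<close> and \<open>m (Suc i)\<close>; the exponents 2i and 2i
    + 1 give them opposite signs.\<close>
  have diag: "a i i + a i (Suc i) = m i - m (Suc i)" for i
  proof -
    have "del i (prism_map r i xs) = (\<lambda>j. if j < i then xs j else r (xs j))"
      "del (Suc i) (prism_map r i xs) = (\<lambda>j. if j < Suc i then xs j else r (xs j))"
      by (auto simp: del_def prism_map_def)
    then show ?thesis by (simp add: a_def m_def mult_2[symmetric])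
  qed
  have below: "a (Suc i) j = - b i j" if "j < Suc i" for i j
  proof -
    have "del j (prism_map r (Suc i) xs) = prism_map r i (del j xs)"
      using that by (auto simp: del_def prism_map_def fun_eq_iff)
    then show ?thesis by (simp add: a_def b_def)
  qed
  have above: "a i (Suc j) = - b i j" if "i < j" for i j
  proof -
    have "del (Suc j) (prism_map r i xs) = prism_map r i (del j xs)"
      using that by (auto simp: del_def prism_map_def fun_eq_iff)
    then show ?thesis by (simp add: a_def b_def)
  qed
  have split: "(\<Sum>j<k + 2. a i j) = (\<Sum>j<i. a i j) + (m i - m (Suc i)) + (\<Sum>j=Suc i..<k + 1. a i (Suc j))"
    if "i < k + 1" for i
  proof -
    have "(\<Sum>j<k + 2. a i j) = (\<Sum>j=0..<i. a i j) + (\<Sum>j=i..<Suc (Suc i). a i j) + (\<Sum>j=Suc (Suc i)..<k + 2. a i j)"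
      using that by (simp add: lessThan_atLeast0 sum.atLeastLessThan_concat del: sum.op_ivl_Suc)
    also have "(\<Sum>j=i..<Suc (Suc i). a i j) = m i - m (Suc i)"
      by (simp add: diag)
    also have "(\<Sum>j=Suc (Suc i)..<k + 2. a i j) = (\<Sum>j=Suc i..<k + 1. a i (Suc j))"
      using sum.shift_bounds_Suc_ivl[of "a i" "Suc i" "k + 1"] by simp
    finally show ?thesis by (simp add: lessThan_atLeast0)
  qed
  have "0 = (\<Sum>i<k + 1. \<Sum>j<k + 2. a i j)"
  proof -
    have "(\<Sum>j<k + 2. a i j) = (- 1) ^ i *\<^sub>R (\<Sum>j<k + 2. (- 1) ^ j *\<^sub>R e (del j (prism_map r i xs)))" for i
      by (simp only: a_def scaleR_sum_right scaleR_scaleR power_add)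
    then show ?thesis using cocycle by simp
  qed
  also have "\<dots> = (\<Sum>i<k + 1. (\<Sum>j<i. a i j) + (m i - m (Suc i)) + (\<Sum>j=Suc i..<k + 1. a i (Suc j)))"
    by (intro sum.cong refl split) simp
  also have "\<dots> = (\<Sum>i<k + 1. \<Sum>j<i. a i j) + (m 0 - m (k + 1)) + (\<Sum>i<k + 1. \<Sum>j=Suc i..<k + 1. a i (Suc j))"
    by (simp only: sum.distrib sum_lessThan_telescope')
  \<comment> \<open>The lower triangle drops its empty row 0 and is shifted, the upper one drops its
    empty row k; together they then fill the rectangle \<open>i < k\<close>,
    \<open>j < k + 1\<close>.\<close>
  also have "(\<Sum>i<k + 1. \<Sum>j<i. a i j) = (\<Sum>i<k. \<Sum>j<Suc i. a (Suc i) j)"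
    using sum.lessThan_Suc_shift[of "\<lambda>i. \<Sum>j<i. a i j" k] by simp
  also have "\<dots> = (\<Sum>i<k. \<Sum>j<Suc i. - b i j)"
    by (intro sum.cong refl below) simp
  also have "(\<Sum>i<k + 1. \<Sum>j=Suc i..<k + 1. a i (Suc j)) = (\<Sum>i<k. \<Sum>j=Suc i..<k + 1. - b i j)"
    by (simp add: above)
  finally have "m (k + 1) - m 0 = (\<Sum>i<k. (\<Sum>j<Suc i. - b i j) + (\<Sum>j=Suc i..<k + 1. - b i j))"
    by (simp only: sum.distrib) (simp add: algebra_simps)
  also have "\<dots> = (\<Sum>i<k. \<Sum>j<k + 1. - b i j)"
    by (intro sum.cong refl) (simp add: lessThan_atLeast0 sum.atLeastLessThan_concat del: sum.op_ivl_Suc)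
  also have "\<dots> = - (\<Sum>j<k + 1. \<Sum>i<k. b i j)"
    by (subst sum.swap) (simp add: sum_negf)
  also have "(\<Sum>j<k + 1. \<Sum>i<k. b i j) =
      (\<Sum>j<k + 1. (- 1) ^ j *\<^sub>R (\<Sum>i<k. (- 1) ^ i *\<^sub>R e (prism_map r i (del j xs))))"
    by (simp only: b_def scaleR_sum_right scaleR_scaleR power_add mult.commute)
  finally have "m 0 - m (k + 1) =
      (\<Sum>j<k + 1. (- 1) ^ j *\<^sub>R (\<Sum>i<k. (- 1) ^ i *\<^sub>R e (prism_map r i (del j xs))))"
    by (simp add: algebra_simps)
  moreover have "m 0 = e (\<lambda>j. r (xs j))" "m (k + 1) = e xs"
    by (auto simp: m_def intro: ext)
  ultimately show ?thesis by simp
qed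

section \<open>Linear structure of cochains and of cohomology\<close>

lemma coboundary_lincomb:
  "coboundary k (\<lambda>gs. a *\<^sub>R \<xi> gs + b *\<^sub>R \<eta> gs) gs = a *\<^sub>R coboundary k \<xi> gs + b *\<^sub>R coboundary k \<eta> gs"
  unfolding coboundary_def
  by (simp only: scaleR_add_right sum.distrib scaleR_sum_right scaleR_scaleR mult.commute)

context measured_action
begin

lemma measurable_tuple_component:
  "i < n \<Longrightarrow> (\<lambda>gs. gs i) \<in> tuple_measure G \<nu> \<kappa> n \<rightarrow>\<^sub>M arrows G"
  unfolding measurable_tuple_iff
  by (intro measurable_restrict_space1 measurable_component_singleton) auto

lemma cochains_lincomb:
  assumes A: "\<And>g. linear (A g)"
    and \<xi>: "\<xi> \<in> cochains G \<nu> \<kappa> A k" and \<eta>: "\<eta> \<in> cochains G \<nu> \<kappa> A k"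
  shows "(\<lambda>gs. a *\<^sub>R \<xi> gs + b *\<^sub>R \<eta> gs) \<in> cochains G \<nu> \<kappa> A k"
  unfolding cochains_iff
proof (intro conjI allI)
  have meas: "(\<lambda>\<omega>. \<xi> \<omega> v) \<in> borel_measurable (tuple_measure G \<nu> \<kappa> (k + 1))"
    "(\<lambda>\<omega>. \<eta> \<omega> v) \<in> borel_measurable (tuple_measure G \<nu> \<kappa> (k + 1))" for v
    using \<xi> \<eta> unfolding cochains_iff by auto
  show "(\<lambda>\<omega>. (a *\<^sub>R \<xi> \<omega> + b *\<^sub>R \<eta> \<omega>) v) \<in> borel_measurable (tuple_measure G \<nu> \<kappa> (k + 1))" for v
    unfolding plus_blinfun.rep_eq scaleR_blinfun.rep_eq
    by (intro borel_measurable_add borel_measurable_scaleR borel_measurable_const meas)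
  obtain C D where C: "AE \<omega> in tuple_measure G \<nu> \<kappa> (k + 1). norm (\<xi> \<omega>) \<le> C"
    and D: "AE \<omega> in tuple_measure G \<nu> \<kappa> (k + 1). norm (\<eta> \<omega>) \<le> D"
    using \<xi> \<eta> unfolding cochains_iff by blast
  have "AE \<omega> in tuple_measure G \<nu> \<kappa> (k + 1). norm (a *\<^sub>R \<xi> \<omega> + b *\<^sub>R \<eta> \<omega>) \<le> \<bar>a\<bar> * C + \<bar>b\<bar> * D"
    using C D
  proof eventually_elim
    case (elim \<omega>)
    have "norm (a *\<^sub>R \<xi> \<omega> + b *\<^sub>R \<eta> \<omega>) \<le> \<bar>a\<bar> * norm (\<xi> \<omega>) + \<bar>b\<bar> * norm (\<eta> \<omega>)"
      using norm_triangle_ineq[of "a *\<^sub>R \<xi> \<omega>" "b *\<^sub>R \<eta> \<omega>"] by simp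
    also have "\<dots> \<le> \<bar>a\<bar> * C + \<bar>b\<bar> * D" using elim by (intro add_mono mult_left_mono) auto
    finally show ?case .
  qed
  then show "\<exists>C. AE \<omega> in tuple_measure G \<nu> \<kappa> (k + 1). norm (a *\<^sub>R \<xi> \<omega> + b *\<^sub>R \<eta> \<omega>) \<le> C" by blast
  have inv: "AE x in M. \<forall>z\<in>Orb x. \<forall>xs. (\<forall>i<k+1. xs i \<in> Orb x) \<longrightarrow>
      A (arr z x) (\<zeta> (coord (k+1) z xs)) = \<zeta> (coord (k+1) x xs)" if "\<zeta> \<in> cochains G \<nu> \<kappa> A k" for \<zeta>
    using that unfolding cochains_iff by blast
  show "AE x in M. \<forall>z\<in>Orb x. \<forall>xs. (\<forall>i<k+1. xs i \<in> Orb x) \<longrightarrow>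
      A (arr z x) (a *\<^sub>R \<xi> (coord (k+1) z xs) + b *\<^sub>R \<eta> (coord (k+1) z xs)) =
      a *\<^sub>R \<xi> (coord (k+1) x xs) + b *\<^sub>R \<eta> (coord (k+1) x xs)"
    using inv[OF \<xi>] inv[OF \<eta>] by eventually_elim (simp add: linear_add[OF A] linear_scale[OF A])
qed

lemma cochains_zero:
  assumes A: "\<And>g. linear (A g)"
  shows "(\<lambda>_. 0) \<in> cochains G \<nu> \<kappa> A k"
  unfolding cochains_iff by (auto simp: linear_0[OF A] intro!: exI[of _ 0])

lemma cochains_sum:
  fixes n :: nat
  assumes A: "\<And>g. linear (A g)" and "\<And>i. i < n \<Longrightarrow> \<xi> i \<in> cochains G \<nu> \<kappa> A k"
  shows "(\<lambda>gs. \<Sum>i<n. c i *\<^sub>R \<xi> i gs) \<in> cochains G \<nu> \<kappa> A k"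
  using assms(2)
proof (induction n)
  case 0
  then show ?case using cochains_zero[OF A] by simp
next
  case (Suc n)
  then show ?case using cochains_lincomb[OF A, where \<xi>="\<lambda>gs. \<Sum>i<n. c i *\<^sub>R \<xi> i gs" and \<eta>="\<xi> n" and a=1 and b="c n"] by simp
qed

lemma cohomology_function_quotient:
  assumes A: "\<And>g. linear (A g)"
  shows "function_quotient (cocycles G \<nu> \<kappa> A k) (coboundaries G \<nu> \<kappa> A k)"
proof
  fix x y a b
  show "(\<lambda>\<omega>. a *\<^sub>R x \<omega> + b *\<^sub>R y \<omega>) \<in> cocycles G \<nu> \<kappa> A k"
    if "x \<in> cocycles G \<nu> \<kappa> A k" "y \<in> cocycles G \<nu> \<kappa> A k"
    using that unfolding cocycles_def
    by (auto simp: coboundary_lincomb intro!: cochains_lincomb[OF A])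
  show "(\<lambda>\<omega>. a *\<^sub>R x \<omega> + b *\<^sub>R y \<omega>) \<in> coboundaries G \<nu> \<kappa> A k"
    if x: "x \<in> coboundaries G \<nu> \<kappa> A k" and y: "y \<in> coboundaries G \<nu> \<kappa> A k"
  proof (cases k)
    case 0
    then show ?thesis
      using x y unfolding coboundaries_def by (auto intro!: cochains_lincomb[OF A])
  next
    case (Suc j)
    then obtain \<xi> \<eta> where *: "\<xi> \<in> cochains G \<nu> \<kappa> A j" "\<eta> \<in> cochains G \<nu> \<kappa> A j"
      "AE gs in tuple_measure G \<nu> \<kappa> (k + 1). x gs = coboundary j \<xi> gs"
      "AE gs in tuple_measure G \<nu> \<kappa> (k + 1). y gs = coboundary j \<eta> gs"
      using x y unfolding coboundaries_def by auto
    have "AE gs in tuple_measure G \<nu> \<kappa> (k + 1).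
        a *\<^sub>R x gs + b *\<^sub>R y gs = coboundary j (\<lambda>gs. a *\<^sub>R \<xi> gs + b *\<^sub>R \<eta> gs) gs"
      using *(3,4) by eventually_elim (simp add: coboundary_lincomb)
    moreover have "(\<lambda>\<omega>. a *\<^sub>R x \<omega> + b *\<^sub>R y \<omega>) \<in> cochains G \<nu> \<kappa> A k"
      using x y unfolding coboundaries_def by (auto intro!: cochains_lincomb[OF A])
    ultimately show ?thesis
      using cochains_lincomb[OF A *(1,2), of a b] Suc unfolding coboundaries_def by auto
  qed
next
  show "(\<lambda>_. 0) \<in> coboundaries G \<nu> \<kappa> A k"
    using cochains_zero[OF A] unfolding coboundaries_def
    by (auto split: nat.split simp: coboundary_def intro!: bexI[of _ "\<lambda>_. 0"])
qed

lemma Hmb_eq_quotient_space: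
  assumes A: "\<And>g. linear (A g)"
  shows "Hmb G \<nu> \<kappa> A k =
    function_quotient.quotient_space (cocycles G \<nu> \<kappa> A k) (coboundaries G \<nu> \<kappa> A k)
      (Linf_norm (tuple_measure G \<nu> \<kappa> (k + 1)))"
proof -
  interpret function_quotient "cocycles G \<nu> \<kappa> A k" "coboundaries G \<nu> \<kappa> A k"
    by (rule cohomology_function_quotient[OF A])
  have "cohomology_class G \<nu> \<kappa> A k = cls"
    by (simp add: fun_eq_iff cohomology_class_def cls_def)
  then show ?thesis by (simp add: Hmb_def quotient_space_def)
qed

end

section \<open>Pullback of cochains\<close>

locale two_actions =
  S: measured_action \<Gamma> \<phi> M \<nu> \<kappa> + T: measured_action \<Lambda> \<psi> N \<nu>' \<kappa>'
  for \<Gamma> :: "('g, 'm) monoid_scheme" and \<phi> :: "'g \<Rightarrow> 'x \<Rightarrow> 'x" and M \<nu> \<kappa>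
    and \<Lambda> :: "('l, 'n) monoid_scheme" and \<psi> :: "'l \<Rightarrow> 'y \<Rightarrow> 'y" and N \<nu>' \<kappa>'
begin

text \<open>
  If \<open>q j x\<close> lies in the orbit of \<open>p x\<close> for all \<open>j\<close>, then \<open>pull\<close> is the cochain
  \<open>(g\<^sub>0, \<dots>, g\<^sub>n\<^sub>-\<^sub>1) \<mapsto> \<xi> (h\<^sub>0, \<dots>, h\<^sub>m\<^sub>-\<^sub>1) \<circ> b x\<close>, where \<open>x\<close> is the common target of the \<open>g\<^sub>i\<close> and \<open>h\<^sub>j\<close> is
  the arrow from \<open>q j (s g\<^bsub>c j\<^esub>)\<close> to \<open>p x\<close>. The case distinction makes it measurable everywhere.
\<close>

definition pull ::
    "nat \<Rightarrow> ('x \<Rightarrow> 'y) \<Rightarrow> (nat \<Rightarrow> 'x \<Rightarrow> 'y) \<Rightarrow> (nat \<Rightarrow> nat) \<Rightarrow> ('x \<Rightarrow> ('e::real_normed_vector \<Rightarrow>\<^sub>L 'e)) \<Rightarrow>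
     ((nat \<Rightarrow> 'l \<times> 'y) \<Rightarrow> 'e dual) \<Rightarrow> (nat \<Rightarrow> 'g \<times> 'x) \<Rightarrow> 'e dual" where
  "pull m p q c b \<xi> gs =
     (let x = target S.G (gs 0); hs = (\<lambda>j\<in>{..<m}. T.arr (q j (source S.G (gs (c j)))) (p x))
      in if \<forall>j<m. target T.G (hs j) = p x then \<xi> hs o\<^sub>L b x else 0)"

lemma pull_lin:
  fixes \<xi> \<eta> :: "(nat \<Rightarrow> 'l \<times> 'y) \<Rightarrow> 'e::real_normed_vector dual"
  shows "pull m p q c b (\<lambda>\<omega>. s *\<^sub>R \<xi> \<omega> + t *\<^sub>R \<eta> \<omega>) = (\<lambda>\<omega>. s *\<^sub>R pull m p q c b \<xi> \<omega> + t *\<^sub>R pull m p q c b \<eta> \<omega>)"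
proof -
  have lin: "(s *\<^sub>R f + t *\<^sub>R f') o\<^sub>L h = s *\<^sub>R (f o\<^sub>L h) + t *\<^sub>R (f' o\<^sub>L h)" for f f' :: "'e dual" and h :: "'e \<Rightarrow>\<^sub>L 'e"
    by (rule blinfun_eqI) (simp add: blinfun.bilinear_simps)
  have if_lin: "(if P then u else 0) = s *\<^sub>R (if P then v else 0) + t *\<^sub>R (if P then w else 0)"
    if "u = s *\<^sub>R v + t *\<^sub>R w" for P and u v w :: "'e dual"
    using that by simp
  show ?thesis unfolding pull_def Let_def by (rule ext, rule if_lin, rule lin)
qed

lemma pull_coord:
  assumes x: "x \<in> space M" and n: "0 < n" and xs: "\<forall>i<n. xs i \<in> S.Orb x"
    and p: "p x \<in> space N" and c: "\<forall>j<m. c j < n" and q: "\<forall>j<m. q j (xs (c j)) \<in> T.Orb (p x)"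
  shows "pull m p q c b \<xi> (S.coord n x xs) = \<xi> (T.coord m (p x) (\<lambda>j. q j (xs (c j)))) o\<^sub>L b x"
proof -
  have "x \<in> S.Orb (xs 0)"
    using xs n S.orbit_sym S.orbit_space x by blast
  then have target: "target S.G (S.coord n x xs 0) = x"
    using n by (simp add: S.coord_def S.target_arr)
  have hs: "(\<lambda>j\<in>{..<m}. T.arr (q j (source S.G (S.coord n x xs (c j)))) (p x)) =
      T.coord m (p x) (\<lambda>j. q j (xs (c j)))"
    using c by (auto simp: S.coord_def T.coord_def)
  have "p x \<in> T.Orb (q j (xs (c j)))" if "j < m" for j
    using q that T.orbit_sym T.orbit_space p by blast
  then have "\<forall>j<m. target T.G (T.coord m (p x) (\<lambda>j. q j (xs (c j))) j) = p x"
    by (simp add: T.coord_def T.target_arr)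
  then show ?thesis unfolding pull_def Let_def target hs by (rule if_P)
qed

text \<open>The functional and the vector \<open>b x v\<close> both vary with the tuple, so this
  needs \<open>wstar_pairing_measurable\<close>.\<close>

lemma pull_measurable:
  fixes \<xi> :: "(nat \<Rightarrow> 'l \<times> 'y) \<Rightarrow> 'e::{banach, second_countable_topology} dual"
    and b :: "'x \<Rightarrow> ('e \<Rightarrow>\<^sub>L 'e)"
  assumes \<xi>: "\<And>v. (\<lambda>hs. \<xi> hs v) \<in> borel_measurable (tuple_measure T.G \<nu>' \<kappa>' m)"
    and p: "p \<in> M \<rightarrow>\<^sub>M N" and q: "\<And>j. j < m \<Longrightarrow> q j \<in> M \<rightarrow>\<^sub>M N" and c: "\<And>j. j < m \<Longrightarrow> c j < n"
    and n: "0 < n" and b: "\<And>v. (\<lambda>x. b x v) \<in> borel_measurable M"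
  shows "(\<lambda>gs. pull m p q c b \<xi> gs v) \<in> borel_measurable (tuple_measure S.G \<nu> \<kappa> n)"
proof -
  let ?K = "tuple_measure S.G \<nu> \<kappa> n"
  define X where "X gs = target S.G (gs 0)" for gs :: "nat \<Rightarrow> 'g \<times> 'x"
  define H where "H gs = (\<lambda>j\<in>{..<m}. T.arr (q j (source S.G (gs (c j)))) (p (X gs)))" for gs
  have X: "X \<in> ?K \<rightarrow>\<^sub>M M"
    unfolding X_def by (rule measurable_compose[OF S.measurable_tuple_component[OF n] S.measurable_target])
  have h: "(\<lambda>gs. T.arr (q j (source S.G (gs (c j)))) (p (X gs))) \<in> ?K \<rightarrow>\<^sub>M arrows T.G" if "j < m" for j
    using measurable_compose[OF measurable_compose[OF S.measurable_tuple_component[OF c[OF that]] S.measurable_source] q[OF that]]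
      measurable_compose[OF X p]
    by (rule T.measurable_arr)
  have H: "H \<in> ?K \<rightarrow>\<^sub>M (\<Pi>\<^sub>M j\<in>{..<m}. arrows T.G)"
    unfolding H_def using h by (intro measurable_restrict) auto
  define D where "D = {gs. \<forall>j\<in>{..<m}. target T.G (H gs j) = p (X gs)}"
  have D: "D \<inter> space ?K \<in> sets ?K"
  proof -
    have "Measurable.pred ?K (\<lambda>gs. target T.G (H gs j) = p (X gs))" if "j < m" for j
      using that measurable_compose[OF h T.measurable_target] measurable_compose[OF X p]
      by (intro standard_borel_pred_eq[OF T.standard]) (simp_all add: H_def)
    then have "Measurable.pred ?K (\<lambda>gs. \<forall>j\<in>{..<m}. target T.G (H gs j) = p (X gs))"
      by (intro pred_intros_finite) auto
    moreover have "D \<inter> space ?K = {gs \<in> space ?K. \<forall>j\<in>{..<m}. target T.G (H gs j) = p (X gs)}"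
      unfolding D_def by blast
    ultimately show ?thesis unfolding pred_def by (simp only:)
  qed
  \<comment> \<open>\<open>\<xi>\<close> is measurable only on tuples with a common target; on
    \<open>D\<close> all targets equal \<open>p (X gs)\<close>. Off \<open>D\<close> the default 0
    of \<open>pull\<close> takes over.\<close>
  have HD: "H \<in> restrict_space ?K D \<rightarrow>\<^sub>M tuple_measure T.G \<nu>' \<kappa>' m"
  proof -
    have "H \<in> restrict_space ?K D \<rightarrow>\<^sub>M restrict_space (\<Pi>\<^sub>M j\<in>{..<m}. arrows T.G)
        {gs. \<forall>i<m. \<forall>j<m. target T.G (gs i) = target T.G (gs j)}"
      using H by (intro measurable_restrict_space2 measurable_restrict_space1)
        (simp_all add: space_restrict_space D_def)
    moreover have "sets (tuple_measure T.G \<nu>' \<kappa>' m) = sets (restrict_space (\<Pi>\<^sub>M j\<in>{..<m}. arrows T.G)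
        {gs. \<forall>i<m. \<forall>j<m. target T.G (gs i) = target T.G (gs j)})"
      unfolding tuple_measure_def by (rule sets_restrict_space_cong[OF T.sets_tuple_bind])
    ultimately show ?thesis using measurable_cong_sets[OF refl] by blast
  qed
  have "(\<lambda>gs. \<xi> (H gs) (b (X gs) v)) \<in> borel_measurable (restrict_space ?K D)"
  proof (rule wstar_pairing_measurable)
    show "(\<lambda>gs. \<xi> (H gs) w) \<in> borel_measurable (restrict_space ?K D)" for w
      by (rule measurable_compose[OF HD \<xi>])
    show "(\<lambda>gs. b (X gs) v) \<in> borel_measurable (restrict_space ?K D)"
      by (rule measurable_restrict_space1[OF measurable_compose[OF X b]])
  qed
  then have "(\<lambda>gs. if gs \<in> D then \<xi> (H gs) (b (X gs) v) else 0) \<in> borel_measurable ?K"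
    using D by (subst measurable_If_restrict_space_iff) (auto simp: Int_def conj_commute)
  moreover have "pull m p q c b \<xi> gs v = (if gs \<in> D then \<xi> (H gs) (b (X gs) v) else 0)" for gs
    by (simp add: pull_def Let_def D_def H_def X_def)
  ultimately show ?thesis by simp
qed

end

lemma compose_id_blinfun [simp]: "f o\<^sub>L id_blinfun = f"
  by (rule blinfun_eqI) simp

text \<open>Nonsingularity is stated as transport of almost everywhere properties, the form in which
  it is applied. The map \<open>p\<close> may identify points of an orbit, as it does when it first
  moves points into a smaller set.\<close>

locale orbit_map = two_actions \<Gamma> \<phi> M \<nu> \<kappa> \<Lambda> \<psi> N \<nu>' \<kappa>'
  for \<Gamma> :: "('g, 'm) monoid_scheme" and \<phi> :: "'g \<Rightarrow> 'x \<Rightarrow> 'x" and M \<nu> \<kappa>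
    and \<Lambda> :: "('l, 'n) monoid_scheme" and \<psi> :: "'l \<Rightarrow> 'y \<Rightarrow> 'y" and N \<nu>' \<kappa>' +
  fixes p :: "'x \<Rightarrow> 'y"
  assumes p_measurable: "p \<in> M \<rightarrow>\<^sub>M N"
    and p_nonsingular: "(AE y in N. P y) \<Longrightarrow> (AE x in M. P (p x))"
    and p_orbit: "AE x in M. \<forall>z\<in>S.Orb x. p z \<in> T.Orb (p x)"
begin

lemma p_space: "x \<in> space M \<Longrightarrow> p x \<in> space N"
  using p_measurable by (rule measurable_space)

text \<open>The quantifier over \<open>\<xi>\<close> stands inside the almost everywhere quantifier:
  one conull set serves all functions at once, among them \<open>\<xi>\<close> and its
  coboundary.\<close>

lemma AE_pull_coord:
  fixes n m :: nat and b :: "'x \<Rightarrow> ('e::real_normed_vector \<Rightarrow>\<^sub>L 'e)"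
  assumes n: "0 < n" and c: "\<forall>j<m. c j < n"
    and q: "\<forall>j<m. AE x in M. \<forall>z\<in>S.Orb x. q j z \<in> T.Orb (p x)"
  shows "AE x in M. \<forall>xs. (\<forall>i<n. xs i \<in> S.Orb x) \<longrightarrow>
    (\<forall>j<m. q j (xs (c j)) \<in> T.Orb (p x)) \<and>
    (\<forall>\<xi>. pull m p q c b \<xi> (S.coord n x xs) = \<xi> (T.coord m (p x) (\<lambda>j. q j (xs (c j)))) o\<^sub>L b x)"
proof -
  have "AE x in M. \<forall>j\<in>{..<m}. \<forall>z\<in>S.Orb x. q j z \<in> T.Orb (p x)"
    using q by (intro AE_finite_allI) auto
  then show ?thesis using AE_space[of M]
  proof eventually_elim
    case (elim x)
    show ?case
    proof (intro allI impI)
      fix xs assume xs: "\<forall>i<n. xs i \<in> S.Orb x"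
      then have qx: "\<forall>j<m. q j (xs (c j)) \<in> T.Orb (p x)"
        using elim(1) c by blast
      then show "(\<forall>j<m. q j (xs (c j)) \<in> T.Orb (p x)) \<and>
          (\<forall>\<xi>. pull m p q c b \<xi> (S.coord n x xs) = \<xi> (T.coord m (p x) (\<lambda>j. q j (xs (c j)))) o\<^sub>L b x)"
        using pull_coord[where p=p and q=q and c=c and m=m, OF elim(2) n xs p_space[OF elim(2)] c qx] by blast
    qed
  qed
qed

lemma pull_bound:
  fixes \<xi> :: "(nat \<Rightarrow> 'l \<times> 'y) \<Rightarrow> 'e::real_normed_vector dual"
    and b :: "'x \<Rightarrow> ('e \<Rightarrow>\<^sub>L 'e)"
  assumes n: "0 < n" and m: "0 < m" and c: "\<forall>j<m. c j < n"
    and q: "\<forall>j<m. AE x in M. \<forall>z\<in>S.Orb x. q j z \<in> T.Orb (p x)"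
    and b: "AE x in M. norm (b x) \<le> 1"
    and \<xi>: "AE hs in tuple_measure T.G \<nu>' \<kappa>' m. norm (\<xi> hs) \<le> C"
  shows "AE gs in tuple_measure S.G \<nu> \<kappa> n. norm (pull m p q c b \<xi> gs) \<le> C"
  unfolding S.AE_coord[OF n]
  using p_nonsingular[OF \<xi>[unfolded T.AE_coord[OF m]]] AE_pull_coord[where b=b, OF n c q] b
proof eventually_elim
  case (elim x)
  show ?case
  proof (intro allI impI)
    fix xs assume "\<forall>i<n. xs i \<in> S.Orb x"
    with elim(2) have orb: "\<forall>j<m. q j (xs (c j)) \<in> T.Orb (p x)"
      and eq: "pull m p q c b \<xi> (S.coord n x xs) = \<xi> (T.coord m (p x) (\<lambda>j. q j (xs (c j)))) o\<^sub>L b x"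
      by blast+
    let ?f = "\<xi> (T.coord m (p x) (\<lambda>j. q j (xs (c j))))"
    have "norm (?f o\<^sub>L b x) \<le> norm ?f * norm (b x)" by (rule norm_blinfun_compose)
    also have "\<dots> \<le> norm ?f" using elim(3) by (simp add: mult_left_le)
    also have "\<dots> \<le> C" by (rule elim(1)[THEN spec, THEN mp, OF orb])
    finally show "norm (pull m p q c b \<xi> (S.coord n x xs)) \<le> C" unfolding eq .
  qed
qed

text \<open>By \<open>equivariant\<close>, composition with \<open>b\<close> intertwines the two
  actions along an arrow and its image. The vertices \<open>q j (xs (c j))\<close> do not depend on
  the base point, so invariance of \<open>\<xi>\<close> along the arrow from p z to p x becomes
  invariance of the pullback. Keeping \<open>l\<close>, \<open>c\<close> and \<open>q\<close>
  general covers both chain maps and prism operators.\<close>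

lemma pull_cochain:
  fixes \<xi> :: "(nat \<Rightarrow> 'l \<times> 'y) \<Rightarrow> 'e::{banach, second_countable_topology} dual"
    and b :: "'x \<Rightarrow> ('e \<Rightarrow>\<^sub>L 'e)"
  assumes c: "\<forall>j<l + 1. c j < k + 1"
    and q: "\<forall>j<l + 1. q j \<in> M \<rightarrow>\<^sub>M N"
      "\<forall>j<l + 1. AE x in M. \<forall>z\<in>S.Orb x. q j z \<in> T.Orb (p x)"
    and b: "\<And>v. (\<lambda>x. b x v) \<in> borel_measurable M" "AE x in M. norm (b x) \<le> 1"
    and equivariant: "AE x in M. \<forall>z\<in>S.Orb x. \<forall>\<zeta>.
      A (S.arr z x) (\<zeta> o\<^sub>L b z) = A' (T.arr (p z) (p x)) \<zeta> o\<^sub>L b x"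
    and \<xi>: "\<xi> \<in> cochains T.G \<nu>' \<kappa>' A' l"
  shows "pull (l + 1) p q c b \<xi> \<in> cochains S.G \<nu> \<kappa> A k"
  unfolding S.cochains_iff
proof (intro conjI allI)
  have \<xi>_meas: "(\<lambda>hs. \<xi> hs v) \<in> borel_measurable (tuple_measure T.G \<nu>' \<kappa>' (l + 1))" for v
    using \<xi> unfolding T.cochains_iff by blast
  show "(\<lambda>gs. pull (l + 1) p q c b \<xi> gs v) \<in> borel_measurable (tuple_measure S.G \<nu> \<kappa> (k + 1))" for v
    by (rule pull_measurable[OF \<xi>_meas p_measurable _ _ _ b(1)]) (use q(1) c in auto)
  obtain C where "AE hs in tuple_measure T.G \<nu>' \<kappa>' (l + 1). norm (\<xi> hs) \<le> C"
    using \<xi> unfolding T.cochains_iff by blast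
  then show "\<exists>C. AE gs in tuple_measure S.G \<nu> \<kappa> (k + 1). norm (pull (l + 1) p q c b \<xi> gs) \<le> C"
    using pull_bound[OF _ _ c q(2) b(2)] by (metis add_gr_0 zero_less_one)
  have "AE y in N. \<forall>w\<in>T.Orb y. \<forall>ys. (\<forall>i<l+1. ys i \<in> T.Orb y) \<longrightarrow>
      A' (T.arr w y) (\<xi> (T.coord (l+1) w ys)) = \<xi> (T.coord (l+1) y ys)"
    using \<xi> unfolding T.cochains_iff by blast
  note inv = p_nonsingular[OF this]
  have "0 < k + 1" by simp
  note coord = AE_pull_coord[OF this c q(2), where b=b]
  show "AE x in M. \<forall>z\<in>S.Orb x. \<forall>xs. (\<forall>i<k+1. xs i \<in> S.Orb x) \<longrightarrow>
      A (S.arr z x) (pull (l + 1) p q c b \<xi> (S.coord (k+1) z xs)) = pull (l + 1) p q c b \<xi> (S.coord (k+1) x xs)"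
    using S.AE_orbit[OF coord] coord inv equivariant p_orbit AE_space[of M]
  proof eventually_elim
    case (elim x)
    show ?case
    proof (intro ballI allI impI)
      fix z xs assume z: "z \<in> S.Orb x" and xs: "\<forall>i<k+1. xs i \<in> S.Orb x"
      have orb: "S.Orb z = S.Orb x" using S.orbit_eq elim z by blast
      define ys where "ys = (\<lambda>j. q j (xs (c j)))"
      have ys: "\<forall>j<l+1. ys j \<in> T.Orb (p x)"
        and x: "pull (l + 1) p q c b \<xi> (S.coord (k+1) x xs) = \<xi> (T.coord (l+1) (p x) ys) o\<^sub>L b x"
        using elim(2) xs unfolding ys_def by blast+
      have z': "pull (l + 1) p q c b \<xi> (S.coord (k+1) z xs) = \<xi> (T.coord (l+1) (p z) ys) o\<^sub>L b z"
        using elim(1) z xs orb unfolding ys_def by blast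
      have "A (S.arr z x) (\<xi> (T.coord (l+1) (p z) ys) o\<^sub>L b z) =
          A' (T.arr (p z) (p x)) (\<xi> (T.coord (l+1) (p z) ys)) o\<^sub>L b x"
        using elim(4) z by blast
      also have "A' (T.arr (p z) (p x)) (\<xi> (T.coord (l+1) (p z) ys)) = \<xi> (T.coord (l+1) (p x) ys)"
        using elim(5) z by (intro elim(3)[THEN bspec, THEN spec, THEN mp, OF _ ys]) blast
      finally show "A (S.arr z x) (pull (l + 1) p q c b \<xi> (S.coord (k+1) z xs)) = pull (l + 1) p q c b \<xi> (S.coord (k+1) x xs)"
        unfolding x z' .
    qed
  qed
qed

end

section \<open>Changing orbit points is homotopic to the identity\<close>

context measured_action
begin

lemma homotopic_to_identity:
  fixes \<eta> \<zeta> :: "(nat \<Rightarrow> 'g \<times> 'x) \<Rightarrow> 'e::{banach, second_countable_topology} dual"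
  assumes A: "\<And>g. linear (A g)"
    and r: "r \<in> M \<rightarrow>\<^sub>M M" "AE x in M. r x \<in> Orb x"
    and \<eta>: "\<eta> \<in> cocycles G \<nu> \<kappa> A k" and \<zeta>: "\<zeta> \<in> cochains G \<nu> \<kappa> A k"
    and eq: "AE x in M. \<forall>xs. (\<forall>i<k+1. xs i \<in> Orb x) \<longrightarrow>
      \<zeta> (coord (k+1) x xs) = \<eta> (coord (k+1) x (\<lambda>j. r (xs j)))"
  shows "(\<lambda>gs. \<zeta> gs - \<eta> gs) \<in> coboundaries G \<nu> \<kappa> A k"
proof -
  interpret two_actions \<Gamma> \<phi> M \<nu> \<kappa> \<Gamma> \<phi> M \<nu> \<kappa> ..
  \<comment> \<open>With the identity as base map, \<open>pull\<close> moves the orbit points alone,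
    so \<open>pull_cochain\<close> shows that the prism terms are cochains.\<close>
  interpret I: orbit_map \<Gamma> \<phi> M \<nu> \<kappa> \<Gamma> \<phi> M \<nu> \<kappa> "\<lambda>x. x"
    by unfold_locales auto
  have \<eta>_cochain: "\<eta> \<in> cochains G \<nu> \<kappa> A k" using \<eta> by (simp add: cocycles_def)
  have diff: "(\<lambda>gs. \<zeta> gs - \<eta> gs) \<in> cochains G \<nu> \<kappa> A k"
    using cochains_lincomb[OF A \<zeta> \<eta>_cochain, of 1 "-1"] by simp
  have r_orb: "AE x in M. \<forall>z\<in>Orb x. r z \<in> Orb x"
    using AE_orbit[OF r(2)] AE_space[of M] by eventually_elim (use orbit_eq in blast)
  have \<eta>_cocycle: "AE x in M. \<forall>xs. (\<forall>i<k+2. xs i \<in> Orb x) \<longrightarrow> coboundary k \<eta> (coord (k+2) x xs) = 0"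
    using \<eta> AE_coord[of "k + 2"] by (simp add: cocycles_def)
  have prism: "AE x in M. \<forall>xs. (\<forall>i<k+1. xs i \<in> Orb x) \<longrightarrow>
      \<zeta> (coord (k+1) x xs) - \<eta> (coord (k+1) x xs) =
      (\<Sum>j<k + 1. (- 1) ^ j *\<^sub>R (\<Sum>i<k. (- 1) ^ i *\<^sub>R \<eta> (coord (k+1) x (prism_map r i (del j xs)))))"
    using eq \<eta>_cocycle r_orb
  proof eventually_elim
    case (elim x)
    show ?case
    proof (intro allI impI)
      fix xs assume xs: "\<forall>i<k+1. xs i \<in> Orb x"
      have "\<eta> (coord (k+1) x (\<lambda>j. r (xs j))) - \<eta> (coord (k+1) x xs) =
        (\<Sum>j<k + 1. (- 1) ^ j *\<^sub>R (\<Sum>i<k. (- 1) ^ i *\<^sub>R \<eta> (coord (k+1) x (prism_map r i (del j xs)))))"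
      proof (rule prism_homotopy[where e="\<lambda>ys. \<eta> (coord (k+1) x ys)"])
        show "\<eta> (coord (k+1) x ys) = \<eta> (coord (k+1) x zs)" if "\<And>i. i < k + 1 \<Longrightarrow> ys i = zs i" for ys zs
          using coord_cong[of "k + 1" ys zs x] that by simp
        fix i assume i: "i < k + 1"
        have "\<forall>j<k+2. prism_map r i xs j \<in> Orb x"
          using xs elim(3) i by (auto simp: prism_map_def)
        then show "(\<Sum>j<k + 2. (- 1) ^ j *\<^sub>R \<eta> (coord (k+1) x (del j (prism_map r i xs)))) = 0"
          using elim(2) unfolding coboundary_coord by blast
      qed
      then show "\<zeta> (coord (k+1) x xs) - \<eta> (coord (k+1) x xs) =
        (\<Sum>j<k + 1. (- 1) ^ j *\<^sub>R (\<Sum>i<k. (- 1) ^ i *\<^sub>R \<eta> (coord (k+1) x (prism_map r i (del j xs)))))"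
        using elim(1) xs by simp
    qed
  qed
  show ?thesis
  proof (cases k)
    \<comment> \<open>The inner sums over \<open>i < k\<close> are empty, so the difference vanishes
      almost everywhere, which is what being a coboundary means in degree 0.\<close>
    case 0
    then have "AE gs in tuple_measure G \<nu> \<kappa> (k + 1). \<zeta> gs - \<eta> gs = 0"
      using prism unfolding AE_coord[of "k + 1", OF zero_less_Suc[of k, unfolded Suc_eq_plus1]] by simp
    then show ?thesis using diff unfolding 0 coboundaries_def by simp
  next
    case (Suc l)
    \<comment> \<open>The prism map is split into a choice of index and a map on points, as
      \<open>pull\<close> requires: entry j of the i-th simplex is \<open>q i j\<close> applied to
      entry \<open>c i j\<close>.\<close>
    define c where "c i j = (if j \<le> i then j else j - 1)" for i j :: nat
    define q where "q i j = (if j \<le> i then \<lambda>x. x else r)" for i j :: nat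
    define P where "P i = pull (k + 1) (\<lambda>x. x) (q i) (c i) (\<lambda>_. id_blinfun) \<eta>" for i
    define D where "D gs = (\<Sum>i<k. (- 1) ^ i *\<^sub>R P i gs)" for gs
    have q_orb: "\<forall>j<k + 1. AE x in M. \<forall>z\<in>Orb x. q i j z \<in> Orb x" for i
    proof (intro allI impI)
      show "AE x in M. \<forall>z\<in>Orb x. q i j z \<in> Orb x" for j
        using r_orb by eventually_elim (auto simp: q_def)
    qed
    have c_less: "\<forall>j<k + 1. c i j < l + 1" if "i < k" for i
      using that Suc by (auto simp: c_def)
    have P: "P i \<in> cochains G \<nu> \<kappa> A l" if "i < k" for i
      unfolding P_def
    proof (rule I.pull_cochain[OF c_less[OF that] _ q_orb _ _ _ \<eta>_cochain])
      show "\<forall>j<k + 1. q i j \<in> M \<rightarrow>\<^sub>M M" using r(1) by (simp add: q_def)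
      show "AE x in M. norm (id_blinfun :: 'e \<Rightarrow>\<^sub>L 'e) \<le> 1"
        by (simp add: norm_blinfun_id_le)
    qed simp_all
    then have D: "D \<in> cochains G \<nu> \<kappa> A l"
      unfolding D_def by (intro cochains_sum[OF A])
    have "AE x in M. \<forall>i\<in>{..<k}. \<forall>xs. (\<forall>j<l+1. xs j \<in> Orb x) \<longrightarrow>
        P i (coord (l+1) x xs) = \<eta> (coord (k+1) x (prism_map r i xs))"
    proof (intro AE_finite_allI)
      fix i assume "i \<in> {..<k}"
      then have i: "i < k" by simp
      have *: "(\<lambda>j. q i j (xs (c i j))) = prism_map r i xs" for xs
        by (auto simp: q_def c_def prism_map_def)
      have "0 < l + 1" by simp
      from I.AE_pull_coord[OF this c_less[OF i] q_orb[of i], where b="\<lambda>_. id_blinfun"]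
      show "AE x in M. \<forall>xs. (\<forall>j<l+1. xs j \<in> Orb x) \<longrightarrow>
          P i (coord (l+1) x xs) = \<eta> (coord (k+1) x (prism_map r i xs))"
        by (rule eventually_mono) (unfold P_def * compose_id_blinfun, blast)
    qed simp
    with prism have "AE x in M. \<forall>xs. (\<forall>i<k+1. xs i \<in> Orb x) \<longrightarrow>
        \<zeta> (coord (k+1) x xs) - \<eta> (coord (k+1) x xs) = coboundary l D (coord (k+1) x xs)"
    proof eventually_elim
      case (elim x)
      show ?case
      proof (intro allI impI)
        fix xs assume xs: "\<forall>i<k+1. xs i \<in> Orb x"
        have "D (coord (l+1) x (del j xs)) = (\<Sum>i<k. (- 1) ^ i *\<^sub>R \<eta> (coord (k+1) x (prism_map r i (del j xs))))" for j
        proof -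
          have "\<forall>i<l+1. del j xs i \<in> Orb x" using xs Suc by (auto simp: del_def)
          then show ?thesis unfolding D_def using elim(2) by (intro sum.cong refl) auto
        qed
        moreover have "k + 1 = l + 2" using Suc by simp
        ultimately show "\<zeta> (coord (k+1) x xs) - \<eta> (coord (k+1) x xs) = coboundary l D (coord (k+1) x xs)"
          using elim(1)[rule_format, of xs] xs coboundary_coord[of l D x xs] by simp
      qed
    qed
    then have "AE gs in tuple_measure G \<nu> \<kappa> (k + 1). \<zeta> gs - \<eta> gs = coboundary l D gs"
      by (subst AE_coord) auto
    then show ?thesis using diff D Suc by (auto simp: coboundaries_def)
  qed
qed

end

section \<open>Isomorphisms from orbit maps\<close>

lemma sum_compose_blinfun:
  fixes f :: "'i \<Rightarrow> 'e::real_normed_vector dual"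
  shows "(\<Sum>i\<in>I. c i *\<^sub>R (f i o\<^sub>L h)) = (\<Sum>i\<in>I. c i *\<^sub>R f i) o\<^sub>L h"
  by (rule blinfun_eqI) (simp add: blinfun.sum_left blinfun.bilinear_simps)

lemma compose_blinfun_assoc: "(f o\<^sub>L g) o\<^sub>L h = f o\<^sub>L (g o\<^sub>L h)"
  by (rule blinfun_eqI) simp

text \<open>Serves both directions: along \<open>p\<close> with \<open>b\<close> the identity, and
  along \<open>q\<close> with \<open>b\<close> the action of the arrow from y to p (q y). The bound
  on \<open>b\<close> keeps norms from growing.\<close>

locale chain_map = orbit_map \<Gamma> \<phi> M \<nu> \<kappa> \<Lambda> \<psi> N \<nu>' \<kappa>' p
  for \<Gamma> :: "('g, 'm) monoid_scheme" and \<phi> :: "'g \<Rightarrow> 'x \<Rightarrow> 'x" and M \<nu> \<kappa>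
    and \<Lambda> :: "('l, 'n) monoid_scheme" and \<psi> :: "'l \<Rightarrow> 'y \<Rightarrow> 'y" and N \<nu>' \<kappa>'
    and p :: "'x \<Rightarrow> 'y" +
  fixes b :: "'x \<Rightarrow> ('e::{banach, second_countable_topology} \<Rightarrow>\<^sub>L 'e)"
    and A :: "'g \<times> 'x \<Rightarrow> 'e dual \<Rightarrow> 'e dual" and A' :: "'l \<times> 'y \<Rightarrow> 'e dual \<Rightarrow> 'e dual"
  assumes b_measurable: "(\<lambda>x. b x v) \<in> borel_measurable M"
    and b_norm: "AE x in M. norm (b x) \<le> 1"
    and equivariant: "AE x in M. \<forall>z\<in>S.Orb x. \<forall>\<zeta>.
      A (S.arr z x) (\<zeta> o\<^sub>L b z) = A' (T.arr (p z) (p x)) \<zeta> o\<^sub>L b x"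
begin

definition cmap :: "nat \<Rightarrow> ((nat \<Rightarrow> 'l \<times> 'y) \<Rightarrow> 'e dual) \<Rightarrow> (nat \<Rightarrow> 'g \<times> 'x) \<Rightarrow> 'e dual" where
  "cmap k = pull (k + 1) p (\<lambda>_. p) (\<lambda>j. j) b"

lemma cmap_coord:
  "AE x in M. \<forall>xs. (\<forall>i<k+1. xs i \<in> S.Orb x) \<longrightarrow>
    (\<forall>j<k+1. p (xs j) \<in> T.Orb (p x)) \<and>
    (\<forall>\<xi>. cmap k \<xi> (S.coord (k+1) x xs) = \<xi> (T.coord (k+1) (p x) (\<lambda>j. p (xs j))) o\<^sub>L b x)"
  unfolding cmap_def using p_orbit by (intro AE_pull_coord) auto

lemma cmap_lin:
  "cmap k (\<lambda>\<omega>. s *\<^sub>R \<xi> \<omega> + t *\<^sub>R \<eta> \<omega>) = (\<lambda>\<omega>. s *\<^sub>R cmap k \<xi> \<omega> + t *\<^sub>R cmap k \<eta> \<omega>)"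
  unfolding cmap_def by (rule pull_lin)

lemma cmap_diff: "cmap k (\<lambda>\<omega>. \<xi> \<omega> - \<eta> \<omega>) = (\<lambda>\<omega>. cmap k \<xi> \<omega> - cmap k \<eta> \<omega>)"
  using cmap_lin[of k 1 \<xi> "-1" \<eta>] by simp

lemma cmap_cochain: "\<xi> \<in> cochains T.G \<nu>' \<kappa>' A' k \<Longrightarrow> cmap k \<xi> \<in> cochains S.G \<nu> \<kappa> A k"
  unfolding cmap_def
  using p_measurable p_orbit b_measurable b_norm equivariant by (intro pull_cochain) auto

lemma cmap_bound:
  "AE hs in tuple_measure T.G \<nu>' \<kappa>' (k + 1). norm (\<xi> hs) \<le> C \<Longrightarrow>
   AE gs in tuple_measure S.G \<nu> \<kappa> (k + 1). norm (cmap k \<xi> gs) \<le> C"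
  unfolding cmap_def using p_orbit b_norm by (intro pull_bound) auto

lemma cmap_zero:
  "AE hs in tuple_measure T.G \<nu>' \<kappa>' (k + 1). \<xi> hs = 0 \<Longrightarrow>
   AE gs in tuple_measure S.G \<nu> \<kappa> (k + 1). cmap k \<xi> gs = 0"
  using cmap_bound[where \<xi>=\<xi> and C=0] by simp

text \<open>Deleting a vertex commutes with applying \<open>p\<close> to all vertices, leaves the
  base point alone, and composition with \<open>b x\<close> is linear. So this holds for arbitrary
  functions \<open>\<xi>\<close>.\<close>

lemma cmap_coboundary:
  "AE gs in tuple_measure S.G \<nu> \<kappa> (k + 2). coboundary k (cmap k \<xi>) gs = cmap (k + 1) (coboundary k \<xi>) gs"
proof -
  have "AE x in M. \<forall>xs. (\<forall>i<k+2. xs i \<in> S.Orb x) \<longrightarrow>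
      coboundary k (cmap k \<xi>) (S.coord (k+2) x xs) = cmap (k + 1) (coboundary k \<xi>) (S.coord (k+2) x xs)"
    using cmap_coord[of k] cmap_coord[of "k + 1"]
  proof eventually_elim
    case (elim x)
    show ?case
    proof (intro allI impI)
      fix xs assume xs: "\<forall>i<k+2. xs i \<in> S.Orb x"
      have k2: "k + 1 + 1 = k + 2" by simp
      have "cmap (k + 1) (coboundary k \<xi>) (S.coord (k+2) x xs) =
          coboundary k \<xi> (T.coord (k+2) (p x) (\<lambda>j. p (xs j))) o\<^sub>L b x"
        using elim(2) xs unfolding k2 by blast
      also have "\<dots> = (\<Sum>i<k + 2. (- 1) ^ i *\<^sub>R (\<xi> (T.coord (k+1) (p x) (del i (\<lambda>j. p (xs j)))) o\<^sub>L b x))"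
        unfolding T.coboundary_coord sum_compose_blinfun ..
      also have "\<dots> = (\<Sum>i<k + 2. (- 1) ^ i *\<^sub>R cmap k \<xi> (S.coord (k+1) x (del i xs)))"
      proof (intro sum.cong refl)
        fix i
        have "\<forall>j<k+1. del i xs j \<in> S.Orb x" using xs by (auto simp: del_def)
        then have "cmap k \<xi> (S.coord (k+1) x (del i xs)) = \<xi> (T.coord (k+1) (p x) (\<lambda>j. p (del i xs j))) o\<^sub>L b x"
          using elim(1) by blast
        moreover have "(\<lambda>j. p (del i xs j)) = del i (\<lambda>j. p (xs j))" by (auto simp: del_def)
        ultimately show "(- 1) ^ i *\<^sub>R (\<xi> (T.coord (k+1) (p x) (del i (\<lambda>j. p (xs j)))) o\<^sub>L b x) =
            (- 1) ^ i *\<^sub>R cmap k \<xi> (S.coord (k+1) x (del i xs))" by simp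
      qed
      finally show "coboundary k (cmap k \<xi>) (S.coord (k+2) x xs) = cmap (k + 1) (coboundary k \<xi>) (S.coord (k+2) x xs)"
        unfolding S.coboundary_coord ..
    qed
  qed
  then show ?thesis by (subst S.AE_coord) auto
qed

lemma cmap_cocycle:
  assumes "\<xi> \<in> cocycles T.G \<nu>' \<kappa>' A' k"
  shows "cmap k \<xi> \<in> cocycles S.G \<nu> \<kappa> A k"
proof -
  have "k + 1 + 1 = k + 2" by simp
  from cmap_zero[where k="k + 1", unfolded this]
  have "AE gs in tuple_measure S.G \<nu> \<kappa> (k + 2). cmap (k + 1) (coboundary k \<xi>) gs = 0"
    using assms unfolding cocycles_def by blast
  with cmap_coboundary[of k \<xi>] have "AE gs in tuple_measure S.G \<nu> \<kappa> (k + 2). coboundary k (cmap k \<xi>) gs = 0"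
    by eventually_elim simp
  then show ?thesis using assms cmap_cochain by (simp add: cocycles_def)
qed

lemma cmap_coboundaries:
  assumes \<xi>: "\<xi> \<in> coboundaries T.G \<nu>' \<kappa>' A' k"
  shows "cmap k \<xi> \<in> coboundaries S.G \<nu> \<kappa> A k"
proof (cases k)
  case 0
  then show ?thesis using \<xi> cmap_zero[where k=0] cmap_cochain[where k=0] by (simp add: coboundaries_def)
next
  case (Suc j)
  then obtain \<eta> where \<eta>: "\<eta> \<in> cochains T.G \<nu>' \<kappa>' A' j"
    "AE hs in tuple_measure T.G \<nu>' \<kappa>' (k + 1). \<xi> hs = coboundary j \<eta> hs"
    using \<xi> by (auto simp: coboundaries_def)
  have idx: "j + 1 = k" "j + 2 = k + 1" using Suc by simp_all
  have "AE gs in tuple_measure S.G \<nu> \<kappa> (k + 1). cmap k (\<lambda>hs. \<xi> hs - coboundary j \<eta> hs) gs = 0"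
    using \<eta>(2) by (intro cmap_zero) auto
  moreover have "AE gs in tuple_measure S.G \<nu> \<kappa> (k + 1). coboundary j (cmap j \<eta>) gs = cmap k (coboundary j \<eta>) gs"
    by (rule cmap_coboundary[where k=j, unfolded idx])
  ultimately have "AE gs in tuple_measure S.G \<nu> \<kappa> (k + 1). cmap k \<xi> gs = coboundary j (cmap j \<eta>) gs"
    by eventually_elim (simp add: cmap_diff)
  then show ?thesis
    using \<xi> cmap_cochain \<eta>(1) Suc by (auto simp: coboundaries_def)
qed

lemma cmap_norm:
  assumes \<xi>: "\<xi> \<in> cochains T.G \<nu>' \<kappa>' A' k"
  shows "Linf_norm (tuple_measure S.G \<nu> \<kappa> (k + 1)) (cmap k \<xi>) \<le> Linf_norm (tuple_measure T.G \<nu>' \<kappa>' (k + 1)) \<xi>"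
proof -
  obtain C where "AE hs in tuple_measure T.G \<nu>' \<kappa>' (k + 1). norm (\<xi> hs) \<le> C"
    using \<xi> unfolding T.cochains_iff by blast
  then show ?thesis
    using \<xi> cmap_cochain[OF \<xi>] cmap_bound unfolding T.cochains_iff S.cochains_iff
    by (intro Linf_norm_mono wstar_norm_measurable) blast+
qed

end

section \<open>Coefficient modules in orbit coordinates\<close>

context measured_action
begin

lemma cochain_norm_nonneg:
  fixes \<xi> :: "(nat \<Rightarrow> 'g \<times> 'x) \<Rightarrow> 'e::{banach, second_countable_topology} dual"
  assumes "\<xi> \<in> cochains G \<nu> \<kappa> A k"
  shows "0 \<le> Linf_norm (tuple_measure G \<nu> \<kappa> (k + 1)) \<xi>"
  using assms unfolding cochains_iff by (intro Linf_norm_nonneg wstar_norm_measurable) blast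

lemma linear_contragredient: "linear (contragredient G L\<^sub>b g)"
  by (rule linearI; rule blinfun_eqI) (simp_all add: contragredient_def blinfun.bilinear_simps)

lemma module_norm: "coefficient_module G L\<^sub>b \<Longrightarrow> g \<in> space (arrows G) \<Longrightarrow> norm (L\<^sub>b g) \<le> 1"
  by (intro norm_blinfun_bound) (auto simp: coefficient_module_def)

text \<open>Multiplicativity is given for almost every right factor and all left factors. Spreading
  the exceptional null set along orbits gives all composable pairs within almost every
  orbit.\<close>

lemma module_cocycle:
  assumes L: "coefficient_module G L\<^sub>b"
  shows "AE x in M. \<forall>u\<in>Orb x. \<forall>v\<in>Orb x. \<forall>w\<in>Orb x.
    L\<^sub>b (arr v w) o\<^sub>L L\<^sub>b (arr u v) = L\<^sub>b (arr u w)"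
proof -
  have "AE x in M. \<forall>\<gamma>\<in>carrier \<Gamma>. \<forall>h\<in>space (arrows G). source G h = target G (\<gamma>, x) \<longrightarrow>
      L\<^sub>b (gmult G h (\<gamma>, x)) = L\<^sub>b h o\<^sub>L L\<^sub>b (\<gamma>, x)"
    using L unfolding coefficient_module_def AE_arrows by blast
  from AE_orbit[OF this] AE_free AE_space[of M] show ?thesis
  proof eventually_elim
    case (elim x)
    show ?case
    proof (intro ballI)
      fix u v w assume uvw: "u \<in> Orb x" "v \<in> Orb x" "w \<in> Orb x"
      have sp: "u \<in> space M" "v \<in> space M" using uvw orbit_space elim(3) by blast+
      have "v \<in> Orb u" using uvw orbit_eq elim(3) by blast
      then have "source G (arr v w) = target G (arr u v)" by (simp add: target_arr)
      moreover obtain \<gamma> where \<gamma>: "arr u v = (\<gamma>, u)" "\<gamma> \<in> carrier \<Gamma>"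
        using arr_in[OF sp(1), of v] by (auto simp: arr_def semidirect_simps)
      ultimately have "L\<^sub>b (gmult G (arr v w) (arr u v)) = L\<^sub>b (arr v w) o\<^sub>L L\<^sub>b (arr u v)"
        using elim(1) uvw(1) arr_in[OF sp(2), of w] unfolding \<gamma>(1) by blast
      then show "L\<^sub>b (arr v w) o\<^sub>L L\<^sub>b (arr u v) = L\<^sub>b (arr u w)"
        using arr_mult[OF elim(2,3)] uvw by simp
    qed
  qed
qed

text \<open>Multiplicativity makes the operator of a unit idempotent, and an isometric idempotent is
  the identity because it kills the difference between a vector and its image.\<close>

lemma module_id:
  assumes L: "coefficient_module G L\<^sub>b"
  shows "AE x in M. \<forall>u\<in>Orb x. L\<^sub>b (arr u u) = id_blinfun"
  using module_cocycle[OF L] AE_space[of M]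
proof eventually_elim
  case (elim x)
  show ?case
  proof
    fix u assume u: "u \<in> Orb x"
    then have iso: "norm (L\<^sub>b (arr u u) v) = norm v" for v
      using L arr_in orbit_space elim(2) by (simp add: coefficient_module_def)
    show "L\<^sub>b (arr u u) = id_blinfun"
    proof (rule blinfun_eqI)
      fix v
      have "L\<^sub>b (arr u u) (L\<^sub>b (arr u u) v) = L\<^sub>b (arr u u) v"
        using elim(1) u by (metis blinfun_apply_blinfun_compose)
      then have "L\<^sub>b (arr u u) (L\<^sub>b (arr u u) v - v) = 0" by (simp add: blinfun.diff_right)
      then show "L\<^sub>b (arr u u) v = id_blinfun v" using iso[of "L\<^sub>b (arr u u) v - v"] by simp
    qed
  qed
qed

lemma contragredient_arr:
  "AE x in M. \<forall>u\<in>Orb x. \<forall>v\<in>Orb x. \<forall>\<zeta>. contragredient G L\<^sub>b (arr u v) \<zeta> = \<zeta> o\<^sub>L L\<^sub>b (arr v u)"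
  using AE_free AE_space[of M] by eventually_elim (simp add: contragredient_def arr_ginv)

end

section \<open>The isomorphism from a pair of orbit maps\<close>

context two_actions
begin

text \<open>Pulling back along \<open>p\<close> needs no twist, because the \<Gamma>-action is by
  definition \<open>L\<close> along the arrows from p z to p x. Pulling back along \<open>q\<close>
  needs \<open>b\<close>. In both composites, returning to the original base point by invariance
  costs exactly the operator that \<open>b\<close> undoes.\<close>

theorem isometric_iso_of_orbit_maps:
  fixes L\<^sub>b :: "'l \<times> 'y \<Rightarrow> ('e::{banach, second_countable_topology} \<Rightarrow>\<^sub>L 'e)"
  defines "L \<equiv> contragredient T.G L\<^sub>b"
  assumes p: "orbit_map \<Gamma> \<phi> M \<nu> \<kappa> \<Lambda> \<psi> N \<nu>' \<kappa>' p" and q: "orbit_map \<Lambda> \<psi> N \<nu>' \<kappa>' \<Gamma> \<phi> M \<nu> \<kappa> q"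
    and qp: "AE x in M. q (p x) \<in> S.Orb x" and pq: "AE y in N. p (q y) \<in> T.Orb y"
    and L: "coefficient_module T.G L\<^sub>b"
    and F: "AE g in arrows S.G. F g = T.arr (p (source S.G g)) (p (target S.G g))"
  shows "\<exists>\<Phi>. isometric_iso (Hmb T.G \<nu>' \<kappa>' L k) (Hmb S.G \<nu> \<kappa> (\<lambda>g. L (F g)) k) \<Phi> \<and>
    induced_by T.G \<nu>' \<kappa>' S.G \<nu> \<kappa> L k F \<Phi>"
proof -
  interpret P: orbit_map \<Gamma> \<phi> M \<nu> \<kappa> \<Lambda> \<psi> N \<nu>' \<kappa>' p by (rule p)
  interpret Q: orbit_map \<Lambda> \<psi> N \<nu>' \<kappa>' \<Gamma> \<phi> M \<nu> \<kappa> q by (rule q)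
  define A where "A g = L (F g)" for g
  have L_lin: "linear (L g)" for g unfolding L_def by (rule T.linear_contragredient)
  have A_lin: "linear (A g)" for g unfolding A_def by (rule L_lin)
  \<comment> \<open>\<open>F\<close> is known on arrows with a good source, whereas here the arrows
    end at x; \<open>AE_orbit\<close> makes all sources in the orbit good.\<close>
  have F_arr: "AE x in M. \<forall>z\<in>S.Orb x. F (S.arr z x) = T.arr (p z) (p x)"
  proof -
    have "AE x in M. \<forall>\<gamma>\<in>carrier \<Gamma>. F (\<gamma>, x) = T.arr (p x) (p (\<phi> \<gamma> x))"
      using F unfolding S.AE_arrows by (simp add: S.semidirect_simps)
    from S.AE_orbit[OF this] AE_space[of M] show ?thesis
    proof eventually_elim
      case (elim x)
      show ?case
      proof
        fix z assume z: "z \<in> S.Orb x"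
        then have "z \<in> space M" "x \<in> S.Orb z" using S.orbit_space S.orbit_sym elim(2) by blast+
        then obtain \<gamma> where "S.arr z x = (\<gamma>, z)" "\<gamma> \<in> carrier \<Gamma>" "\<phi> \<gamma> z = x"
          using S.arr_in[of z x] S.target_arr[of x z] by (auto simp: S.arr_def S.semidirect_simps)
        then show "F (S.arr z x) = T.arr (p z) (p x)" using elim(1) z by metis
      qed
    qed
  qed
  have L_arr: "AE y in N. \<forall>u\<in>T.Orb y. \<forall>v\<in>T.Orb y. \<forall>\<zeta>. L (T.arr u v) \<zeta> = \<zeta> o\<^sub>L L\<^sub>b (T.arr v u)"
    unfolding L_def by (rule T.contragredient_arr)
  note Lb_mult = T.module_cocycle[OF L] and Lb_id = T.module_id[OF L]
  define b where "b y = L\<^sub>b (T.arr y (p (q y)))" for y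
  have pq_meas: "(\<lambda>y. p (q y)) \<in> N \<rightarrow>\<^sub>M N"
    by (rule measurable_compose[OF Q.p_measurable P.p_measurable])
  have qp_meas: "(\<lambda>x. q (p x)) \<in> M \<rightarrow>\<^sub>M M"
    by (rule measurable_compose[OF P.p_measurable Q.p_measurable])
  have pq_orb: "AE y in N. \<forall>w\<in>T.Orb y. p (q w) \<in> T.Orb y"
    using T.AE_orbit[OF pq] AE_space[of N] by eventually_elim (use T.orbit_eq in blast)
  interpret f: chain_map \<Gamma> \<phi> M \<nu> \<kappa> \<Lambda> \<psi> N \<nu>' \<kappa>' p "\<lambda>_. id_blinfun :: 'e \<Rightarrow>\<^sub>L 'e" A L
  proof
    show "AE x in M. norm (id_blinfun :: 'e \<Rightarrow>\<^sub>L 'e) \<le> 1" by (simp add: norm_blinfun_id_le)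
    show "AE x in M. \<forall>z\<in>S.Orb x. \<forall>\<zeta>.
        A (S.arr z x) (\<zeta> o\<^sub>L id_blinfun) = L (T.arr (p z) (p x)) \<zeta> o\<^sub>L id_blinfun"
      using F_arr by eventually_elim (simp add: A_def)
  qed simp
  interpret g: chain_map \<Lambda> \<psi> N \<nu>' \<kappa>' \<Gamma> \<phi> M \<nu> \<kappa> q b L A
  proof
    have arr_meas: "(\<lambda>y. T.arr y (p (q y))) \<in> N \<rightarrow>\<^sub>M arrows T.G"
      using pq_meas by (intro T.measurable_arr) auto
    show "(\<lambda>y. b y v) \<in> borel_measurable N" for v
      unfolding b_def using L by (intro measurable_compose[OF arr_meas]) (simp add: coefficient_module_def)
    show "AE y in N. norm (b y) \<le> 1"
      unfolding b_def using T.module_norm[OF L T.arr_in] by (intro AE_I2)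
    show "AE y in N. \<forall>w\<in>T.Orb y. \<forall>\<zeta>. L (T.arr w y) (\<zeta> o\<^sub>L b w) = A (S.arr (q w) (q y)) \<zeta> o\<^sub>L b y"
      using L_arr Q.p_nonsingular[OF F_arr] Q.p_orbit Lb_mult pq_orb AE_space[of N]
    proof eventually_elim
      case (elim y)
      show ?case
      proof (intro ballI allI)
        fix w \<zeta> assume w: "w \<in> T.Orb y"
        have y: "y \<in> T.Orb y" using elim(6) by (rule T.orbit_refl)
        have pq': "p (q w) \<in> T.Orb y" "p (q y) \<in> T.Orb y" using elim(5) w y by blast+
        \<comment> \<open>The contragredient reverses arrows. Both sides reduce to \<zeta> composed
          with the operator of the arrow from y to p (q w), factored once through w and once through
          p (q y).\<close>
        have "L (T.arr w y) (\<zeta> o\<^sub>L b w) = \<zeta> o\<^sub>L (L\<^sub>b (T.arr w (p (q w))) o\<^sub>L L\<^sub>b (T.arr y w))"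
          using elim(1) w y by (simp add: b_def compose_blinfun_assoc)
        also have "\<dots> = \<zeta> o\<^sub>L L\<^sub>b (T.arr y (p (q w)))"
          using elim(4) w y pq' by simp
        also have "\<dots> = \<zeta> o\<^sub>L (L\<^sub>b (T.arr (p (q y)) (p (q w))) o\<^sub>L L\<^sub>b (T.arr y (p (q y))))"
          using elim(4) w y pq' by simp
        also have "\<dots> = L (T.arr (p (q w)) (p (q y))) \<zeta> o\<^sub>L b y"
          using elim(1) pq' by (simp add: b_def compose_blinfun_assoc)
        also have "\<dots> = A (S.arr (q w) (q y)) \<zeta> o\<^sub>L b y"
          using elim(2,3) w by (simp add: A_def)
        finally show "L (T.arr w y) (\<zeta> o\<^sub>L b w) = A (S.arr (q w) (q y)) \<zeta> o\<^sub>L b y" .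
      qed
    qed
  qed
  have cancel: "AE y in N. \<forall>v\<in>T.Orb y. \<forall>\<zeta>. L (T.arr y v) \<zeta> o\<^sub>L L\<^sub>b (T.arr y v) = \<zeta>"
    using L_arr Lb_mult Lb_id AE_space[of N]
  proof eventually_elim
    case (elim y)
    show ?case
    proof (intro ballI allI)
      fix v \<zeta> assume v: "v \<in> T.Orb y"
      have y: "y \<in> T.Orb y" using elim(4) by (rule T.orbit_refl)
      have "L (T.arr y v) \<zeta> o\<^sub>L L\<^sub>b (T.arr y v) = \<zeta> o\<^sub>L (L\<^sub>b (T.arr v y) o\<^sub>L L\<^sub>b (T.arr y v))"
        using elim(1) v y by (simp add: compose_blinfun_assoc)
      also have "\<dots> = \<zeta>" using elim(2,3) v y by simp
      finally show "L (T.arr y v) \<zeta> o\<^sub>L L\<^sub>b (T.arr y v) = \<zeta>" .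
    qed
  qed
  have gf: "(\<lambda>hs. g.cmap k (f.cmap k \<xi>) hs - \<xi> hs) \<in> coboundaries T.G \<nu>' \<kappa>' L k"
    if \<xi>: "\<xi> \<in> cocycles T.G \<nu>' \<kappa>' L k" for \<xi>
  proof (rule T.homotopic_to_identity[OF L_lin pq_meas pq \<xi>])
    show "g.cmap k (f.cmap k \<xi>) \<in> cochains T.G \<nu>' \<kappa>' L k"
      using \<xi> f.cmap_cochain g.cmap_cochain by (simp add: cocycles_def)
    have "AE y in N. \<forall>w\<in>T.Orb y. \<forall>ys. (\<forall>i<k+1. ys i \<in> T.Orb y) \<longrightarrow>
        L (T.arr w y) (\<xi> (T.coord (k+1) w ys)) = \<xi> (T.coord (k+1) y ys)"
      using \<xi> unfolding cocycles_def T.cochains_iff by blast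
    from T.AE_orbit[OF this] pq_orb g.cmap_coord[of k] Q.p_nonsingular[OF f.cmap_coord[of k]] cancel AE_space[of N]
    show "AE y in N. \<forall>ys. (\<forall>i<k+1. ys i \<in> T.Orb y) \<longrightarrow>
        g.cmap k (f.cmap k \<xi>) (T.coord (k+1) y ys) = \<xi> (T.coord (k+1) y (\<lambda>j. p (q (ys j))))"
    proof eventually_elim
      case (elim y)
      show ?case
      proof (intro allI impI)
        fix ys assume ys: "\<forall>i<k+1. ys i \<in> T.Orb y"
        have y: "y \<in> T.Orb y" using elim(6) by (rule T.orbit_refl)
        have v: "p (q y) \<in> T.Orb y" and orb: "T.Orb (p (q y)) = T.Orb y"
          using elim(2) y T.orbit_eq elim(6) by blast+
        define zs where "zs = (\<lambda>j. p (q (ys j)))"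
        have zs: "\<forall>j<k+1. zs j \<in> T.Orb y" using elim(2) ys by (simp add: zs_def)
        have "\<forall>j<k+1. q (ys j) \<in> S.Orb (q y)"
          and 1: "g.cmap k (f.cmap k \<xi>) (T.coord (k+1) y ys) = f.cmap k \<xi> (S.coord (k+1) (q y) (\<lambda>j. q (ys j))) o\<^sub>L b y"
          using elim(3) ys by blast+
        then have 2: "f.cmap k \<xi> (S.coord (k+1) (q y) (\<lambda>j. q (ys j))) = \<xi> (T.coord (k+1) (p (q y)) zs)"
          using elim(4) unfolding zs_def by simp
        \<comment> \<open>Invariance moves the base point from p (q y) back to y; the resulting
          operator is cancelled by \<open>b y\<close>.\<close>
        have 3: "\<xi> (T.coord (k+1) (p (q y)) zs) = L (T.arr y (p (q y))) (\<xi> (T.coord (k+1) y zs))"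
          using elim(1)[THEN bspec, OF v, THEN bspec, THEN spec, THEN mp, of y zs] y zs unfolding orb by simp
        show "g.cmap k (f.cmap k \<xi>) (T.coord (k+1) y ys) = \<xi> (T.coord (k+1) y (\<lambda>j. p (q (ys j))))"
          unfolding 1 2 3 b_def zs_def[symmetric] using elim(5) v by blast
      qed
    qed
  qed
  have fg: "(\<lambda>gs. f.cmap k (g.cmap k \<eta>) gs - \<eta> gs) \<in> coboundaries S.G \<nu> \<kappa> A k"
    if \<eta>: "\<eta> \<in> cocycles S.G \<nu> \<kappa> A k" for \<eta>
  proof (rule S.homotopic_to_identity[OF A_lin qp_meas qp \<eta>])
    show "f.cmap k (g.cmap k \<eta>) \<in> cochains S.G \<nu> \<kappa> A k"
      using \<eta> f.cmap_cochain g.cmap_cochain by (simp add: cocycles_def)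
    have qp_orb: "AE x in M. \<forall>z\<in>S.Orb x. q (p z) \<in> S.Orb x"
      using S.AE_orbit[OF qp] AE_space[of M] by eventually_elim (use S.orbit_eq in blast)
    have "AE x in M. \<forall>z\<in>S.Orb x. \<forall>xs. (\<forall>i<k+1. xs i \<in> S.Orb x) \<longrightarrow>
        A (S.arr z x) (\<eta> (S.coord (k+1) z xs)) = \<eta> (S.coord (k+1) x xs)"
      using \<eta> unfolding cocycles_def S.cochains_iff by blast
    from S.AE_orbit[OF this] S.AE_orbit[OF F_arr] qp_orb f.cmap_coord[of k]
      P.p_nonsingular[OF g.cmap_coord[of k]] P.p_nonsingular[OF cancel] P.p_nonsingular[OF pq] AE_space[of M]
    show "AE x in M. \<forall>xs. (\<forall>i<k+1. xs i \<in> S.Orb x) \<longrightarrow>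
        f.cmap k (g.cmap k \<eta>) (S.coord (k+1) x xs) = \<eta> (S.coord (k+1) x (\<lambda>j. q (p (xs j))))"
    proof eventually_elim
      case (elim x)
      show ?case
      proof (intro allI impI)
        fix xs assume xs: "\<forall>i<k+1. xs i \<in> S.Orb x"
        have x: "x \<in> S.Orb x" using elim(8) by (rule S.orbit_refl)
        have v: "q (p x) \<in> S.Orb x" and orb: "S.Orb (q (p x)) = S.Orb x"
          using elim(3) x S.orbit_eq elim(8) by blast+
        define zs where "zs = (\<lambda>j. q (p (xs j)))"
        have zs: "\<forall>j<k+1. zs j \<in> S.Orb x" using elim(3) xs by (simp add: zs_def)
        have "\<forall>j<k+1. p (xs j) \<in> T.Orb (p x)"
          and 1: "f.cmap k (g.cmap k \<eta>) (S.coord (k+1) x xs) = g.cmap k \<eta> (T.coord (k+1) (p x) (\<lambda>j. p (xs j)))"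
          using elim(4) xs by simp_all
        then have 2: "g.cmap k \<eta> (T.coord (k+1) (p x) (\<lambda>j. p (xs j))) = \<eta> (S.coord (k+1) (q (p x)) zs) o\<^sub>L b (p x)"
          using elim(5)[THEN spec, THEN mp, of "\<lambda>j. p (xs j)"] unfolding zs_def by blast
        have "\<eta> (S.coord (k+1) (q (p x)) zs) = A (S.arr x (q (p x))) (\<eta> (S.coord (k+1) x zs))"
          using elim(1)[THEN bspec, OF v, THEN bspec, THEN spec, THEN mp, of x zs] x zs unfolding orb by simp
        \<comment> \<open>The cost of returning from q (p x) to x is expressed by \<open>A\<close>;
          through \<open>F\<close> it becomes the operator that the twist at p x cancels.\<close>
        also have "\<dots> = L (T.arr (p x) (p (q (p x)))) (\<eta> (S.coord (k+1) x zs))"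
          using elim(2)[THEN bspec, OF v, THEN bspec, of x] x unfolding orb by (simp add: A_def)
        finally have 3: "\<eta> (S.coord (k+1) (q (p x)) zs) = L (T.arr (p x) (p (q (p x)))) (\<eta> (S.coord (k+1) x zs))" .
        show "f.cmap k (g.cmap k \<eta>) (S.coord (k+1) x xs) = \<eta> (S.coord (k+1) x (\<lambda>j. q (p (xs j))))"
          unfolding 1 2 3 b_def zs_def[symmetric] using elim(6,7) by blast
      qed
    qed
  qed
  interpret FS: function_quotient "cocycles S.G \<nu> \<kappa> A k" "coboundaries S.G \<nu> \<kappa> A k"
    by (rule S.cohomology_function_quotient[OF A_lin])
  interpret FT: function_quotient "cocycles T.G \<nu>' \<kappa>' L k" "coboundaries T.G \<nu>' \<kappa>' L k"
    by (rule T.cohomology_function_quotient[OF L_lin])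
  interpret E: quotient_equivalence
    "cocycles T.G \<nu>' \<kappa>' L k" "coboundaries T.G \<nu>' \<kappa>' L k" "cocycles S.G \<nu> \<kappa> A k" "coboundaries S.G \<nu> \<kappa> A k"
    "f.cmap k" "g.cmap k"
    "Linf_norm (tuple_measure T.G \<nu>' \<kappa>' (k + 1))" "Linf_norm (tuple_measure S.G \<nu> \<kappa> (k + 1))"
  proof
    show "0 \<le> Linf_norm (tuple_measure T.G \<nu>' \<kappa>' (k + 1)) \<xi>" if "\<xi> \<in> cocycles T.G \<nu>' \<kappa>' L k" for \<xi>
      using that T.cochain_norm_nonneg[of \<xi> L k] by (simp add: cocycles_def)
    show "0 \<le> Linf_norm (tuple_measure S.G \<nu> \<kappa> (k + 1)) \<eta>" if "\<eta> \<in> cocycles S.G \<nu> \<kappa> A k" for \<eta>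
      using that S.cochain_norm_nonneg[of \<eta> A k] by (simp add: cocycles_def)
    show "Linf_norm (tuple_measure S.G \<nu> \<kappa> (k + 1)) (f.cmap k \<xi>) \<le> Linf_norm (tuple_measure T.G \<nu>' \<kappa>' (k + 1)) \<xi>"
      if "\<xi> \<in> cocycles T.G \<nu>' \<kappa>' L k" for \<xi>
      using that f.cmap_norm by (simp add: cocycles_def)
    show "Linf_norm (tuple_measure T.G \<nu>' \<kappa>' (k + 1)) (g.cmap k \<eta>) \<le> Linf_norm (tuple_measure S.G \<nu> \<kappa> (k + 1)) \<eta>"
      if "\<eta> \<in> cocycles S.G \<nu> \<kappa> A k" for \<eta>
      using that g.cmap_norm by (simp add: cocycles_def)
  qed (rule f.cmap_lin g.cmap_lin f.cmap_cocycle g.cmap_cocycle f.cmap_coboundaries g.cmap_coboundaries gf fg; assumption)+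
  have HT: "Hmb T.G \<nu>' \<kappa>' L k = FT.quotient_space (Linf_norm (tuple_measure T.G \<nu>' \<kappa>' (k + 1)))"
    by (rule T.Hmb_eq_quotient_space[OF L_lin])
  have HS: "Hmb S.G \<nu> \<kappa> A k = FS.quotient_space (Linf_norm (tuple_measure S.G \<nu> \<kappa> (k + 1)))"
    by (rule S.Hmb_eq_quotient_space[OF A_lin])
  have "induced_by T.G \<nu>' \<kappa>' S.G \<nu> \<kappa> L k F E.induced"
    unfolding induced_by_def
  proof (intro ballI)
    fix P \<xi> assume P: "P \<in> vcarrier (Hmb T.G \<nu>' \<kappa>' L k)" "\<xi> \<in> P"
    \<comment> \<open>\<open>F\<close> maps the arrow from xs i to x to the arrow from p (xs i) to p
      x, so \<open>f.cmap\<close> is a representative, measurable everywhere, of composition with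
      \<open>F\<close>.\<close>
    have "AE gs in tuple_measure S.G \<nu> \<kappa> (k + 1). f.cmap k \<xi> gs = \<xi> (\<lambda>i\<in>{..<k + 1}. F (gs i))"
    proof (subst S.AE_coord)
      show "AE x in M. \<forall>xs. (\<forall>i<k+1. xs i \<in> S.Orb x) \<longrightarrow>
          f.cmap k \<xi> (S.coord (k+1) x xs) = \<xi> (\<lambda>i\<in>{..<k + 1}. F (S.coord (k+1) x xs i))"
        using f.cmap_coord[of k] F_arr
      proof eventually_elim
        case (elim x)
        show ?case
        proof (intro allI impI)
          fix xs assume xs: "\<forall>i<k+1. xs i \<in> S.Orb x"
          then have "(\<lambda>i\<in>{..<k + 1}. F (S.coord (k+1) x xs i)) = T.coord (k+1) (p x) (\<lambda>j. p (xs j))"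
            using elim(2) by (auto simp: S.coord_def T.coord_def)
          then show "f.cmap k \<xi> (S.coord (k+1) x xs) = \<xi> (\<lambda>i\<in>{..<k + 1}. F (S.coord (k+1) x xs i))"
            using elim(1) xs by simp
        qed
      qed
    qed simp
    moreover have "f.cmap k \<xi> \<in> E.induced P"
      using P by (intro E.mem_induced) (simp_all add: HT FT.quotient_space_def)
    ultimately show "\<exists>\<xi>'\<in>E.induced P. AE gs in tuple_measure S.G \<nu> \<kappa> (k + 1). \<xi>' gs = \<xi> (\<lambda>i\<in>{..<k + 1}. F (gs i))"
      by blast
  qed
  then show ?thesis
    using E.isometric_iso_induced unfolding HT[symmetric] HS[symmetric] A_def by blast
qed

end

section \<open>Orbit equivalences\<close>

text \<open>Finiteness of \<open>M\<close> keeps the scaling factor away from 0, so scaling does not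
  change null sets.\<close>

lemma AE_normalized_restriction:
  assumes "finite_measure M" "U \<in> sets M" "0 < emeasure M U"
  shows "(AE x in normalized_restriction M U. P x) \<longleftrightarrow> (AE x in M. x \<in> U \<longrightarrow> P x)"
proof -
  interpret finite_measure M by fact
  let ?R = "restrict_space M U"
  have "1 / emeasure M U \<noteq> 0"
    using emeasure_finite[of U] by (simp add: divide_ennreal_def ennreal_inverse_eq_0_iff)
  then have "null_sets (normalized_restriction M U) = null_sets ?R"
    by (auto simp: null_sets_def normalized_restriction_def)
  then have "(AE x in normalized_restriction M U. P x) \<longleftrightarrow> (AE x in ?R. P x)"
    unfolding eventually_ae_filter by (simp add: normalized_restriction_def space_scale_measure)
  also have "\<dots> \<longleftrightarrow> (AE x in M. x \<in> U \<longrightarrow> P x)"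
    using assms(2) by (intro AE_restrict_space_iff) simp
  finally show ?thesis .
qed

lemma normalized_restriction_space:
  assumes "prob_space M"
  shows "normalized_restriction M (space M) = M"
proof -
  interpret prob_space M by fact
  have "restrict_space M (space M) = M"
    by (rule measure_eqI) (auto simp: sets_restrict_space emeasure_restrict_space dest: sets.sets_into_space
        intro!: image_eqI[where f="\<lambda>A. space M \<inter> A"] sets.Int)
  then show ?thesis by (simp add: normalized_restriction_def emeasure_space_1)
qed

context pmp_action
begin

text \<open>Each point is moved by the first group element, in a fixed enumeration, that sends it
  into \<open>W\<close>; the index of this element is measurable.\<close>

lemma measurable_section:
  assumes W: "W \<in> sets M" and AE: "AE x in M. \<exists>\<gamma>\<in>carrier \<Gamma>. \<phi> \<gamma> x \<in> W"
  obtains \<rho> where "\<rho> \<in> M \<rightarrow>\<^sub>M M" "AE x in M. \<rho> x \<in> Orb x \<and> \<rho> x \<in> W"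
proof
  define en where "en = from_nat_into (carrier \<Gamma>)"
  have en: "en n \<in> carrier \<Gamma>" for n
    by (simp add: en_def from_nat_into carrier_ne)
  define \<rho> where "\<rho> x = \<phi> (en (LEAST n. \<phi> (en n) x \<in> W)) x" for x
  have "Measurable.pred M (\<lambda>x. \<phi> (en n) x \<in> W)" for n
    using measurable_sets[OF measurable_action[OF en] W] by (simp add: pred_def vimage_def Int_def conj_commute)
  then have "(\<lambda>x. LEAST n. \<phi> (en n) x \<in> W) \<in> M \<rightarrow>\<^sub>M count_space UNIV"
    by (rule measurable_Least)
  then show "\<rho> \<in> M \<rightarrow>\<^sub>M M"
    unfolding \<rho>_def by (rule measurable_compose_countable[OF measurable_action[OF en]])
  show "AE x in M. \<rho> x \<in> Orb x \<and> \<rho> x \<in> W"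
    using AE
  proof eventually_elim
    case (elim x)
    then obtain \<gamma> where \<gamma>: "\<gamma> \<in> carrier \<Gamma>" "\<phi> \<gamma> x \<in> W" by blast
    then have "\<exists>n. \<phi> (en n) x \<in> W"
      using from_nat_into_surj[OF countable_group] unfolding en_def by metis
    then have "\<rho> x \<in> W" unfolding \<rho>_def by (rule LeastI_ex)
    then show ?case unfolding \<rho>_def using orbitI[OF en] by blast
  qed
qed

text \<open>The saturation \<open>A\<close> of \<open>W\<close> is invariant and contains
  \<open>W\<close>, hence is not null; ergodicity makes it conull.\<close>

lemma ergodic_AE_visits:
  assumes erg: "ergodic_action \<Gamma> \<phi> M" and W: "W \<in> sets M" "0 < emeasure M W"
  shows "AE x in M. \<exists>\<gamma>\<in>carrier \<Gamma>. \<phi> \<gamma> x \<in> W"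
proof -
  interpret group \<Gamma> by (rule group_Gamma)
  define A where "A = {x \<in> space M. \<exists>\<gamma>\<in>carrier \<Gamma>. \<phi> \<gamma> x \<in> W}"
  have A: "A \<in> sets M"
    unfolding A_def
  proof (rule sets.sets_Collect_countable_Ex'[OF _ countable_group])
    fix \<gamma> assume "\<gamma> \<in> carrier \<Gamma>"
    from measurable_sets[OF measurable_action[OF this] W(1)]
    show "{x \<in> space M. \<phi> \<gamma> x \<in> W} \<in> sets M" by (simp add: vimage_def Int_def conj_commute)
  qed
  have sub: "\<phi> \<delta> x \<in> A" if \<delta>: "\<delta> \<in> carrier \<Gamma>" and A: "x \<in> A" for \<delta> x
  proof -
    obtain \<gamma> where \<gamma>: "\<gamma> \<in> carrier \<Gamma>" "\<phi> \<gamma> x \<in> W" and x: "x \<in> space M" using A by (auto simp: A_def)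
    have "\<phi> (\<gamma> \<otimes> inv \<delta>) (\<phi> \<delta> x) = \<phi> \<gamma> x"
      using \<delta> \<gamma>(1) x by (simp add: composition_rule orbit_sym_aux)
    then show ?thesis using \<delta> \<gamma> x by (auto simp: A_def intro!: bexI[of _ "\<gamma> \<otimes> inv \<delta>"])
  qed
  have "\<phi> \<delta> ` A = A" if "\<delta> \<in> carrier \<Gamma>" for \<delta>
  proof
    show "\<phi> \<delta> ` A \<subseteq> A" using sub that by blast
    show "A \<subseteq> \<phi> \<delta> ` A"
    proof
      fix x assume x: "x \<in> A"
      then have "\<phi> \<delta> (\<phi> (inv \<delta>) x) = x"
        using orbit_sym_aux[of "inv \<delta>" x] that by (simp add: A_def)
      moreover have "\<phi> (inv \<delta>) x \<in> A" using sub x that by simp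
      ultimately show "x \<in> \<phi> \<delta> ` A" by (metis image_eqI)
    qed
  qed
  then have "A \<in> null_sets M \<or> space M - A \<in> null_sets M"
    by (intro erg[unfolded ergodic_action_def, THEN bspec, OF A, THEN mp] ballI)
  moreover have "W \<subseteq> A"
    using sets.sets_into_space[OF W(1)] act_one by (force simp: A_def intro!: bexI[of _ \<one>])
  then have "A \<notin> null_sets M"
    using W(2) emeasure_mono[of W A M] A by (auto simp: null_sets_def)
  ultimately have "AE x in M. x \<notin> space M - A" by (blast intro: AE_not_in)
  then show ?thesis using AE_space[of M] by eventually_elim (simp add: A_def)
qed

end

context two_actions
begin

text \<open>Extends a map from \<open>W\<close> to the whole space by first moving points into
  \<open>W\<close> along their orbits.\<close>

lemma orbit_map_of_section:
  assumes W: "W \<in> sets M" and t: "t \<in> restrict_space M W \<rightarrow>\<^sub>M N"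
    and nonsingular: "\<And>P. (AE y in N. P y) \<Longrightarrow> (AE x in M. x \<in> W \<longrightarrow> P (t x))"
    and orbits: "\<And>u u'. u \<in> W \<Longrightarrow> u' \<in> W \<Longrightarrow> u' \<in> S.Orb u \<Longrightarrow> t u' \<in> T.Orb (t u)"
    and \<rho>: "\<rho> \<in> M \<rightarrow>\<^sub>M M" "AE x in M. \<rho> x \<in> S.Orb x \<and> \<rho> x \<in> W"
    and c: "c \<in> space N"
  shows "orbit_map \<Gamma> \<phi> M \<nu> \<kappa> \<Lambda> \<psi> N \<nu>' \<kappa>' (\<lambda>x. if \<rho> x \<in> W then t (\<rho> x) else c)"
proof
  have D: "{x \<in> space M. \<rho> x \<in> W} \<in> sets M"
    using measurable_sets[OF \<rho>(1) W] by (simp add: vimage_def Int_def conj_commute)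
  have "\<rho> \<in> restrict_space M {x. \<rho> x \<in> W} \<rightarrow>\<^sub>M restrict_space M W"
    using \<rho>(1) by (intro measurable_restrict_space2 measurable_restrict_space1) (auto simp: space_restrict_space)
  then have "(\<lambda>x. t (\<rho> x)) \<in> restrict_space M {x. \<rho> x \<in> W} \<rightarrow>\<^sub>M N"
    using t by (rule measurable_compose)
  then show "(\<lambda>x. if \<rho> x \<in> W then t (\<rho> x) else c) \<in> M \<rightarrow>\<^sub>M N"
    using c D by (subst measurable_If_restrict_space_iff) auto
  \<comment> \<open>A property valid almost everywhere on \<open>W\<close> holds, by
    \<open>AE_orbit\<close>, at all points of \<open>W\<close> in almost every orbit, in particular
    at \<rho> x.\<close>
  show "AE x in M. P (if \<rho> x \<in> W then t (\<rho> x) else c)" if "AE y in N. P y" for P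
    using S.AE_orbit[OF nonsingular[OF that]] \<rho>(2) by eventually_elim auto
  show "AE x in M. \<forall>z\<in>S.Orb x. (if \<rho> z \<in> W then t (\<rho> z) else c) \<in> T.Orb (if \<rho> x \<in> W then t (\<rho> x) else c)"
    using S.AE_orbit[OF \<rho>(2)] AE_space[of M]
  proof eventually_elim
    case (elim x)
    show ?case
    proof
      fix z assume z: "z \<in> S.Orb x"
      have x: "x \<in> S.Orb x" using elim(2) by (rule S.orbit_refl)
      have "\<rho> z \<in> S.Orb x" "\<rho> x \<in> S.Orb x" "\<rho> z \<in> W" "\<rho> x \<in> W"
        using elim(1) z x S.orbit_eq[OF elim(2) z] by auto
      then show "(if \<rho> z \<in> W then t (\<rho> z) else c) \<in> T.Orb (if \<rho> x \<in> W then t (\<rho> x) else c)"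
        using orbits[of "\<rho> x" "\<rho> z"] S.orbit_eq[OF elim(2), of "\<rho> x"] by simp
    qed
  qed
qed

text \<open>\<open>F\<close> is prescribed only on arrows, so that for the unit section it can be
  \<open>oe_hom\<close> itself. The condition \<open>visits\<close> is the common denominator of
  ergodicity and of \<open>V\<close> being the whole space.\<close>

theorem weak_orbit_equivalence_isometric_iso:
  fixes L\<^sub>b :: "'l \<times> 'y \<Rightarrow> ('e::{banach, second_countable_topology} \<Rightarrow>\<^sub>L 'e)"
  defines "L \<equiv> contragredient T.G L\<^sub>b"
  assumes oe: "weak_orbit_equivalence \<Gamma> \<phi> M U \<Lambda> \<psi> N V t"
    and \<theta>: "retracting_section S.G U \<theta>"
    and visits: "AE y in N. \<exists>l\<in>carrier \<Lambda>. \<psi> l y \<in> V"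
    and L: "coefficient_module T.G L\<^sub>b"
    and F: "\<And>g. g \<in> space (arrows S.G) \<Longrightarrow> F g = oe_hom \<phi> \<Lambda> \<psi> t (retract S.G \<theta> g)"
  shows "\<exists>\<Phi>. isometric_iso (Hmb T.G \<nu>' \<kappa>' L k) (Hmb S.G \<nu> \<kappa> (\<lambda>g. L (F g)) k) \<Phi> \<and>
    induced_by T.G \<nu>' \<kappa>' S.G \<nu> \<kappa> L k F \<Phi>"
proof -
  \<comment> \<open>The exchanged pair of actions, for which the inverse of \<open>t\<close> plays
    the part of \<open>t\<close>.\<close>
  interpret R: two_actions \<Lambda> \<psi> N \<nu>' \<kappa>' \<Gamma> \<phi> M \<nu> \<kappa> ..
  let ?M = "normalized_restriction M U" and ?N = "normalized_restriction N V"
  have U: "U \<in> sets M" "0 < emeasure M U" and V: "V \<in> sets N" "0 < emeasure N V"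
    and t_OE: "orbit_equivalence \<Gamma> \<phi> ?M \<Lambda> \<psi> ?N t"
    using oe unfolding weak_orbit_equivalence_def by auto
  have sets_M: "sets ?M = sets (restrict_space M U)" and sets_N: "sets ?N = sets (restrict_space N V)"
    by (auto simp: normalized_restriction_def)
  note AE_M = AE_normalized_restriction[OF S.finite_measure_axioms U]
  note AE_N = AE_normalized_restriction[OF T.finite_measure_axioms V]
  obtain X' Y' where t: "t \<in> ?M \<rightarrow>\<^sub>M ?N" "distr ?M ?N t = ?N" and XY: "X' \<in> sets ?M" "Y' \<in> sets ?N"
    and AE_XY: "AE x in ?M. x \<in> X'" "AE y in ?N. y \<in> Y'" and bij: "bij_betw t X' Y'"
    and s: "the_inv_into X' t \<in> restrict_space ?N Y' \<rightarrow>\<^sub>M restrict_space ?M X'"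
    and orb: "\<And>x. x \<in> X' \<Longrightarrow> t ` (S.Orb x \<inter> X') = T.Orb (t x) \<inter> Y'"
    using t_OE unfolding orbit_equivalence_def by auto
  define s where "s = the_inv_into X' t"
  have X': "X' \<in> sets M" "X' \<subseteq> U" and Y': "Y' \<in> sets N" "Y' \<subseteq> V"
    using XY U(1) V(1) by (auto simp: sets_M sets_N sets_restrict_space_iff)
  have s_t: "s (t x) = x" "t x \<in> Y'" if "x \<in> X'" for x
    using bij that by (auto simp: s_def bij_betw_def the_inv_into_f_f)
  have t_s: "t (s y) = y" "s y \<in> X'" if "y \<in> Y'" for y
    using bij that by (auto simp: s_def bij_betw_def f_the_inv_into_f the_inv_into_into)

  have t_meas: "t \<in> restrict_space M X' \<rightarrow>\<^sub>M N"
  proof -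
    have "t \<in> restrict_space M U \<rightarrow>\<^sub>M restrict_space N V"
      using t(1) by (simp add: measurable_cong_sets[OF sets_M sets_N])
    then show ?thesis
      using X'(2) by (auto simp: measurable_restrict_space2_iff intro: measurable_restrict_mono)
  qed
  have s_meas: "s \<in> restrict_space N Y' \<rightarrow>\<^sub>M M"
  proof -
    have "sets (restrict_space ?N Y') = sets (restrict_space (restrict_space N V) Y')"
      by (rule sets_restrict_space_cong[OF sets_N])
    also have "\<dots> = sets (restrict_space N Y')"
      using Y'(2) V(1) by (simp add: restrict_restrict_space Int_absorb1 Y')
    finally have eqN: "sets (restrict_space ?N Y') = sets (restrict_space N Y')" .
    have "sets (restrict_space ?M X') = sets (restrict_space (restrict_space M U) X')"
      by (rule sets_restrict_space_cong[OF sets_M])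
    also have "\<dots> = sets (restrict_space M X')"
      using X'(2) U(1) by (simp add: restrict_restrict_space Int_absorb1 X')
    finally have eqM: "sets (restrict_space ?M X') = sets (restrict_space M X')" .
    show ?thesis
      using s unfolding s_def measurable_cong_sets[OF eqN eqM] by (simp add: measurable_restrict_space2_iff)
  qed
  have t_ns: "AE x in M. x \<in> X' \<longrightarrow> P (t x)" if "AE y in N. P y" for P
  proof -
    have "AE y in ?N. P y" using that unfolding AE_N by eventually_elim simp
    then have "AE x in ?M. P (t x)" using AE_distrD[OF t(1), where P=P] unfolding t(2) by blast
    then show ?thesis unfolding AE_M by eventually_elim (use X'(2) in blast)
  qed
  have s_ns: "AE y in N. y \<in> Y' \<longrightarrow> P (s y)" if "AE x in M. P x" for P
  proof -
    obtain A where A: "A \<in> null_sets M" "{x \<in> space M. \<not> P x} \<subseteq> A"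
      using \<open>AE x in M. P x\<close> unfolding eventually_ae_filter by blast
    \<comment> \<open>On X' the preimage of \<open>B\<close> under \<open>t\<close> lies in the null
      set \<open>A\<close>. Since \<open>t\<close> pushes one measure to the other, \<open>B\<close>
      is null.\<close>
    define B where "B = s -` A \<inter> space (restrict_space N Y')"
    have "B \<in> sets (restrict_space N Y')"
      unfolding B_def using A(1) by (intro measurable_sets[OF s_meas]) auto
    then have B: "B \<in> sets N" "B \<subseteq> Y'"
      using Y'(1) by (auto simp: sets_restrict_space_iff)
    then have B': "B \<in> sets ?N"
      using Y'(2) V(1) by (auto simp: sets_N sets_restrict_space_iff)
    have "AE x in ?M. x \<notin> A"
      unfolding AE_M using AE_not_in[OF A(1)] by eventually_elim simp
    with AE_XY(1) have "AE x in ?M. t x \<notin> B"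
      by eventually_elim (auto simp: B_def s_t)
    then have "AE y in distr ?M ?N t. y \<notin> B"
      using B' by (subst AE_distr_iff[OF t(1)]) auto
    then have "AE y in N. y \<in> V \<longrightarrow> y \<notin> B"
      unfolding t(2) AE_N .
    then show ?thesis
      using AE_space[of N]
    proof eventually_elim
      case (elim y)
      show ?case
      proof
        assume y: "y \<in> Y'"
        then have "s y \<notin> A" using elim Y' by (auto simp: B_def space_restrict_space)
        moreover have "s y \<in> space M" using t_s(2)[OF y] sets.sets_into_space[OF X'(1)] by blast
        ultimately show "P (s y)" using A(2) by blast
      qed
    qed
  qed
  have t_orb: "t u' \<in> T.Orb (t u)" if "u \<in> X'" "u' \<in> X'" "u' \<in> S.Orb u" for u u'
    using orb[OF that(1)] that by blast
  have s_orb: "s v' \<in> S.Orb (s v)" if v: "v \<in> Y'" "v' \<in> Y'" "v' \<in> T.Orb v" for v v'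
  proof -
    have "v' \<in> t ` (S.Orb (s v) \<inter> X')"
      using orb[OF t_s(2)[OF v(1)]] v t_s(1)[OF v(1)] by simp
    then show ?thesis using s_t(1) by auto
  qed

  define \<rho> where "\<rho> x = target S.G (\<theta> x)" for x
  have \<theta>_meas: "\<theta> \<in> M \<rightarrow>\<^sub>M arrows S.G" and \<theta>_AE: "AE x in M. source S.G (\<theta> x) = x \<and> \<rho> x \<in> U"
    using \<theta> unfolding retracting_section_def S.semidirect_simps(2) \<rho>_def by blast+
  have \<rho>_meas: "\<rho> \<in> M \<rightarrow>\<^sub>M M"
    unfolding \<rho>_def by (rule measurable_compose[OF \<theta>_meas S.measurable_target])
  \<comment> \<open>\<open>\<theta>\<close> is only known to end in \<open>U\<close>, but
    \<open>t\<close> is controlled on X' alone; almost every orbit avoids the null set between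
    them.\<close>
  have "AE x in M. x \<in> U \<longrightarrow> x \<in> X'" using AE_XY(1) unfolding AE_M .
  from S.AE_orbit[OF this] \<theta>_AE AE_space[of M]
  have \<rho>_AE: "AE x in M. source S.G (\<theta> x) = x \<and> \<rho> x \<in> S.Orb x \<and> \<rho> x \<in> X'"
  proof eventually_elim
    case (elim x)
    have "\<rho> x \<in> S.Orb x"
      using S.source_in_orbit(3)[OF measurable_space[OF \<theta>_meas elim(3)]] elim(2) by (simp add: \<rho>_def)
    then show ?case using elim by blast
  qed
  then have \<rho>: "AE x in M. \<rho> x \<in> S.Orb x \<and> \<rho> x \<in> X'" by eventually_elim simp
  have "AE y in N. y \<in> V \<longrightarrow> y \<in> Y'" using AE_XY(2) unfolding AE_N .
  from T.AE_orbit[OF this] visits have "AE y in N. \<exists>l\<in>carrier \<Lambda>. \<psi> l y \<in> Y'"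
    by eventually_elim (use T.orbitI in blast)
  from T.measurable_section[OF Y'(1) this]
  obtain \<sigma> where \<sigma>: "\<sigma> \<in> N \<rightarrow>\<^sub>M N" "AE y in N. \<sigma> y \<in> T.Orb y \<and> \<sigma> y \<in> Y'" by blast
  obtain x0 y0 where x0: "x0 \<in> space M" and y0: "y0 \<in> space N"
    using S.not_empty T.not_empty by blast
  \<comment> \<open>The first branch applies almost everywhere; the constant y0 keeps
    \<open>p\<close> measurable everywhere.\<close>
  define p where "p x = (if \<rho> x \<in> X' then t (\<rho> x) else y0)" for x
  define q where "q y = (if \<sigma> y \<in> Y' then s (\<sigma> y) else x0)" for y
  have p_map: "orbit_map \<Gamma> \<phi> M \<nu> \<kappa> \<Lambda> \<psi> N \<nu>' \<kappa>' p"
    unfolding p_def by (rule orbit_map_of_section[OF X'(1) t_meas t_ns t_orb \<rho>_meas \<rho> y0])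
  have q_map: "orbit_map \<Lambda> \<psi> N \<nu>' \<kappa>' \<Gamma> \<phi> M \<nu> \<kappa> q"
    unfolding q_def by (rule R.orbit_map_of_section[OF Y'(1) s_meas s_ns s_orb \<sigma> x0])
  interpret P: orbit_map \<Gamma> \<phi> M \<nu> \<kappa> \<Lambda> \<psi> N \<nu>' \<kappa>' p by (rule p_map)
  interpret Q: orbit_map \<Lambda> \<psi> N \<nu>' \<kappa>' \<Gamma> \<phi> M \<nu> \<kappa> q by (rule q_map)
  have qp: "AE x in M. q (p x) \<in> S.Orb x"
    using P.p_nonsingular[OF \<sigma>(2)] \<rho> AE_space[of M]
  proof eventually_elim
    case (elim x)
    then have px: "p x = t (\<rho> x)" by (simp add: p_def)
    \<comment> \<open>\<open>t\<close> maps the part of an orbit in X' onto the whole part of the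
      image orbit in Y'. This surjectivity leads back to the orbit of x.\<close>
    have "\<sigma> (p x) \<in> t ` (S.Orb (\<rho> x) \<inter> X')"
      using elim orb[of "\<rho> x"] px by simp
    then have "s (\<sigma> (p x)) \<in> S.Orb (\<rho> x)" using s_t(1) by auto
    then show ?case using elim S.orbit_eq by (simp add: q_def)
  qed
  have pq: "AE y in N. p (q y) \<in> T.Orb y"
    using Q.p_nonsingular[OF \<rho>] \<sigma>(2) AE_space[of N]
  proof eventually_elim
    case (elim y)
    then have qy: "q y = s (\<sigma> y)" by (simp add: q_def)
    have "t (\<rho> (q y)) \<in> T.Orb (t (q y))"
      using elim t_orb[of "q y" "\<rho> (q y)"] t_s(2)[of "\<sigma> y"] qy by simp
    also have "T.Orb (t (q y)) = T.Orb y"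
      using elim t_s(1)[of "\<sigma> y"] T.orbit_eq qy by simp
    finally show ?case using elim by (simp add: p_def)
  qed
  have "AE g in arrows S.G. F g = T.arr (p (source S.G g)) (p (target S.G g))"
    unfolding S.AE_arrows
    using S.AE_orbit[OF \<rho>_AE] P.p_orbit P.p_nonsingular[OF T.AE_free] AE_space[of M]
  proof eventually_elim
    case (elim x)
    show ?case
    proof
      fix \<gamma> assume \<gamma>: "\<gamma> \<in> carrier \<Gamma>"
      interpret group \<Gamma> by (rule S.group_Gamma)
      have x: "x \<in> S.Orb x" "\<phi> \<gamma> x \<in> S.Orb x" using S.orbit_refl elim(4) S.orbitI[OF \<gamma>] by blast+
      have sp: "\<phi> \<gamma> x \<in> space M" using \<gamma> elim(4) by simp
      obtain \<beta> where \<beta>: "\<theta> x = (\<beta>, x)" "\<beta> \<in> carrier \<Gamma>"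
        using measurable_space[OF \<theta>_meas elim(4)] elim(1) x(1) by (cases "\<theta> x") (auto simp: S.semidirect_simps)
      obtain \<alpha> where \<alpha>: "\<theta> (\<phi> \<gamma> x) = (\<alpha>, \<phi> \<gamma> x)" "\<alpha> \<in> carrier \<Gamma>"
        using measurable_space[OF \<theta>_meas sp] elim(1) x(2) by (cases "\<theta> (\<phi> \<gamma> x)") (auto simp: S.semidirect_simps)
      have \<rho>x: "\<rho> x = \<phi> \<beta> x" "\<rho> (\<phi> \<gamma> x) = \<phi> \<alpha> (\<phi> \<gamma> x)"
        using \<alpha> \<beta> by (simp_all add: \<rho>_def S.semidirect_simps)
      have p: "p x = t (\<phi> \<beta> x)" "p (\<phi> \<gamma> x) = t (\<phi> \<alpha> (\<phi> \<gamma> x))"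
        using elim(1)[THEN bspec, OF x(1)] elim(1)[THEN bspec, OF x(2)] by (simp_all add: p_def \<rho>x)
      \<comment> \<open>The retracted arrow leads from \<rho> x to \<rho> (\<gamma> x), the points
        at which \<open>p\<close> evaluates \<open>t\<close>.\<close>
      have ret: "retract S.G \<theta> (\<gamma>, x) = (\<alpha> \<otimes>\<^bsub>\<Gamma>\<^esub> \<gamma> \<otimes>\<^bsub>\<Gamma>\<^esub> inv\<^bsub>\<Gamma>\<^esub> \<beta>, \<phi> \<beta> x)"
        using \<alpha>(1) \<beta>(1) by (simp add: retract_def S.semidirect_simps)
      have act: "\<phi> (\<alpha> \<otimes>\<^bsub>\<Gamma>\<^esub> \<gamma> \<otimes>\<^bsub>\<Gamma>\<^esub> inv\<^bsub>\<Gamma>\<^esub> \<beta>) (\<phi> \<beta> x) = \<phi> \<alpha> (\<phi> \<gamma> x)"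
        using \<alpha>(2) \<beta>(2) \<gamma> elim(4) by (simp add: S.composition_rule S.orbit_sym_aux)
      obtain l where l: "T.arr (p x) (p (\<phi> \<gamma> x)) = (l, p x)" "l \<in> carrier \<Lambda>"
        using T.arr_in[OF P.p_space[OF elim(4)]] by (auto simp: T.arr_def T.semidirect_simps)
      have "p (\<phi> \<gamma> x) \<in> T.Orb (p x)" using elim(2) x(2) by blast
      from T.target_arr[OF this] have l_act: "p (\<phi> \<gamma> x) = \<psi> l (p x)"
        by (simp add: l T.semidirect_simps)
      have stab: "stabilizer \<Lambda> \<psi> (p x) = {\<one>\<^bsub>\<Lambda>\<^esub>}"
        using elim(3) T.orbit_refl[OF P.p_space[OF elim(4)]] by blast
      \<comment> \<open>Freeness at p x makes the definite description in \<open>oe_cocycle\<close>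
        well defined.\<close>
      have "oe_cocycle \<phi> \<Lambda> \<psi> t (\<alpha> \<otimes>\<^bsub>\<Gamma>\<^esub> \<gamma> \<otimes>\<^bsub>\<Gamma>\<^esub> inv\<^bsub>\<Gamma>\<^esub> \<beta>) (\<phi> \<beta> x) = l"
        unfolding oe_cocycle_def act p[symmetric]
      proof (rule the_equality)
        show "l \<in> carrier \<Lambda> \<and> p (\<phi> \<gamma> x) = \<psi> l (p x)" using l(2) l_act by blast
        show "l' = l" if "l' \<in> carrier \<Lambda> \<and> p (\<phi> \<gamma> x) = \<psi> l' (p x)" for l'
          using T.free_unique[OF stab P.p_space[OF elim(4)] _ l(2)] that l_act by metis
      qed
      then show "F (\<gamma>, x) = T.arr (p (source S.G (\<gamma>, x))) (p (target S.G (\<gamma>, x)))"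
        using F[of "(\<gamma>, x)"] \<gamma> elim(4) by (simp add: S.semidirect_simps ret oe_hom_def l(1) p(1)[symmetric])
    qed
  qed
  then show ?thesis
    unfolding L_def by (rule isometric_iso_of_orbit_maps[OF p_map q_map qp pq L])
qed

end

lemma isometric_iso_imp_seminormed_iso: "isometric_iso V W \<Phi> \<Longrightarrow> seminormed_iso V W \<Phi>"
  unfolding isometric_iso_def seminormed_iso_def by (auto intro!: exI[of _ 1])

theorem corollary4p13:
  fixes \<Gamma> :: "('g, 'm) monoid_scheme" and \<phi> :: "'g \<Rightarrow> 'x \<Rightarrow> 'x" and X :: "'x measure"
    and \<Lambda> :: "('l, 'n) monoid_scheme" and \<psi> :: "'l \<Rightarrow> 'y \<Rightarrow> 'y" and Y :: "'y measure"
    and \<nu>\<^sub>X :: "('g \<times> 'x) measure" and \<kappa>\<^sub>X :: "'x \<Rightarrow> ('g \<times> 'x) measure"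
    and \<nu>\<^sub>Y :: "('l \<times> 'y) measure" and \<kappa>\<^sub>Y :: "'y \<Rightarrow> ('l \<times> 'y) measure"
    and L\<^sub>b :: "'l \<times> 'y \<Rightarrow> ('e::{banach, second_countable_topology} \<Rightarrow>\<^sub>L 'e)"
  defines "GX \<equiv> semidirect \<Gamma> \<phi> X" and "HY \<equiv> semidirect \<Lambda> \<psi> Y"
  defines "L \<equiv> contragredient HY L\<^sub>b"
  assumes "pmp_action \<Gamma> \<phi> X" and "essentially_free \<Gamma> \<phi> X"
    and "pmp_action \<Lambda> \<psi> Y" and "essentially_free \<Lambda> \<psi> Y"
    and "symmetric_class_prob GX \<nu>\<^sub>X" and "disintegration GX \<nu>\<^sub>X \<kappa>\<^sub>X"
    and "symmetric_class_prob HY \<nu>\<^sub>Y" and "disintegration HY \<nu>\<^sub>Y \<kappa>\<^sub>Y"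
    and "coefficient_module HY L\<^sub>b"
  shows "(\<forall>T. orbit_equivalence \<Gamma> \<phi> X \<Lambda> \<psi> Y T \<longrightarrow>
            (\<forall>k. \<exists>\<Phi>. isometric_iso (Hmb HY \<nu>\<^sub>Y \<kappa>\<^sub>Y L k)
                       (Hmb GX \<nu>\<^sub>X \<kappa>\<^sub>X (\<lambda>g. L (oe_hom \<phi> \<Lambda> \<psi> T g)) k) \<Phi>)) \<and>
         (ergodic_action \<Gamma> \<phi> X \<and> ergodic_action \<Lambda> \<psi> Y \<longrightarrow>
            (\<forall>U V T \<theta>. weak_orbit_equivalence \<Gamma> \<phi> X U \<Lambda> \<psi> Y V T \<and> retracting_section GX U \<theta> \<longrightarrow>
               (\<forall>k. \<exists>\<Phi>. seminormed_iso (Hmb HY \<nu>\<^sub>Y \<kappa>\<^sub>Y L k)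
                          (Hmb GX \<nu>\<^sub>X \<kappa>\<^sub>X (\<lambda>g. L (oe_hom \<phi> \<Lambda> \<psi> T (retract GX \<theta> g))) k) \<Phi> \<and>
                        induced_by HY \<nu>\<^sub>Y \<kappa>\<^sub>Y GX \<nu>\<^sub>X \<kappa>\<^sub>X L k
                          (\<lambda>g. oe_hom \<phi> \<Lambda> \<psi> T (retract GX \<theta> g)) \<Phi>)))"
proof -
  interpret two_actions \<Gamma> \<phi> X \<nu>\<^sub>X \<kappa>\<^sub>X \<Lambda> \<psi> Y \<nu>\<^sub>Y \<kappa>\<^sub>Y
    using assms unfolding GX_def HY_def
    by (intro two_actions.intro measured_action.intro measured_action_axioms.intro)
  have module: "coefficient_module (semidirect \<Lambda> \<psi> Y) L\<^sub>b" using assms unfolding HY_def by simp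
  note iso = weak_orbit_equivalence_isometric_iso[OF _ _ _ module, folded GX_def HY_def, folded L_def]
  have "\<exists>\<Phi>. isometric_iso (Hmb HY \<nu>\<^sub>Y \<kappa>\<^sub>Y L k) (Hmb GX \<nu>\<^sub>X \<kappa>\<^sub>X (\<lambda>g. L (oe_hom \<phi> \<Lambda> \<psi> T g)) k) \<Phi>"
    if T: "orbit_equivalence \<Gamma> \<phi> X \<Lambda> \<psi> Y T" for T k
  proof -
    interpret group \<Gamma> by (rule S.group_Gamma)
    interpret \<Lambda>: group \<Lambda> by (rule T.group_Gamma)
    \<comment> \<open>The unit section: with \<open>U\<close> the whole space no point has to be
      moved, so \<open>retract\<close> is the identity on arrows.\<close>
    define \<theta> where "\<theta> x = (\<one>\<^bsub>\<Gamma>\<^esub>, x)" for x :: 'x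
    have weak: "weak_orbit_equivalence \<Gamma> \<phi> X (space X) \<Lambda> \<psi> Y (space Y) T"
      using T by (simp add: weak_orbit_equivalence_def normalized_restriction_space S.prob_space_axioms
          T.prob_space_axioms S.emeasure_space_1 T.emeasure_space_1)
    have "\<theta> \<in> X \<rightarrow>\<^sub>M arrows S.G"
      unfolding \<theta>_def S.arrows_eq by (intro measurable_Pair measurable_const) simp_all
    then have sec: "retracting_section GX (space X) \<theta>"
      unfolding retracting_section_def GX_def by (auto simp: S.semidirect_simps \<theta>_def)
    \<comment> \<open>The unit of \<Lambda> is a witness, in the place where part (2) invokes
      ergodicity.\<close>
    have visits: "AE y in Y. \<exists>l\<in>carrier \<Lambda>. \<psi> l y \<in> space Y"
      using \<Lambda>.one_closed T.act_space by blast
    have "oe_hom \<phi> \<Lambda> \<psi> T g = oe_hom \<phi> \<Lambda> \<psi> T (retract GX \<theta> g)" if "g \<in> space (arrows GX)" for g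
    proof -
      have "retract GX \<theta> g = g"
        using that by (auto simp: GX_def S.semidirect_simps retract_def \<theta>_def)
      then show ?thesis by simp
    qed
    from iso[OF weak sec visits this] show ?thesis by blast
  qed
  moreover have "\<exists>\<Phi>. seminormed_iso (Hmb HY \<nu>\<^sub>Y \<kappa>\<^sub>Y L k)
        (Hmb GX \<nu>\<^sub>X \<kappa>\<^sub>X (\<lambda>g. L (oe_hom \<phi> \<Lambda> \<psi> T (retract GX \<theta> g))) k) \<Phi> \<and>
      induced_by HY \<nu>\<^sub>Y \<kappa>\<^sub>Y GX \<nu>\<^sub>X \<kappa>\<^sub>X L k (\<lambda>g. oe_hom \<phi> \<Lambda> \<psi> T (retract GX \<theta> g)) \<Phi>"
    if erg: "ergodic_action \<Lambda> \<psi> Y"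
      and weak: "weak_orbit_equivalence \<Gamma> \<phi> X U \<Lambda> \<psi> Y V T" and sec: "retracting_section GX U \<theta>" for U V T \<theta> k
  proof -
    have "AE y in Y. \<exists>l\<in>carrier \<Lambda>. \<psi> l y \<in> V"
      using weak by (intro T.ergodic_AE_visits[OF erg]) (auto simp: weak_orbit_equivalence_def)
    from iso[OF weak sec this refl] show ?thesis
      using isometric_iso_imp_seminormed_iso by blast
  qed
  ultimately show ?thesis by blast
qed

end
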